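(* Let $d\ge2$ and let $\xi,\xi_1,\xi_2,\ldots$ be i.i.d. random variables in $\mathbb{R}^d$ with $\mathbb{E}[\|\xi\|^2]<\infty$ and $\mathbb{E}\xi=\mu$ with $\|\mu\|>0$. Let $S_0:=0$, $S_n:=\sum_{i=1}^n\xi_i$, and let $\mathcal{V}_n$ be the $d$-dimensional volume (Lebesgue measure) of $\operatorname{hull}\{S_0,\ldots,S_n\}$. Then, as $n\to\infty$, $$n^{-(d+1)/2}\,\mathcal{V}_n\ \longrightarrow\ \|\mu\|\sqrt{\det\Sigma_{\mu_\perp}}\;\tilde v_d\quad\text{in distribution},$$ where $\tilde v_d$ is the $d$-dimensional volume of $\tilde h_d:=\operatorname{hull}\{\tilde b_d(t):t\in[0,1]\}$.
   Context: $\operatorname{hull}$ is the convex hull. Let $\{u_1,\ldots,u_d\}$ be an orthonormal basis of $\mathbb{R}^d$ with $u_1=\mu/\|\mu\|$, let $\xi'_\perp:=(\xi\cdot u_2,\ldots,\xi\cdot u_d)^{\top}$, and let $\Sigma_{\mu_\perp}:=\mathbb{E}[\xi'_\perp(\xi'_\perp)^{\top}]$, a $(d-1)\times(d-1)$ matrix. Let $\tilde b_d(t):=(t,b_{d-1}(t))$ for $t\in[0,1]$, where $b_{d-1}$ is standard $(d-1)$-dimensional Brownian motion started at $0$ with continuous paths. *)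

theory Defs
  imports "HOL-Probability.Probability"
begin

text \<open>The conjuncts on measurability matter: \<^const>\<open>distr\<close> and \<^const>\<open>weak_conv_m\<close> are
  total, and carry no information about functions that are not random variables.  The limit may
  live on a different probability space.\<close>

definition converges_in_distribution ::
  "'w measure \<Rightarrow> (nat \<Rightarrow> 'w \<Rightarrow> real) \<Rightarrow> 'v measure \<Rightarrow> ('v \<Rightarrow> real) \<Rightarrow> bool" where
  "converges_in_distribution M X N Y \<longleftrightarrow>
     (\<forall>n. X n \<in> borel_measurable M) \<and> Y \<in> borel_measurable N \<and>
     weak_conv_m (\<lambda>n. distr M borel (X n)) (distr N borel Y)"

text \<open>The product of one-dimensional normal densities is the density of the centred normal law
  with covariance matrix \<open>(t - s) I\<close>.\<close>

definition standard_brownian_motion ::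
  "'v measure \<Rightarrow> (real \<Rightarrow> 'v \<Rightarrow> real ^ 'm) \<Rightarrow> bool" where
  "standard_brownian_motion N b \<longleftrightarrow>
     prob_space N \<and>
     (\<forall>t\<ge>0. b t \<in> borel_measurable N) \<and>
     (\<forall>\<omega>\<in>space N. b 0 \<omega> = 0) \<and>
     (\<forall>(n::nat) t. 0 \<le> t 0 \<and> (\<forall>k<n. t k < t (Suc k)) \<longrightarrow>
        prob_space.indep_vars N (\<lambda>_. borel) (\<lambda>k \<omega>. b (t (Suc k)) \<omega> - b (t k) \<omega>) {..<n}) \<and>
     (\<forall>s t. 0 \<le> s \<and> s < t \<longrightarrow>
        distributed N lborel (\<lambda>\<omega>. b t \<omega> - b s \<omega>)
          (\<lambda>x. ennreal (\<Prod>i\<in>UNIV. normal_density 0 (sqrt (t - s)) (x $ i)))) \<and>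
     (\<forall>\<omega>\<in>space N. continuous_on {0..} (\<lambda>t. b t \<omega>))"

definition orthonormal_basis :: "('i \<Rightarrow> 'a::euclidean_space) \<Rightarrow> bool" where
  "orthonormal_basis u \<longleftrightarrow>
     (\<forall>i j. u i \<bullet> u j = (if i = j then 1 else 0)) \<and> span (range u) = UNIV"

text \<open>A basis \<open>u\<^sub>1, \<dots>, u\<^sub>d\<close> is indexed by \<^typ>\<open>'m option\<close>, where \<^typ>\<open>'m\<close> has \<open>d - 1\<close>
  elements: \<^const>\<open>None\<close> stands for the index \<open>1\<close> and the values of \<^const>\<open>Some\<close> for
  \<open>2, \<dots>, d\<close>.\<close>

definition perp_coords :: "('m option \<Rightarrow> real ^ 'n) \<Rightarrow> real ^ 'n \<Rightarrow> real ^ 'm" where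
  "perp_coords u x = (\<chi> i. x \<bullet> u (Some i))"

definition second_moment_matrix :: "'w measure \<Rightarrow> ('w \<Rightarrow> real ^ 'm) \<Rightarrow> real ^ 'm ^ 'm" where
  "second_moment_matrix M Z = (\<chi> i j. integral\<^sup>L M (\<lambda>\<omega>. Z \<omega> $ i * Z \<omega> $ j))"

definition partial_sum :: "(nat \<Rightarrow> 'w \<Rightarrow> real ^ 'n) \<Rightarrow> nat \<Rightarrow> 'w \<Rightarrow> real ^ 'n" where
  "partial_sum \<xi> n \<omega> = (\<Sum>i=1..n. \<xi> i \<omega>)"

definition walk_hull_volume :: "(nat \<Rightarrow> 'w \<Rightarrow> real ^ 'n) \<Rightarrow> nat \<Rightarrow> 'w \<Rightarrow> real" where
  "walk_hull_volume \<xi> n \<omega> =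
     measure lborel (convex hull ((\<lambda>k. partial_sum \<xi> k \<omega>) ` {0..n}))"

text \<open>The space-time path \<open>t \<mapsto> (t, b t)\<close> lives in \<^typ>\<open>real \<times> real ^ 'm\<close>, which serves as
  \<open>d\<close>-dimensional Euclidean space; its \<^const>\<open>lborel\<close> is \<open>d\<close>-dimensional Lebesgue measure.\<close>

definition spacetime_hull_volume :: "(real \<Rightarrow> 'v \<Rightarrow> real ^ 'm) \<Rightarrow> 'v \<Rightarrow> real" where
  "spacetime_hull_volume b \<omega> = measure lborel (convex hull ((\<lambda>t. (t, b t \<omega>)) ` {0..1}))"

end

theory Submission
  imports Defs
begin

text \<open>The functional central limit theorem is bypassed by discretizing at \<open>k\<close> equally spaced times.
  In coordinates along and orthogonal to \<open>\<mu>\<close>, rescaled by \<open>1 / n\<close> and \<open>1 / \<surd>n\<close>, the walk is close to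
  a path \<open>(t, b t)\<close>.  For bounded convex sets the volume of the hull is Lipschitz with respect to the
  Hausdorff distance, because the volume swept by translating a convex set in a fixed direction
  grows at a nondecreasing rate.  By Etemadi's maximal inequality and the fourth moment of the
  normal law, keeping only the \<open>k + 1\<close> block end points changes the hull by little in probability,
  uniformly in large \<open>n\<close>.  For fixed \<open>k\<close> the volume is a continuous function of the block
  increments, whose joint law converges because all linear forms do (characteristic functions and
  the Stone--Weierstrass theorem).  Finally \<open>k \<rightarrow> \<infinity>\<close> by continuity of the Brownian path, and a matrix
  \<open>A\<close> with \<open>A A\<^sup>T = \<Sigma>\<close> contributes the factor \<open>\<bar>det A\<bar>\<close>.\<close>

section \<open>Volume of convex hulls under small perturbations\<close>

text \<open>Splitting the walk into \<open>k\<close> blocks costs a union bound over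
  \<open>k\<close> oscillations, each of variance of order \<open>1 / k\<close>. Chebyshev's
  inequality bounds each of them by a multiple of \<open>1 / k\<close>, and the total does not
  become small; a fourth moment gives \<open>1 / k^2\<close>. Only the Gaussian limit has to possess
  it, so two moments of the steps suffice.

  Along the drift the fluctuations have order \<open>sqrt n\<close> but are divided by
  \<open>n\<close>: they vanish, and this coordinate turns into deterministic time. Across the drift
  the divisor is \<open>sqrt n\<close>. One factor \<open>n\<close> and \<open>d - 1\<close> factors
  \<open>sqrt n\<close> make up the power \<open>(d + 1) / 2\<close> of \<open>n\<close>.

  The Lipschitz bound for the volume is uniform over subsets of a fixed ball and includes flat
  hulls. Hence one \<open>k\<close> serves all large \<open>n\<close>, and a singular covariance
  matrix needs no separate treatment; for the same reason \<open>A\<close> comes from an elimination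
  that skips vanishing pivots.\<close>

definition sweep :: "'a::euclidean_space set \<Rightarrow> 'a \<Rightarrow> real \<Rightarrow> 'a set" where
  "sweep A e s = (\<lambda>(a, t). a + t *\<^sub>R e) ` (A \<times> {0..s})"

lemma compact_sweep: "compact A \<Longrightarrow> compact (sweep A e s)"
  unfolding sweep_def
  by (intro compact_continuous_image compact_Times compact_Icc)
     (auto intro!: continuous_intros simp: split_beta)

lemma convex_sweep:
  assumes "convex A"
  shows "convex (sweep A e s)"
proof -
  have "linear (\<lambda>(a, t). a + t *\<^sub>R e)"
    by (auto intro!: linearI simp: algebra_simps)
  then show ?thesis
    unfolding sweep_def using assms by (intro convex_linear_image convex_Times) auto
qed

lemma sweep_0: "sweep A e 0 = A"
  by (force simp: sweep_def)

lemma sweep_mono: "s \<le> t \<Longrightarrow> sweep A e s \<subseteq> sweep A e t"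
  by (auto simp: sweep_def)

lemma sweep_subset_cball:
  assumes "A \<subseteq> cball 0 R" "norm e \<le> 1"
  shows "sweep A e s \<subseteq> cball 0 (R + s)"
proof
  fix x assume "x \<in> sweep A e s"
  then obtain a t where x: "x = a + t *\<^sub>R e" "a \<in> A" "0 \<le> t" "t \<le> s" by (auto simp: sweep_def)
  have "norm x \<le> norm a + t * norm e" unfolding x(1) using norm_triangle_ineq[of a "t *\<^sub>R e"] x by simp
  also have "t * norm e \<le> t * 1" using x assms by (intro mult_left_mono) auto
  finally show "x \<in> cball 0 (R + s)" using x assms by auto
qed

text \<open>Convexity makes the swept volume grow at a rate that does not decrease: a point reached for the
  first time during the initial time \<open>\<delta>\<close> is, after translation by \<open>s e\<close>, reached for the first time
  between the times \<open>s\<close> and \<open>s + \<delta>\<close>.\<close>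
lemma measure_sweep_superadditive:
  assumes A: "convex A" "compact A" and "0 \<le> s" "0 \<le> \<delta>"
  shows "measure lebesgue (sweep A e \<delta>) - measure lebesgue A
       \<le> measure lebesgue (sweep A e (s + \<delta>)) - measure lebesgue (sweep A e s)"
proof -
  have lm: "sweep A e t \<in> lmeasurable" for t
    using compact_sweep[OF A(2)] lmeasurable_compact by blast
  have lA: "A \<in> lmeasurable" using A lmeasurable_compact by blast
  have AS: "A \<subseteq> sweep A e \<delta>" using sweep_mono[of 0 \<delta> A e] assms by (simp add: sweep_0)
  have "measure lebesgue (sweep A e \<delta>) - measure lebesgue A = measure lebesgue (sweep A e \<delta> - A)"
    using measurable_measure_Diff[OF lm fmeasurableD[OF lA] AS] by simp
  also have "\<dots> = measure lebesgue ((+) (s *\<^sub>R e) ` (sweep A e \<delta> - A))"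
    by (simp add: measure_translation)
  also have "\<dots> \<le> measure lebesgue (sweep A e (s + \<delta>) - sweep A e s)"
  proof (rule measure_mono_fmeasurable)
    show "(+) (s *\<^sub>R e) ` (sweep A e \<delta> - A) \<in> sets lebesgue"
      using lm lA by (intro fmeasurableD measurable_translation fmeasurable.Diff) auto
    show "sweep A e (s + \<delta>) - sweep A e s \<in> lmeasurable"
      using lm by (intro fmeasurable.Diff) auto
    show "(+) (s *\<^sub>R e) ` (sweep A e \<delta> - A) \<subseteq> sweep A e (s + \<delta>) - sweep A e s"
    proof clarify
      fix x assume x: "x \<in> sweep A e \<delta>" "x \<notin> A"
      obtain a t where a: "x = a + t *\<^sub>R e" "a \<in> A" "0 \<le> t" "t \<le> \<delta>" using x by (auto simp: sweep_def)
      have 1: "s *\<^sub>R e + x \<in> sweep A e (s + \<delta>)"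
        unfolding sweep_def using a assms
        by (intro image_eqI[of _ _ "(a, s + t)"]) (auto simp: algebra_simps)
      have 2: "s *\<^sub>R e + x \<notin> sweep A e s"
      proof
        assume "s *\<^sub>R e + x \<in> sweep A e s"
        then obtain a' r where r: "s *\<^sub>R e + x = a' + r *\<^sub>R e" "a' \<in> A" "0 \<le> r" "r \<le> s"
          by (auto simp: sweep_def)
        have a'1: "a' = a + (t + (s - r)) *\<^sub>R e" using r(1) a(1) by (simp add: algebra_simps)
        show False
        proof (cases "t + (s - r) = 0")
          case True
          then have "t = 0" using a r by auto
          then show False using a x by simp
        next
          case False
          then have pos: "t + (s - r) > 0" using a r by auto
          define q where "q = t / (t + (s - r))"
          have q: "0 \<le> q" "q \<le> 1" using pos a r by (auto simp: q_def)
          have "x = (1 - q) *\<^sub>R a + q *\<^sub>R a'"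
          proof -
            have "(1 - q) *\<^sub>R a + q *\<^sub>R a' = a + (q * (t + (s - r))) *\<^sub>R e"
              unfolding a'1 by (simp add: algebra_simps)
            then show ?thesis using pos a(1) by (simp add: q_def)
          qed
          then have "x \<in> A" using A(1) a(2) r(2) q by (simp add: convex_alt)
          then show False using x by simp
        qed
      qed
      show "s *\<^sub>R e + x \<in> sweep A e (s + \<delta>) - sweep A e s" using 1 2 by blast
    qed
  qed
  also have "\<dots> = measure lebesgue (sweep A e (s + \<delta>)) - measure lebesgue (sweep A e s)"
    using measurable_measure_Diff[OF lm fmeasurableD[OF lm] sweep_mono[of s "s + \<delta>" A e]] assms
    by simp
  finally show ?thesis .
qed

lemma measure_sweep_multiple:
  assumes A: "convex A" "compact A" and "0 \<le> \<delta>"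
  shows "real N * (measure lebesgue (sweep A e \<delta>) - measure lebesgue A)
       \<le> measure lebesgue (sweep A e (real N * \<delta>)) - measure lebesgue A"
proof (induction N)
  case 0 then show ?case by (simp add: sweep_0)
next
  case (Suc N)
  have "measure lebesgue (sweep A e \<delta>) - measure lebesgue A
    \<le> measure lebesgue (sweep A e (N * \<delta> + \<delta>)) - measure lebesgue (sweep A e (N * \<delta>))"
    using assms by (intro measure_sweep_superadditive) auto
  then show ?case using Suc by (simp add: algebra_simps)
qed

text \<open>Since the growth rate does not decrease, the initial growth is controlled by the growth
  up to time 1, and the set swept by then still lies in the ball of radius
  \<open>R + 1\<close>.\<close>

lemma measure_sweep_le:
  fixes A :: "'a::euclidean_space set"
  assumes A: "convex A" "compact A" "A \<subseteq> cball 0 R" and "0 \<le> \<delta>" "\<delta> \<le> 1" "norm e \<le> 1"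
  shows "measure lebesgue (sweep A e \<delta>) \<le> measure lebesgue A + 2 * \<delta> * measure lebesgue (cball (0::'a) (R + 1))"
proof (cases "\<delta> = 0")
  case True then show ?thesis by (simp add: sweep_0)
next
  case False
  then have \<delta>: "\<delta> > 0" using assms by simp
  \<comment> \<open>\<open>N\<close> steps of length \<open>\<delta>\<close> fit into the unit of
    time and fill at least half of it; this half is the origin of the factor 2.\<close>
  define N where "N = nat \<lfloor>1 / \<delta>\<rfloor>"
  have "1 \<le> 1 / \<delta>" using \<delta> assms by simp
  then have "1 \<le> N" unfolding N_def by linarith
  have N1: "real N \<le> 1 / \<delta>" "1 / \<delta> < real N + 1" unfolding N_def using \<open>1 \<le> 1/\<delta>\<close>
    by linarith+
  have N2: "real N * \<delta> \<le> 1" using N1(1) \<delta> by (simp add: field_simps)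
  have N3: "1 \<le> 2 * \<delta> * real N"
  proof -
    have "1 < (real N + 1) * \<delta>" using N1(2) \<delta> by (simp add: field_simps)
    also have "\<dots> \<le> (2 * real N) * \<delta>" using \<open>1 \<le> N\<close> \<delta> by (intro mult_right_mono) auto
    finally show ?thesis by (simp add: mult_ac)
  qed
  let ?D = "measure lebesgue (sweep A e \<delta>) - measure lebesgue A"
  have lm: "sweep A e t \<in> lmeasurable" for t
    using compact_sweep[OF A(2)] lmeasurable_compact by blast
  have "measure lebesgue A \<le> measure lebesgue (sweep A e \<delta>)"
    using sweep_mono[of 0 \<delta> A e] assms lm A
    by (intro measure_mono_fmeasurable) (auto simp: sweep_0 lmeasurable_compact fmeasurableD)
  then have D: "0 \<le> ?D" by simp
  have "?D \<le> 2 * \<delta> * (real N * ?D)"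
    using mult_right_mono[OF N3 D] by (simp add: mult_ac)
  also have "real N * ?D \<le> measure lebesgue (sweep A e (real N * \<delta>)) - measure lebesgue A"
    using assms by (intro measure_sweep_multiple) auto
  also have "\<dots> \<le> measure lebesgue (sweep A e (real N * \<delta>))" by simp
  also have "\<dots> \<le> measure lebesgue (cball (0::'a) (R + 1))"
  proof (rule measure_mono_fmeasurable)
    show "sweep A e (real N * \<delta>) \<subseteq> cball 0 (R + 1)"
      using sweep_subset_cball[OF A(3) assms(6)] sweep_mono[OF N2, of A e] by blast
  qed (use lm in auto)
  finally show ?thesis using \<delta> by simp
qed

text \<open>Sweeping along the vectors of \<open>F\<close> in turn makes \<open>A'\<close> contain
  the sum of \<open>A\<close> and a cube of side \<open>\<delta>\<close>. Each sweep enlarges the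
  radius by at most 1, so a ball of radius \<open>R + DIM('a) + 1\<close> serves in every
  step.\<close>

lemma measure_sweep_basis:
  fixes A :: "'a::euclidean_space set" and R :: real
  assumes A: "convex A" "compact A" "A \<subseteq> cball 0 R" and \<delta>: "0 \<le> \<delta>" "\<delta> \<le> 1"
    and F: "finite F" "F \<subseteq> Basis"
  shows "\<exists>A'. convex A' \<and> compact A' \<and> A' \<subseteq> cball 0 (R + card F) \<and>
     measure lebesgue A' \<le> measure lebesgue A + card F * (2 * \<delta> * measure lebesgue (cball (0::'a) (R + DIM('a) + 1))) \<and>
     (\<forall>a\<in>A. \<forall>c. (\<forall>b\<in>F. 0 \<le> c b \<and> c b \<le> \<delta>) \<longrightarrow> a + (\<Sum>b\<in>F. c b *\<^sub>R b) \<in> A')"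
  using F
proof (induction F rule: finite_induct)
  case empty then show ?case using A by (intro exI[of _ A]) auto
next
  let ?V = "measure lebesgue (cball (0::'a) (R + DIM('a) + 1))"
  case (insert e F)
  then obtain A' where A': "convex A'" "compact A'" "A' \<subseteq> cball 0 (R + card F)"
     "measure lebesgue A' \<le> measure lebesgue A + card F * (2 * \<delta> * ?V)"
     "\<And>a c. a \<in> A \<Longrightarrow> (\<forall>b\<in>F. 0 \<le> c b \<and> c b \<le> \<delta>) \<Longrightarrow> a + (\<Sum>b\<in>F. c b *\<^sub>R b) \<in> A'"
    by auto
  have e: "norm e \<le> 1" using insert by auto
  have "card F \<le> DIM('a)" using insert by (intro card_mono) auto
  then have le: "measure lebesgue (cball (0::'a) (R + card F + 1)) \<le> ?V"
    by (intro measure_mono_fmeasurable) auto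
  have "measure lebesgue (sweep A' e \<delta>) \<le> measure lebesgue A' + 2 * \<delta> * measure lebesgue (cball (0::'a) (R + card F + 1))"
    using A' \<delta> e by (intro measure_sweep_le) auto
  also have "\<dots> \<le> measure lebesgue A' + 2 * \<delta> * ?V"
    using le \<delta> by (intro add_left_mono mult_left_mono) auto
  finally have m: "measure lebesgue (sweep A' e \<delta>) \<le> measure lebesgue A + card (insert e F) * (2 * \<delta> * ?V)"
    using A'(4) insert by (simp add: algebra_simps)
  have s: "sweep A' e \<delta> \<subseteq> cball 0 (R + card (insert e F))"
    using sweep_subset_cball[OF A'(3) e, of \<delta>] \<delta> insert by force
  have "a + (\<Sum>b\<in>insert e F. c b *\<^sub>R b) \<in> sweep A' e \<delta>"
    if "a \<in> A" "\<forall>b\<in>insert e F. 0 \<le> c b \<and> c b \<le> \<delta>" for a c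
    unfolding sweep_def using that insert A'(5)[of a c]
    by (intro image_eqI[of _ _ "(a + (\<Sum>b\<in>F. c b *\<^sub>R b), c e)"]) (auto simp: add_ac)
  then show ?case using m s convex_sweep[OF A'(1)] compact_sweep[OF A'(2)] by blast
qed

text \<open>There is one sweep for each dimension. The 4 is the factor 2 of
  \<open>measure_sweep_le\<close> times another 2, because a ball of radius
  \<open>\<epsilon>\<close> needs a cube of side \<open>2 * \<epsilon>\<close>.\<close>

definition hull_lipschitz :: "'a::euclidean_space itself \<Rightarrow> real \<Rightarrow> real" where
  "hull_lipschitz _ R = real DIM('a) * (4 * measure lborel (cball (0::'a) (R + DIM('a) + 1)))"

lemma hull_lipschitz_nonneg: "0 \<le> hull_lipschitz TYPE('a::euclidean_space) R"
  by (simp add: hull_lipschitz_def)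

abbreviation hull_volume :: "'a::euclidean_space set \<Rightarrow> real" where
  "hull_volume S \<equiv> measure lborel (convex hull S)"

text \<open>The sum of \<open>convex hull P\<close> and a ball of radius \<open>\<epsilon>\<close>
  is convex and contains \<open>Q\<close>, hence also its hull; the ball is then replaced by a cube
  reached through sweeps. These run for time \<open>2 * \<epsilon>\<close>, which has to be at most
  1.\<close>

lemma measure_hull_le:
  fixes P Q :: "'a::euclidean_space set"
  assumes "compact P" "compact Q" "P \<subseteq> cball 0 R" "0 \<le> \<epsilon>" "\<epsilon> \<le> 1 / 2"
    and close: "\<And>q. q \<in> Q \<Longrightarrow> \<exists>p\<in>P. dist p q \<le> \<epsilon>"
  shows "hull_volume Q \<le> hull_volume P + hull_lipschitz TYPE('a) R * \<epsilon>"
proof -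
  let ?A = "convex hull P" and ?B = "convex hull Q"
  have cA: "compact ?A" "compact ?B" using assms compact_convex_hull by auto
  have AR: "?A \<subseteq> cball 0 R" using assms by (intro hull_minimal) auto
  obtain A' where A': "convex A'" "compact A'"
     "measure lebesgue A' \<le> measure lebesgue ?A + DIM('a) * (2 * (2 * \<epsilon>) * measure lebesgue (cball (0::'a) (R + DIM('a) + 1)))"
     "\<And>a c. a \<in> ?A \<Longrightarrow> (\<forall>b\<in>Basis. 0 \<le> c b \<and> c b \<le> 2 * \<epsilon>) \<Longrightarrow> a + (\<Sum>b\<in>Basis. c b *\<^sub>R b) \<in> A'"
    using measure_sweep_basis[of ?A R "2 * \<epsilon>" "Basis"] cA AR assms by auto
  have "convex (\<Union>x\<in>?A. \<Union>y\<in>cball 0 \<epsilon>. {x + y})"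
    by (intro convex_sums) auto
  moreover have "Q \<subseteq> (\<Union>x\<in>?A. \<Union>y\<in>cball 0 \<epsilon>. {x + y})"
  proof
    fix q assume "q \<in> Q"
    then obtain p where p: "p \<in> P" "dist p q \<le> \<epsilon>" using close by blast
    have "p \<in> ?A" using p hull_inc by metis
    moreover have "q - p \<in> cball 0 \<epsilon>" using p by (simp add: dist_norm norm_minus_commute)
    ultimately show "q \<in> (\<Union>x\<in>?A. \<Union>y\<in>cball 0 \<epsilon>. {x + y})"
      by (intro UN_I[of p] UN_I[of "q - p"]) auto
  qed
  ultimately have B: "?B \<subseteq> (\<Union>x\<in>?A. \<Union>y\<in>cball 0 \<epsilon>. {x + y})" by (intro hull_minimal)
  \<comment> \<open>Sweeps move only in positive directions. Translation by \<open>?v\<close> takes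
    the cube with coordinates in \<open>[-\<epsilon>, \<epsilon>]\<close> to
    \<open>[0, 2 * \<epsilon>]\<close> and leaves volumes unchanged.\<close>
  let ?v = "\<Sum>b\<in>Basis. \<epsilon> *\<^sub>R b :: 'a"
  have sub: "(+) ?v ` ?B \<subseteq> A'"
  proof clarify
    fix x assume "x \<in> ?B"
    then obtain a y where y: "x = a + y" "a \<in> ?A" "norm y \<le> \<epsilon>" using B by auto
    have "a + (\<Sum>b\<in>Basis. (y \<bullet> b + \<epsilon>) *\<^sub>R b) \<in> A'"
    proof (rule A'(4)[OF y(2)], intro ballI)
      fix b :: 'a assume "b \<in> Basis"
      then have "\<bar>y \<bullet> b\<bar> \<le> \<epsilon>" using Basis_le_norm[of b y] y(3) by linarith
      then show "0 \<le> y \<bullet> b + \<epsilon> \<and> y \<bullet> b + \<epsilon> \<le> 2 * \<epsilon>" by linarith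
    qed
    also have "a + (\<Sum>b\<in>Basis. (y \<bullet> b + \<epsilon>) *\<^sub>R b) = ?v + x"
      by (simp add: y(1) scaleR_add_left sum.distrib euclidean_representation)
    finally show "?v + x \<in> A'" .
  qed
  have "measure lebesgue ?B = measure lebesgue ((+) ?v ` ?B)"
    by (simp add: measure_translation)
  also have "\<dots> \<le> measure lebesgue A'"
    using sub cA A' by (intro measure_mono_fmeasurable fmeasurableD measurable_translation lmeasurable_compact)
  finally have "measure lebesgue ?B \<le> measure lebesgue ?A + DIM('a) * (2 * (2 * \<epsilon>) * measure lebesgue (cball (0::'a) (R + DIM('a) + 1)))"
    using A'(3) by linarith
  then show ?thesis
    using cA by (simp add: hull_lipschitz_def borel_compact mult_ac)
qed

lemma measure_hull_close:
  fixes P Q :: "'a::euclidean_space set"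
  assumes "compact P" "compact Q" "P \<subseteq> cball 0 R" "Q \<subseteq> cball 0 R" "0 \<le> \<epsilon>" "\<epsilon> \<le> 1 / 2"
    and "\<And>q. q \<in> Q \<Longrightarrow> \<exists>p\<in>P. dist p q \<le> \<epsilon>"
    and "\<And>p. p \<in> P \<Longrightarrow> \<exists>q\<in>Q. dist p q \<le> \<epsilon>"
  shows "\<bar>hull_volume P - hull_volume Q\<bar> \<le> hull_lipschitz TYPE('a) R * \<epsilon>"
proof -
  have "hull_volume Q \<le> hull_volume P + hull_lipschitz TYPE('a) R * \<epsilon>"
    using assms by (intro measure_hull_le) auto
  moreover have "hull_volume P \<le> hull_volume Q + hull_lipschitz TYPE('a) R * \<epsilon>"
    using assms by (intro measure_hull_le) (auto simp: dist_commute)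
  ultimately show ?thesis by linarith
qed

text \<open>Used twice: for the measurability of hull volumes of random points, and for the
  continuity of the functional to which convergence in law is applied.\<close>

lemma continuous_measure_hull_finite:
  fixes p :: "'k \<Rightarrow> 'b::topological_space \<Rightarrow> 'a::euclidean_space"
  assumes "finite J" "\<And>j. j \<in> J \<Longrightarrow> continuous_on UNIV (p j)"
  shows "continuous_on UNIV (\<lambda>x. hull_volume ((\<lambda>j. p j x) ` J))"
  unfolding continuous_on_def
proof
  fix x :: 'b
  \<comment> \<open>The additional 1 leaves room for the displaced points, so that both hulls lie in
    the same ball.\<close>
  define R where "R = (\<Sum>j\<in>J. norm (p j x)) + 1"
  have nR: "norm (p j x) \<le> R - 1" if "j \<in> J" for j
    unfolding R_def using member_le_sum[of j J "\<lambda>j. norm (p j x)"] that assms by auto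
  define C where "C = hull_lipschitz TYPE('a) R"
  have C: "0 \<le> C" by (simp add: C_def hull_lipschitz_nonneg)
  show "((\<lambda>x. hull_volume ((\<lambda>j. p j x) ` J)) \<longlongrightarrow> hull_volume ((\<lambda>j. p j x) ` J)) (at x within UNIV)"
  proof (rule tendstoI)
    fix e :: real assume e: "e > 0"
    \<comment> \<open>The Lipschitz estimate is available only for displacements up to
      \<open>1/2\<close>; \<open>C + 1\<close> instead of \<open>C\<close> avoids a division by
      zero.\<close>
    define \<epsilon> where "\<epsilon> = min (1/2) (e / (2 * (C + 1)))"
    have \<epsilon>: "\<epsilon> > 0" "\<epsilon> \<le> 1/2" using e C by (simp_all only: \<epsilon>_def min_less_iff_conj min.cobounded1) auto
    have "C * \<epsilon> \<le> (C + 1) * (e / (2 * (C + 1)))" using C e by (intro mult_mono) (auto simp: \<epsilon>_def)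
    also have "\<dots> = e / 2" using C by (simp add: field_simps)
    finally have Ce: "C * \<epsilon> < e" using e by simp
    have "\<forall>\<^sub>F y in at x. \<forall>j\<in>J. dist (p j y) (p j x) < \<epsilon>"
      using assms \<epsilon> by (intro eventually_ball_finite ballI) (auto simp: continuous_on_def intro!: tendstoD)
    then show "\<forall>\<^sub>F y in at x. dist (hull_volume ((\<lambda>j. p j y) ` J)) (hull_volume ((\<lambda>j. p j x) ` J)) < e"
    proof eventually_elim
      case (elim y)
      have n1: "norm (p j y) \<le> R" if "j \<in> J" for j
        using elim that nR[OF that] \<epsilon> norm_triangle_sub[of "p j y" "p j x"] by (fastforce simp: dist_norm)
      have n2: "norm (p j x) \<le> R" if "j \<in> J" for j using nR[OF that] by simp
      have "\<bar>hull_volume ((\<lambda>j. p j y) ` J) - hull_volume ((\<lambda>j. p j x) ` J)\<bar> \<le> C * \<epsilon>"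
        unfolding C_def
      proof (rule measure_hull_close)
        show "\<exists>a\<in>(\<lambda>j. p j y) ` J. dist a q \<le> \<epsilon>" if "q \<in> (\<lambda>j. p j x) ` J" for q
          using that elim by (auto intro: less_imp_le)
        show "\<exists>q\<in>(\<lambda>j. p j x) ` J. dist a q \<le> \<epsilon>" if "a \<in> (\<lambda>j. p j y) ` J" for a
          using that elim by (auto intro: less_imp_le)
      qed (use \<epsilon> assms(1) n1 n2 in \<open>auto intro: finite_imp_compact\<close>)
      then show ?case using Ce by (simp add: dist_real_def)
    qed
  qed
qed

section \<open>Volume under linear maps\<close>

lemma basis_map_inner:
  fixes f :: "'a::euclidean_space \<Rightarrow> 'b::euclidean_space"
  assumes "linear f" "bij_betw f Basis Basis"
  shows "f x \<bullet> f y = x \<bullet> y"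
proof -
  have *: "f b \<bullet> f c = (if b = c then 1 else 0)" if "b \<in> Basis" "c \<in> Basis" for b c
  proof -
    have "f b \<in> Basis" "f c \<in> Basis" "f b = f c \<longleftrightarrow> b = c"
      using that assms(2) by (auto simp: bij_betw_def inj_on_def)
    then show ?thesis by (simp add: inner_Basis)
  qed
  have "f x \<bullet> f y = f (\<Sum>b\<in>Basis. (x \<bullet> b) *\<^sub>R b) \<bullet> f (\<Sum>c\<in>Basis. (y \<bullet> c) *\<^sub>R c)"
    by (simp only: euclidean_representation)
  also have "\<dots> = (\<Sum>c\<in>Basis. (y \<bullet> c) * (\<Sum>b\<in>Basis. (x \<bullet> b) * (f b \<bullet> f c)))"
    by (simp only: linear_sum[OF assms(1)] linear_scale[OF assms(1)] inner_sum_left inner_sum_right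
        inner_scaleR_left inner_scaleR_right)
  also have "\<dots> = (\<Sum>c\<in>Basis. (y \<bullet> c) * (\<Sum>b\<in>Basis. (x \<bullet> b) * (if b = c then 1 else 0)))"
    by (intro sum.cong refl arg_cong2[of _ _ _ _ "(*)"]) (simp_all add: *)
  also have "\<dots> = x \<bullet> y"
    by (simp add: euclidean_inner[of x y] if_distrib[of "\<lambda>z. _ * z"] mult.commute cong: if_cong)
  finally show ?thesis .
qed

lemma ex_basis_map:
  assumes "DIM('a::euclidean_space) = DIM('b::euclidean_space)"
  shows "\<exists>f::'a \<Rightarrow> 'b. linear f \<and> bij_betw f Basis Basis"
proof -
  obtain h :: "'a \<Rightarrow> 'b" where h: "bij_betw h Basis Basis"
    using finite_same_card_bij[OF finite_Basis finite_Basis assms] by blast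
  define f where "f x = (\<Sum>b\<in>Basis. (x \<bullet> b) *\<^sub>R h b)" for x
  have "linear f"
    unfolding f_def by (auto intro!: linearI simp: inner_add_left scaleR_add_left sum.distrib scaleR_sum_right)
  moreover have "f b = h b" if "b \<in> Basis" for b
  proof -
    have "f b = (\<Sum>c\<in>Basis. if b = c then h c else 0)"
      unfolding f_def by (intro sum.cong refl) (simp add: inner_Basis that)
    then show ?thesis using that by simp
  qed
  then have "bij_betw f Basis Basis" using h bij_betw_cong[of Basis f h] by blast
  ultimately show ?thesis by blast
qed

text \<open>Boxes pull back to boxes with the same side lengths in another order, and the values on
  boxes determine Lebesgue measure.\<close>

lemma lborel_distr_basis_map:
  fixes f :: "'a::euclidean_space \<Rightarrow> 'b::euclidean_space"
  assumes f: "linear f" "bij_betw f Basis Basis"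
  shows "lborel = distr lborel borel f"
proof (rule lborel_eqI)
  fix l u :: 'b assume lu: "\<And>b. b \<in> Basis \<Longrightarrow> l \<bullet> b \<le> u \<bullet> b"
  have m: "f \<in> borel_measurable lborel"
    using linear_continuous_on[of f UNIV] f(1) by (auto intro!: borel_measurable_continuous_onI simp: linear_conv_bounded_linear)
  have eq: "(\<forall>b\<in>Basis. P b) \<longleftrightarrow> (\<forall>b\<in>Basis. P (f b))" for P
    using f(2) unfolding bij_betw_def by (metis (no_types) image_iff)
  have "f -` box l u = box (\<Sum>b\<in>Basis. (l \<bullet> f b) *\<^sub>R b) (\<Sum>b\<in>Basis. (u \<bullet> f b) *\<^sub>R b)"
    by (auto simp: box_def eq basis_map_inner[OF f])
  then have "emeasure (distr lborel borel f) (box l u) = emeasure lborel (box (\<Sum>b\<in>Basis. (l \<bullet> f b) *\<^sub>R b) (\<Sum>b\<in>Basis. (u \<bullet> f b) *\<^sub>R b))"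
    by (subst emeasure_distr[OF m]) auto
  also have "\<dots> = (\<Prod>b\<in>Basis. (u - l) \<bullet> f b)"
    using lu f(2) by (subst emeasure_lborel_box) (auto simp: bij_betw_def inner_diff_left)
  also have "(\<Prod>b\<in>Basis. (u - l) \<bullet> f b) = (\<Prod>b\<in>Basis. (u - l) \<bullet> b)"
    by (rule prod.reindex_bij_betw[OF f(2)])
  finally show "emeasure (distr lborel borel f) (box l u) = (\<Prod>b\<in>Basis. (u - l) \<bullet> b)" .
qed simp

lemma inj_if_inner_preserving:
  fixes f :: "'a::real_inner \<Rightarrow> 'b::real_inner"
  assumes "linear f" "\<And>x y. f x \<bullet> f y = x \<bullet> y"
  shows "inj f"
proof (rule injI)
  fix x y assume "f x = f y"
  then have "f (x - y) \<bullet> f (x - y) = 0" by (simp add: linear_diff[OF assms(1)])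
  then show "x = y" by (simp add: assms(2))
qed

lemma compact_linear_image_euclidean: "linear f \<Longrightarrow> compact K \<Longrightarrow> compact (f ` K)"
  for f :: "'a::euclidean_space \<Rightarrow> 'b::euclidean_space"
  using linear_continuous_on[of f K] by (intro compact_continuous_image) (auto simp: linear_conv_bounded_linear)

lemma measure_basis_map_image:
  fixes f :: "'a::euclidean_space \<Rightarrow> 'b::euclidean_space"
  assumes f: "linear f" "bij_betw f Basis Basis" and K: "compact K"
  shows "measure lborel (f ` K) = measure lborel K"
proof -
  have m: "f \<in> borel_measurable lborel"
    using linear_continuous_on[of f UNIV] f(1) by (auto intro!: borel_measurable_continuous_onI simp: linear_conv_bounded_linear)
  have "inj f" by (rule inj_if_inner_preserving[OF f(1) basis_map_inner[OF f]])
  have "measure lborel (f ` K) = measure (distr lborel borel f) (f ` K)"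
    using lborel_distr_basis_map[OF f] by simp
  also have "\<dots> = measure lborel (f -` f ` K)"
    using compact_linear_image_euclidean[OF f(1) K] by (subst measure_distr[OF m]) (auto intro!: borel_compact)
  finally show ?thesis by (simp add: inj_vimage_image_eq[OF \<open>inj f\<close>])
qed

text \<open>The change of variables theorems of the library need a well-ordered index type; this copy of a
  finite type provides one.\<close>

typedef 'a well_ordered = "UNIV :: 'a set" by simp

instance well_ordered :: (finite) finite
proof
  have "(UNIV :: 'a well_ordered set) = range Abs_well_ordered"
    by (metis Abs_well_ordered_cases surj_def)
  then show "finite (UNIV :: 'a well_ordered set)" by (metis finite finite_imageI)
qed

instantiation well_ordered :: (finite) wellorder
begin

definition less_eq_well_ordered :: "'a well_ordered \<Rightarrow> 'a well_ordered \<Rightarrow> bool" where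
  "x \<le> y \<longleftrightarrow> to_nat (Rep_well_ordered x) \<le> to_nat (Rep_well_ordered y)"

definition less_well_ordered :: "'a well_ordered \<Rightarrow> 'a well_ordered \<Rightarrow> bool" where
  "x < y \<longleftrightarrow> to_nat (Rep_well_ordered x) < to_nat (Rep_well_ordered y)"

instance
proof
  fix x y z :: "'a well_ordered" and P
  show "x < y \<longleftrightarrow> x \<le> y \<and> \<not> y \<le> x" "x \<le> x" "x \<le> y \<Longrightarrow> y \<le> z \<Longrightarrow> x \<le> z" "x \<le> y \<or> y \<le> x"
    by (auto simp: less_eq_well_ordered_def less_well_ordered_def)
  show "x \<le> y \<Longrightarrow> y \<le> x \<Longrightarrow> x = y"
    by (auto simp: less_eq_well_ordered_def Rep_well_ordered_inject)
  show "P x" if "\<And>x. (\<And>y. y < x \<Longrightarrow> P y) \<Longrightarrow> P x"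
    by (induction x rule: measure_induct_rule[of "\<lambda>x. to_nat (Rep_well_ordered x)"])
       (use that in \<open>auto simp: less_well_ordered_def\<close>)
qed

end

lemma bij_Rep_well_ordered: "bij Rep_well_ordered"
  by (metis Abs_well_ordered_inverse Rep_well_ordered_inverse UNIV_I bijI' surj_def)

lemma CARD_well_ordered: "CARD('a::finite well_ordered) = CARD('a)"
  using bij_betw_same_card[OF bij_Rep_well_ordered] .

section \<open>Determinants under a renaming of the indices\<close>

text \<open>Conjugation by \<open>g\<close> sends the transposition of \<open>a\<close> and
  \<open>b\<close> to that of \<open>g a\<close> and \<open>g b\<close>, so a product of
  transpositions keeps its length when it moves to the other type.\<close>

lemma swapidseq_conjugate:
  assumes "bij g" "swapidseq n p"
  shows "swapidseq n (g \<circ> p \<circ> inv g)"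
  using assms(2)
proof (induction rule: swapidseq.induct)
  case id
  then show ?case using assms(1) by (simp add: fun_eq_iff surj_f_inv_f[OF bij_is_surj])
next
  case (comp_Suc n p a b)
  have "g \<circ> (Transposition.transpose a b \<circ> p) \<circ> inv g = Transposition.transpose (g a) (g b) \<circ> (g \<circ> p \<circ> inv g)"
  proof
    fix x
    have "g (Transposition.transpose a b y) = Transposition.transpose (g a) (g b) (g y)" for y
      using inj_eq[OF bij_is_inj[OF assms(1)]] by (simp add: Transposition.transpose_def)
    then show "(g \<circ> (Transposition.transpose a b \<circ> p) \<circ> inv g) x = (Transposition.transpose (g a) (g b) \<circ> (g \<circ> p \<circ> inv g)) x" by simp
  qed
  moreover have "g a \<noteq> g b" using comp_Suc.hyps(2) inj_eq[OF bij_is_inj[OF assms(1)]] by simp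
  ultimately show ?case using swapidseq.comp_Suc[OF comp_Suc.IH] by (simp only:)
qed

lemma sign_conjugate:
  fixes g :: "'a::finite \<Rightarrow> 'b::finite"
  assumes "bij g" "p permutes UNIV"
  shows "sign (g \<circ> p \<circ> inv g) = sign p"
proof -
  have "permutation p" unfolding permutation_permutes using assms(2) by (intro exI[of _ UNIV]) simp
  then obtain n where n: "swapidseq n p" by (auto simp: permutation_def)
  have "evenperm (g \<circ> p \<circ> inv g) = even n" "evenperm p = even n"
    using evenperm_unique[OF n refl] evenperm_unique[OF swapidseq_conjugate[OF assms(1) n] refl] by simp_all
  then show ?thesis by (simp add: sign_def)
qed

lemma permutes_UNIV_iff_bij: "p permutes UNIV \<longleftrightarrow> bij p"
  by (simp add: permutes_def bij_iff)

text \<open>Conjugation by \<open>g\<close> matches the permutations of the two index types and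
  preserves signs, so the two Leibniz sums agree term by term after reindexing each product.\<close>

lemma det_reindex:
  fixes A :: "real^'p^'p" and g :: "'q::finite \<Rightarrow> 'p::finite"
  assumes g: "bij g"
  shows "det (\<chi> i j. A $ g i $ g j :: real^'q^'q) = det A"
proof -
  have gi: "g (inv g x) = x" "inv g (g y) = y" for x y
    using g by (simp_all add: bij_is_surj surj_f_inv_f bij_is_inj)
  have bij: "bij_betw (\<lambda>p. g \<circ> p \<circ> inv g) {p. p permutes UNIV} {p. p permutes UNIV}"
  proof (rule bij_betw_byWitness[where f'="\<lambda>p. inv g \<circ> p \<circ> g"])
    show "\<forall>p\<in>{p. p permutes UNIV}. inv g \<circ> (g \<circ> p \<circ> inv g) \<circ> g = p" by (auto simp: fun_eq_iff gi)
    show "\<forall>p\<in>{p. p permutes UNIV}. g \<circ> (inv g \<circ> p \<circ> g) \<circ> inv g = p" by (auto simp: fun_eq_iff gi)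
    have "bij (g \<circ> p \<circ> inv g)" if "bij p" for p :: "'q \<Rightarrow> 'q"
      using that g by (intro bij_comp) (auto simp: bij_imp_bij_inv)
    then show "(\<lambda>p. g \<circ> p \<circ> inv g) ` {p. p permutes UNIV} \<subseteq> {p. p permutes UNIV}"
      by (auto simp: permutes_UNIV_iff_bij)
    have "bij (inv g \<circ> p \<circ> g)" if "bij p" for p :: "'p \<Rightarrow> 'p"
      using that g by (intro bij_comp) (auto simp: bij_imp_bij_inv)
    then show "(\<lambda>p. inv g \<circ> p \<circ> g) ` {p. p permutes UNIV} \<subseteq> {p. p permutes UNIV}"
      by (auto simp: permutes_UNIV_iff_bij)
  qed
  have "det A = (\<Sum>p | p permutes UNIV. of_int (sign (g \<circ> p \<circ> inv g)) * (\<Prod>i\<in>UNIV. A $ i $ (g \<circ> p \<circ> inv g) i))"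
    unfolding det_def
    by (rule sum.reindex_bij_betw[OF bij, of "\<lambda>p. of_int (sign p) * (\<Prod>i\<in>UNIV. A $ i $ p i)", symmetric])
  also have "\<dots> = (\<Sum>p | p permutes UNIV. of_int (sign p) * (\<Prod>i\<in>UNIV. A $ g i $ g (p i)))"
  proof (intro sum.cong refl)
    fix p :: "'q \<Rightarrow> 'q" assume p: "p \<in> {p. p permutes UNIV}"
    have "(\<Prod>i\<in>UNIV. A $ i $ (g \<circ> p \<circ> inv g) i) = (\<Prod>i\<in>UNIV. A $ g i $ g (p i))"
      using prod.reindex_bij_betw[OF g, of "\<lambda>i. A $ i $ (g \<circ> p \<circ> inv g) i"] unfolding comp_def gi by (rule sym)
    then show "of_int (sign (g \<circ> p \<circ> inv g)) * (\<Prod>i\<in>UNIV. A $ i $ (g \<circ> p \<circ> inv g) i) = of_int (sign p) * (\<Prod>i\<in>UNIV. A $ g i $ g (p i))"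
      using sign_conjugate[OF g] p by simp
  qed
  finally show ?thesis unfolding det_def by simp
qed

section \<open>Volume of linear images of compact sets\<close>

text \<open>Conjugation with the renaming \<open>P\<close> of coordinates, which preserves volume,
  moves \<open>f\<close> to the well-ordered index type; the determinant survives by
  \<open>det_reindex\<close>.\<close>

lemma measure_linear_image_finite:
  fixes f :: "real^'p \<Rightarrow> real^'p"
  assumes f: "linear f" and K: "compact K"
  shows "measure lborel (f ` K) = \<bar>det (matrix f)\<bar> * measure lborel K"
proof -
  let ?g = "Rep_well_ordered :: 'p well_ordered \<Rightarrow> 'p"
  have g: "bij ?g" by (rule bij_Rep_well_ordered)
  define P :: "real^'p \<Rightarrow> real^'p well_ordered" where "P x = (\<chi> i. x $ ?g i)" for x
  define Q :: "real^'p well_ordered \<Rightarrow> real^'p" where "Q x = (\<chi> i. x $ inv ?g i)" for x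
  have gi: "?g (inv ?g x) = x" "inv ?g (?g y) = y" for x y
    using g by (simp_all add: bij_is_surj surj_f_inv_f bij_is_inj)
  have QP: "Q (P x) = x" for x by (simp add: P_def Q_def vec_eq_iff gi)
  have PQ: "P (Q x) = x" for x by (simp add: P_def Q_def vec_eq_iff gi)
  have lP: "linear P" and lQ: "linear Q"
    by (auto intro!: linearI simp: P_def Q_def vec_eq_iff)
  have Qa: "Q (axis i 1) = axis (?g i) 1" for i
    by (auto simp: Q_def axis_def vec_eq_iff gi)
  have Pa: "P (axis i 1) = axis (inv ?g i) 1" for i
    using QP[of "axis i 1"] by (metis PQ Qa gi(1))
  have bP: "bij_betw P Basis Basis"
    by (rule bij_betw_byWitness[where f'=Q]) (auto simp: QP PQ Basis_vec_def Pa Qa)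
  let ?f = "P \<circ> f \<circ> Q"
  have lf: "linear ?f" using f lP lQ by (intro linear_compose) auto
  have cPK: "compact (P ` K)" using compact_linear_image_euclidean[OF lP K] .
  have cfK: "compact (f ` K)" using compact_linear_image_euclidean[OF f K] .
  have "matrix ?f = (\<chi> i j. matrix f $ ?g i $ ?g j)"
    by (simp add: matrix_def vec_eq_iff Qa) (simp add: P_def)
  then have det: "det (matrix ?f) = det (matrix f)" using det_reindex[OF g, of "matrix f"] by simp
  have "measure lborel (f ` K) = measure lborel (P ` f ` K)"
    using measure_basis_map_image[OF lP bP cfK] by simp
  also have "P ` f ` K = ?f ` P ` K" by (simp add: image_image QP)
  also have "measure lborel (?f ` P ` K) = measure lebesgue (?f ` P ` K)"
    using compact_linear_image_euclidean[OF lf cPK] by (simp add: borel_compact)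
  also have "\<dots> = \<bar>det (matrix ?f)\<bar> * measure lebesgue (P ` K)"
    by (rule measure_linear_image[OF lf]) (use cPK lmeasurable_compact in blast)
  also have "measure lebesgue (P ` K) = measure lborel K"
    using measure_basis_map_image[OF lP bP K] cPK by (simp add: borel_compact)
  finally show ?thesis unfolding det .
qed

text \<open>\<open>T\<close> connects two different types, whereas an orthogonal transformation acts
  on one. Placing it between the basis maps \<open>P\<close> and \<open>Q\<close> yields an
  orthogonal transformation of \<open>real^'n well_ordered\<close>.\<close>

lemma measure_isometry_image:
  fixes T :: "real^'n \<Rightarrow> 'b::euclidean_space"
  assumes T: "linear T" "\<And>x y. T x \<bullet> T y = x \<bullet> y" and dim: "DIM('b) = CARD('n)" and K: "compact K"
  shows "measure lborel (T ` K) = measure lborel K"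
proof -
  obtain Q :: "'b \<Rightarrow> real^'n well_ordered" where Q: "linear Q" "bij_betw Q Basis Basis"
    using ex_basis_map[where 'a='b and 'b="real^'n well_ordered"] dim by (auto simp: CARD_well_ordered)
  obtain P :: "real^'n well_ordered \<Rightarrow> real^'n" where P: "linear P" "bij_betw P Basis Basis"
    using ex_basis_map[where 'b="real^'n" and 'a="real^'n well_ordered"] by (auto simp: CARD_well_ordered)
  have oT: "orthogonal_transformation (Q \<circ> T \<circ> P)"
    unfolding orthogonal_transformation_def using T P Q
    by (auto intro!: linear_compose simp: basis_map_inner)
  have oP: "\<exists>R. linear R \<and> (\<forall>x. P (R x) = x)"
  proof -
    have "inj P" by (rule inj_if_inner_preserving[OF P(1) basis_map_inner[OF P]])
    then have "surj P" using P(1) by (intro linear_injective_imp_surjective) (auto simp: CARD_well_ordered)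
    then show ?thesis using P(1) linear_surjective_right_inverse[of P] by (auto simp: fun_eq_iff)
  qed
  then obtain R where R: "linear R" "\<And>x. P (R x) = x" by blast
  have cR: "compact (R ` K)" using compact_linear_image_euclidean[OF R(1) K] .
  have eq: "K = P ` R ` K" by (simp add: image_image R)
  have cT: "compact (T ` K)" by (rule compact_linear_image_euclidean[OF T(1) K])
  have lm: "R ` K \<in> lmeasurable" using cR lmeasurable_compact by blast
  have "measure lborel (T ` K) = measure lborel (Q ` T ` K)"
    using measure_basis_map_image[OF Q cT] by simp
  also have "Q ` T ` K = (Q \<circ> T \<circ> P) ` R ` K" by (simp add: image_image R)
  also have "measure lborel \<dots> = measure lebesgue \<dots>"
    using compact_linear_image_euclidean[OF orthogonal_transformation_linear[OF oT] cR] by (simp add: borel_compact)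
  also have "\<dots> = measure lebesgue (R ` K)" by (rule measure_orthogonal_image[OF oT lm])
  also have "\<dots> = measure lborel (R ` K)" using cR by (simp add: borel_compact)
  also have "\<dots> = measure lborel (P ` R ` K)"
    using measure_basis_map_image[OF P cR] by simp
  finally show ?thesis using eq by simp
qed

text \<open>Cavalieri's principle: the slice at time \<open>t\<close> is mapped by \<open>f\<close>
  to the slice at the same time, so every slice is multiplied by the same factor. A singular
  \<open>f\<close> is included.\<close>

lemma measure_image_snd_linear:
  fixes f :: "real^'m \<Rightarrow> real^'m" and K :: "(real \<times> (real^'m)) set"
  assumes f: "linear f" and K: "compact K"
  shows "measure lborel ((\<lambda>(t, x). (t, f x)) ` K) = \<bar>det (matrix f)\<bar> * measure lborel K"
proof -
  let ?F = "\<lambda>(t, x). (t, f x)"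
  have cf: "continuous_on S f" for S using f linear_continuous_on linear_conv_bounded_linear by blast
  have cK: "compact (?F ` K)"
    using K by (intro compact_continuous_image continuous_intros continuous_on_compose2[OF cf[of UNIV]])
       (auto simp: split_beta intro!: continuous_intros continuous_on_compose2[OF cf[of UNIV]])
  have slice: "compact (Pair t -` K)" for t
  proof -
    have "Pair t -` K = snd ` (K \<inter> {t} \<times> UNIV)" by force
    moreover have "compact (K \<inter> {t} \<times> UNIV)"
      using K by (intro compact_Int_closed closed_Times) auto
    ultimately show ?thesis
      using compact_continuous_image[of "K \<inter> {t} \<times> UNIV" snd] continuous_on_snd[OF continuous_on_id] by auto
  qed
  have fin: "emeasure lborel C < \<infinity>" if "compact C" for C :: "'c::euclidean_space set"
    using emeasure_bounded_finite[of C] compact_imp_bounded[OF that] by simp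
  have im: "Pair t -` (?F ` K) = f ` (Pair t -` K)" for t by force
  have em: "emeasure lborel (Pair t -` (?F ` K)) = ennreal \<bar>det (matrix f)\<bar> * emeasure lborel (Pair t -` K)" for t
    unfolding im using measure_linear_image_finite[OF f slice[of t]] fin[OF slice[of t]]
      fin[OF compact_linear_image_euclidean[OF f slice[of t]]]
    by (simp add: emeasure_eq_ennreal_measure less_top ennreal_mult' del: ennreal_mult'' flip: ennreal_mult')
  have pair: "emeasure lborel C = (\<integral>\<^sup>+t. emeasure lborel (Pair t -` C) \<partial>lborel)" if "compact C" for C :: "(real \<times> (real^'m)) set"
    using that lborel.emeasure_pair_measure_alt[of C lborel] unfolding lborel_prod
    by (simp add: borel_compact)
  have "emeasure lborel (?F ` K) = (\<integral>\<^sup>+t. ennreal \<bar>det (matrix f)\<bar> * emeasure lborel (Pair t -` K) \<partial>lborel)"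
    unfolding pair[OF cK] em ..
  also have "\<dots> = ennreal \<bar>det (matrix f)\<bar> * emeasure lborel K"
    unfolding pair[OF K]
  proof (rule nn_integral_cmult)
    have "K \<in> sets (lborel \<Otimes>\<^sub>M lborel)" unfolding lborel_prod using K by (simp add: borel_compact)
    then show "(\<lambda>t. emeasure lborel (Pair t -` K)) \<in> borel_measurable lborel"
      by (rule lborel.measurable_emeasure_Pair)
  qed
  finally show ?thesis by (simp add: measure_def enn2real_mult)
qed

lemma measure_image_scaling:
  fixes K :: "(real \<times> (real^'m)) set"
  assumes "a > 0" "c > 0" and K: "compact K"
  shows "measure lborel ((\<lambda>(t, x). (a * t, c *\<^sub>R x)) ` K) = a * c ^ CARD('m) * measure lborel K"
proof -
  let ?F = "\<lambda>(t, x). (a * t, c *\<^sub>R x) :: real \<times> (real^'m)"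
  \<comment> \<open>The basis of the product consists of \<open>(1, 0)\<close> and the vectors
    \<open>(0, j)\<close>; a vanishing first component recognizes the latter.\<close>
  let ?c = "\<lambda>j::real \<times> (real^'m). if fst j = 0 then c else a"
  have F: "?F = (\<lambda>x. 0 + (\<Sum>j\<in>Basis. (?c j * (x \<bullet> j)) *\<^sub>R j))"
  proof
    fix x :: "real \<times> (real^'m)"
    have "(\<Sum>j\<in>Basis. (?c j * (x \<bullet> j)) *\<^sub>R j) =
       (\<Sum>j\<in>Basis. (a * (fst x * j)) *\<^sub>R (j, 0)) + (\<Sum>j\<in>Basis. (c * (snd x \<bullet> j)) *\<^sub>R (0, j))"
      unfolding Basis_prod_def
      by (subst sum.union_disjoint) (auto simp: sum.reindex inj_on_def inner_prod_def)
    also have "(\<Sum>j\<in>Basis. (c * (snd x \<bullet> j)) *\<^sub>R (0::real, j)) = (0, c *\<^sub>R (\<Sum>j\<in>Basis. (snd x \<bullet> j) *\<^sub>R j))"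
      by (simp add: prod_eq_iff scaleR_sum_right fst_sum snd_sum)
    finally show "?F x = 0 + (\<Sum>j\<in>Basis. (?c j * (x \<bullet> j)) *\<^sub>R j)"
      by (simp add: euclidean_representation split_beta)
  qed
  have prodc: "(\<Prod>j\<in>Basis. \<bar>?c j\<bar>) = a * c ^ CARD('m)"
  proof -
    have "(\<Prod>j\<in>Basis. \<bar>?c j\<bar>) = (\<Prod>j\<in>(Basis::real set). a) * (\<Prod>j\<in>(Basis :: (real^'m) set). c)"
      unfolding Basis_prod_def using assms
      by (subst prod.union_disjoint) (auto simp: prod.reindex inj_on_def)
    then show ?thesis by simp
  qed
  have lb: "lborel = density (distr lborel borel ?F) (\<lambda>_. (\<Prod>j\<in>Basis. \<bar>?c j\<bar>))"
    unfolding F by (rule lborel_affine_euclidean) (use assms in auto)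
  have cont: "continuous_on S ?F" for S by (auto simp: split_beta intro!: continuous_intros)
  have cK: "?F ` K \<in> sets borel" using compact_continuous_image[OF cont K] borel_compact by blast
  have m: "?F \<in> borel_measurable lborel" using cont by (auto intro: borel_measurable_continuous_onI)
  have "inj ?F" using assms by (auto simp: inj_def)
  have "emeasure lborel (?F ` K) = emeasure (density (distr lborel borel ?F) (\<lambda>_. (\<Prod>j\<in>Basis. \<bar>?c j\<bar>))) (?F ` K)"
    using lb by simp
  also have "\<dots> = ennreal (a * c ^ CARD('m)) * emeasure (distr lborel borel ?F) (?F ` K)"
    unfolding prodc using cK by (subst emeasure_density) (auto simp: nn_integral_cmult)
  also have "emeasure (distr lborel borel ?F) (?F ` K) = emeasure lborel K"
    using cK by (subst emeasure_distr[OF m]) (auto simp: inj_vimage_image_eq[OF \<open>inj ?F\<close>])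
  finally show ?thesis using assms by (simp add: measure_def enn2real_mult)
qed

section \<open>Factorization of positive semidefinite matrices\<close>

text \<open>With a zero at \<open>(j, j)\<close>, the quadratic form is affine in \<open>t\<close>
  along \<open>t *\<^sub>R axis j 1 + axis k 1\<close>; a nonzero slope would make it negative
  somewhere.\<close>

lemma psd_zero_diagonal:
  fixes S :: "real^'m^'m"
  assumes sym: "\<And>x y. x \<bullet> (S *v y) = y \<bullet> (S *v x)" and psd: "\<And>x. 0 \<le> x \<bullet> (S *v x)"
    and "S $ j $ j = 0"
  shows "S $ j $ k = 0"
proof (rule ccontr)
  assume nz: "S $ j $ k \<noteq> 0"
  have ax: "axis a 1 \<bullet> (S *v axis b 1) = S $ a $ b" for a b
    by (simp add: inner_axis' matrix_vector_mult_basis column_def)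
  \<comment> \<open>This makes the value \<open>2 * t * S $ j $ k + S $ k $ k\<close> equal to
    -1.\<close>
  define t where "t = - (S $ k $ k + 1) / (2 * S $ j $ k)"
  let ?x = "t *\<^sub>R axis j 1 + axis k 1 :: real^'m"
  have "?x \<bullet> (S *v ?x) = t * t * S $ j $ j + t * S $ j $ k + (t * (axis k 1 \<bullet> (S *v axis j 1)) + S $ k $ k)"
    by (simp add: matrix_vector_right_distrib matrix_vector_mult_scaleR inner_add_left inner_add_right ax algebra_simps)
  also have "axis k 1 \<bullet> (S *v axis j 1) = S $ j $ k" using sym ax by metis
  finally have "?x \<bullet> (S *v ?x) = 2 * t * S $ j $ k + S $ k $ k" using assms(3) by simp
  also have "2 * t * S $ j $ k = - (S $ k $ k + 1)" using nz by (simp add: t_def)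
  finally have "?x \<bullet> (S *v ?x) = - 1" by simp
  then show False using psd[of ?x] by simp
qed

text \<open>Eliminating one nonzero diagonal entry at a time; the vector removed in the step with pivot \<open>i\<close>
  becomes column \<open>i\<close>.\<close>
lemma psd_factorization_aux:
  fixes S :: "real^'m^'m"
  assumes "\<And>x y. x \<bullet> (S *v y) = y \<bullet> (S *v x)" "\<And>x. 0 \<le> x \<bullet> (S *v x)"
  shows "\<exists>A. A ** transpose A = S \<and> (\<forall>j. S $ j $ j = 0 \<longrightarrow> (\<forall>i. A $ i $ j = 0))"
  using assms
proof (induction "card {i. S $ i $ i \<noteq> 0}" arbitrary: S rule: less_induct)
  case less
  note sym = less.prems(1) and psd = less.prems(2)
  have ax: "axis a 1 \<bullet> (S *v axis b 1) = S $ a $ b" for a b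
    by (simp add: inner_axis' matrix_vector_mult_basis column_def)
  have ssym: "S $ a $ b = S $ b $ a" for a b using sym ax by metis
  show ?case
  proof (cases "\<exists>i. S $ i $ i \<noteq> 0")
    case False
    then have "S $ j $ k = 0" for j k using psd_zero_diagonal[OF sym psd] by blast
    then show ?thesis by (intro exI[of _ 0]) (simp add: vec_eq_iff matrix_matrix_mult_def)
  next
    case True
    then obtain i where i: "S $ i $ i \<noteq> 0" by blast
    have ipos: "S $ i $ i > 0" using psd[of "axis i 1"] ax[of i i] i by simp
    \<comment> \<open>The Schur complement of the pivot. A vanishing diagonal entry of
      \<open>S\<close> forces a vanishing row, so it stays zero in \<open>S'\<close>, while the
      entry at \<open>(i, i)\<close> becomes zero as well: the induction measure drops.\<close>
    define S' :: "real^'m^'m" where "S' = (\<chi> j k. S $ j $ k - S $ j $ i * S $ k $ i / S $ i $ i)"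
    have S'mult: "x \<bullet> (S' *v y) = x \<bullet> (S *v y) - (x \<bullet> (S *v axis i 1)) * (y \<bullet> (S *v axis i 1)) / S $ i $ i" for x y
      unfolding S'_def
      by (simp add: matrix_vector_mult_def inner_vec_def axis_def if_distrib sum_subtractf algebra_simps
          sum_distrib_left sum_distrib_right sum_divide_distrib cong: if_cong) (subst sum.swap, simp add: mult_ac)
    have sym': "x \<bullet> (S' *v y) = y \<bullet> (S' *v x)" for x y
      unfolding S'mult using sym[of x y] by simp
    have psd': "0 \<le> x \<bullet> (S' *v x)" for x
    proof -
      \<comment> \<open>This \<open>c\<close> minimizes the form of \<open>S\<close> along the line
        through \<open>x\<close> in direction \<open>axis i 1\<close>; the minimum is the form of
        \<open>S'\<close> at \<open>x\<close>, hence nonnegative.\<close>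
      define c where "c = (x \<bullet> (S *v axis i 1)) / S $ i $ i"
      let ?y = "x - c *\<^sub>R axis i 1"
      have "?y \<bullet> (S *v ?y) = x \<bullet> (S *v x) - c * (axis i 1 \<bullet> (S *v x)) - c * (x \<bullet> (S *v axis i 1)) + c * c * S $ i $ i"
        by (simp add: matrix_vector_mult_diff_distrib matrix_vector_mult_scaleR inner_diff_left inner_diff_right ax algebra_simps)
      also have "axis i 1 \<bullet> (S *v x) = x \<bullet> (S *v axis i 1)" by (rule sym)
      also have "x \<bullet> (S *v x) - c * (x \<bullet> (S *v axis i 1)) - c * (x \<bullet> (S *v axis i 1)) + c * c * S $ i $ i = x \<bullet> (S' *v x)"
        unfolding S'mult c_def using i by (simp add: field_simps)
      finally show ?thesis using psd[of ?y] by simp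
    qed
    have S'0: "S' $ i $ i = 0" "S $ j $ j = 0 \<Longrightarrow> S' $ j $ j = 0" for j
      using i psd_zero_diagonal[OF sym psd, of j i] by (auto simp: S'_def)
    have "{j. S' $ j $ j \<noteq> 0} \<subset> {j. S $ j $ j \<noteq> 0}" using S'0 i by auto
    then have "card {j. S' $ j $ j \<noteq> 0} < card {j. S $ j $ j \<noteq> 0}" by (simp add: psubset_card_mono)
    then obtain A' where A': "A' ** transpose A' = S'" "\<And>j i. S' $ j $ j = 0 \<Longrightarrow> A' $ i $ j = 0"
      using less.hyps[of S'] sym' psd' by blast
    \<comment> \<open>Column \<open>i\<close> of \<open>A'\<close> is zero because \<open>S'\<close>
      vanishes at \<open>(i, i)\<close>, so it is free for the removed vector. This is the purpose
      of the clause on vanishing columns in the induction.\<close>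
    define A :: "real^'m^'m" where "A = (\<chi> j k. if k = i then S $ j $ i / sqrt (S $ i $ i) else A' $ j $ k)"
    have "(A ** transpose A) $ j $ k = S $ j $ k" for j k
    proof -
      have "(A ** transpose A) $ j $ k = (\<Sum>l\<in>UNIV. A' $ j $ l * A' $ k $ l + (if l = i then S $ j $ i * S $ k $ i / S $ i $ i else 0))"
        using A'(2)[OF S'0(1)] ipos
        by (auto simp: matrix_matrix_mult_def transpose_def A_def intro!: sum.cong)
      also have "\<dots> = (A' ** transpose A') $ j $ k + S $ j $ i * S $ k $ i / S $ i $ i"
        by (simp add: sum.distrib matrix_matrix_mult_def transpose_def)
      finally show ?thesis by (simp add: A'(1) S'_def)
    qed
    moreover have "A $ k $ j = 0" if "S $ j $ j = 0" for j k
      using that A'(2)[OF S'0(2)[OF that]] i by (auto simp: A_def)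
    ultimately show ?thesis by (intro exI[of _ A]) (auto simp: vec_eq_iff)
  qed
qed

lemma psd_factorization:
  fixes S :: "real^'m^'m"
  assumes "\<And>x y. x \<bullet> (S *v y) = y \<bullet> (S *v x)" "\<And>x. 0 \<le> x \<bullet> (S *v x)"
  obtains A :: "real^'m^'m" where "A ** transpose A = S"
  using psd_factorization_aux[OF assms] by blast

section \<open>Convergence in law from linear forms\<close>

text \<open>The phase \<open>s\<close> absorbs sines and constants, and product-to-sum formulas make
  the class closed under multiplication, so two rules generate an algebra.\<close>

inductive trig_poly :: "'i set \<Rightarrow> (('i \<Rightarrow> real) \<Rightarrow> real) \<Rightarrow> bool" for I where
  cos: "trig_poly I (\<lambda>x. c * cos ((\<Sum>i\<in>I. t i * x i) + s))"
| add: "trig_poly I f \<Longrightarrow> trig_poly I g \<Longrightarrow> trig_poly I (\<lambda>x. f x + g x)"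

lemma trig_poly_const: "trig_poly I (\<lambda>x. c)"
  using trig_poly.cos[of I c "\<lambda>_. 0" 0] by simp

lemma trig_poly_cmult: "trig_poly I f \<Longrightarrow> trig_poly I (\<lambda>x. a * f x)"
proof (induction rule: trig_poly.induct)
  case (cos c t s)
  show ?case using trig_poly.cos[of I "a * c" t s] by (simp add: mult_ac)
next
  case (add f g)
  then show ?case using trig_poly.add[OF add.IH] by (simp add: distrib_left)
qed

lemma trig_poly_cos_mult:
  assumes "trig_poly I g"
  shows "trig_poly I (\<lambda>x. cos ((\<Sum>i\<in>I. t i * x i) + s) * g x)"
  using assms
proof (induction rule: trig_poly.induct)
  case (cos c t' s')
  have "trig_poly I (\<lambda>x. c / 2 * cos ((\<Sum>i\<in>I. (t i - t' i) * x i) + (s - s')) + c / 2 * cos ((\<Sum>i\<in>I. (t i + t' i) * x i) + (s + s')))"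
    by (intro trig_poly.intros)
  also have "(\<lambda>x. c / 2 * cos ((\<Sum>i\<in>I. (t i - t' i) * x i) + (s - s')) + c / 2 * cos ((\<Sum>i\<in>I. (t i + t' i) * x i) + (s + s'))) =
     (\<lambda>x. cos ((\<Sum>i\<in>I. t i * x i) + s) * (c * cos ((\<Sum>i\<in>I. t' i * x i) + s')))"
  proof
    fix x
    let ?a = "(\<Sum>i\<in>I. t i * x i) + s" and ?b = "(\<Sum>i\<in>I. t' i * x i) + s'"
    have "(\<Sum>i\<in>I. (t i - t' i) * x i) + (s - s') = ?a - ?b" "(\<Sum>i\<in>I. (t i + t' i) * x i) + (s + s') = ?a + ?b"
      by (simp_all add: algebra_simps sum.distrib sum_subtractf)
    moreover have "c / 2 * cos (a - b) + c / 2 * cos (a + b) = cos a * (c * cos b)" for a b :: real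
      by (simp add: cos_add cos_diff algebra_simps)
    ultimately show "c / 2 * cos ((\<Sum>i\<in>I. (t i - t' i) * x i) + (s - s')) + c / 2 * cos ((\<Sum>i\<in>I. (t i + t' i) * x i) + (s + s'))
        = cos ?a * (c * cos ?b)" by (simp only:)
  qed
  finally show ?case .
next
  case (add f g)
  then show ?case using trig_poly.add[OF add.IH] by (simp add: distrib_left)
qed

lemma trig_poly_mult:
  assumes "trig_poly I f" "trig_poly I g"
  shows "trig_poly I (\<lambda>x. f x * g x)"
  using assms(1)
proof (induction rule: trig_poly.induct)
  case (cos c t s)
  show ?case using trig_poly_cmult[OF trig_poly_cos_mult[OF assms(2), of t s], of c] by (simp add: mult_ac)
next
  case (add f g)
  then show ?case using trig_poly.add[OF add.IH] by (simp add: distrib_right)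
qed

lemma continuous_trig_poly:
  fixes f :: "('i::countable \<Rightarrow> real) \<Rightarrow> real"
  shows "trig_poly I f \<Longrightarrow> continuous_on S f"
proof (induction rule: trig_poly.induct)
  case (cos c t s)
  have "continuous_on S (\<lambda>x. x i)" for i :: 'i
    by (rule continuous_on_subset[OF continuous_on_product_coordinates]) simp
  then show ?case by (intro continuous_intros)
next
  case (add f g)
  then show ?case by (intro continuous_intros)
qed

lemma bounded_trig_poly: "trig_poly I f \<Longrightarrow> \<exists>B. \<forall>x. \<bar>f x\<bar> \<le> B"
proof (induction rule: trig_poly.induct)
  case (cos c t s)
  have "\<bar>c * cos r\<bar> \<le> \<bar>c\<bar>" for r by (simp add: abs_mult mult_left_le)
  then show ?case by blast
next
  case (add f g)
  then obtain B C where "\<bar>f x\<bar> \<le> B" "\<bar>g x\<bar> \<le> C" for x by blast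
  then have "\<bar>f x + g x\<bar> \<le> B + C" for x by (meson abs_triangle_ineq add_mono order_trans)
  then show ?case by blast
qed

text \<open>The functions live on the whole type, so the coordinates outside \<open>I\<close> are
  pinned to 0; every factor is then compact and Tychonoff's theorem applies. It also means that two
  different points of the box differ in a coordinate from \<open>I\<close>.\<close>

lemma compact_coordinate_box:
  fixes I :: "'i::countable set"
  shows "compact {x :: 'i \<Rightarrow> real. (\<forall>i\<in>I. \<bar>x i\<bar> \<le> R) \<and> (\<forall>i. i \<notin> I \<longrightarrow> x i = 0)}"
proof -
  let ?K = "\<lambda>i. if i \<in> I then {-R..R} else {0::real}"
  have "compactin (product_topology (\<lambda>i. euclidean) UNIV) (PiE UNIV ?K)"
    by (subst compactin_PiE) auto
  then have "compact (PiE UNIV ?K)" by (simp add: euclidean_product_topology)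
  also have "PiE UNIV ?K = {x. (\<forall>i\<in>I. \<bar>x i\<bar> \<le> R) \<and> (\<forall>i. i \<notin> I \<longrightarrow> x i = 0)}"
    by (fastforce simp: PiE_UNIV_domain Pi_iff abs_le_iff split: if_splits)
  finally show ?thesis .
qed

text \<open>Folding every coordinate back into \<open>[-R, R]\<close> along a triangle wave: a trigonometric polynomial in
  the functions \<open>sin (\<pi> x\<^sub>i / 2R)\<close> is invariant under it, so an approximation on the box is automatically
  controlled outside of the box.\<close>
definition fold_coords :: "real \<Rightarrow> ('i \<Rightarrow> real) \<Rightarrow> 'i \<Rightarrow> real" where
  "fold_coords R x = (\<lambda>i. 2 * R / pi * arcsin (sin (pi / (2 * R) * x i)))"

lemma fold_coords_bound: "R > 0 \<Longrightarrow> \<bar>fold_coords R x i\<bar> \<le> R"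
proof -
  assume R: "R > 0"
  have "\<bar>arcsin (sin y)\<bar> \<le> pi / 2" for y
    using arcsin_bounded[of "sin y"] by (simp add: abs_le_iff) linarith
  then have "2 * R / pi * \<bar>arcsin (sin y)\<bar> \<le> 2 * R / pi * (pi / 2)" for y
    using R by (intro mult_left_mono) auto
  then show ?thesis using R by (simp add: fold_coords_def abs_mult)
qed

lemma fold_coords_id:
  assumes "R > 0" "\<bar>x i\<bar> \<le> R"
  shows "fold_coords R x i = x i"
proof -
  define y where "y = pi / (2 * R) * x i"
  have "\<bar>y\<bar> = pi / (2 * R) * \<bar>x i\<bar>" using assms by (simp add: y_def abs_mult)
  also have "\<dots> \<le> pi / (2 * R) * R" using assms by (intro mult_left_mono) auto
  also have "\<dots> = pi / 2" using assms by simp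
  finally have "- (pi / 2) \<le> y" "y \<le> pi / 2" by linarith+
  then have "arcsin (sin y) = y" by (rule arcsin_sin)
  then show ?thesis unfolding fold_coords_def y_def using assms by simp
qed

lemma sin_fold_coords: "R > 0 \<Longrightarrow> sin (pi / (2 * R) * fold_coords R x i) = sin (pi / (2 * R) * x i)"
  by (simp add: fold_coords_def)

lemma trig_poly_approximation:
  fixes F :: "('i::countable \<Rightarrow> real) \<Rightarrow> real"
  assumes F: "continuous_on UNIV F" and I: "finite I" and R: "R > 0" and e: "e > 0"
  obtains g where "trig_poly I g"
    "\<And>x. (\<And>i. i \<notin> I \<Longrightarrow> x i = 0) \<Longrightarrow> \<bar>F (fold_coords R x) - g x\<bar> < e"
proof -
  let ?K = "{x :: 'i \<Rightarrow> real. (\<forall>i\<in>I. \<bar>x i\<bar> \<le> R) \<and> (\<forall>i. i \<notin> I \<longrightarrow> x i = 0)}"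
  \<comment> \<open>Invariance under folding passes to sums and products, so it can be made part of
    the algebra to which the Stone--Weierstrass theorem is applied.\<close>
  let ?P = "\<lambda>f. trig_poly I f \<and> (\<forall>x. f (fold_coords R x) = f x)"
  have "\<exists>g. ?P g \<and> (\<forall>x\<in>?K. \<bar>F x - g x\<bar> < e)"
  proof (rule Stone_Weierstrass_HOL[of ?K ?P F e])
    show "compact ?K" by (rule compact_coordinate_box)
    show "?P (\<lambda>x. c)" for c by (simp add: trig_poly_const)
    show "?P f \<Longrightarrow> continuous_on ?K f" for f by (rule continuous_trig_poly) (rule conjunct1)
    show "?P f \<and> ?P g \<Longrightarrow> ?P (\<lambda>x. f x + g x)" for f g by (simp add: trig_poly.add)
    show "?P f \<and> ?P g \<Longrightarrow> ?P (\<lambda>x. f x * g x)" for f g by (simp add: trig_poly_mult)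
    show "continuous_on ?K F" by (rule continuous_on_subset[OF F]) simp
    show "\<exists>f. ?P f \<and> f x \<noteq> f y" if "x \<in> ?K \<and> y \<in> ?K \<and> x \<noteq> y" for x y
    proof -
      have "x \<noteq> y" using that by simp
      then obtain i where i: "x i \<noteq> y i" by (auto simp: fun_eq_iff)
      then have iI: "i \<in> I" using that by force
      \<comment> \<open>This sine is injective in \<open>x i\<close> on \<open>[-R, R]\<close>,
        hence separates the points of the box; the phase \<open>- (pi / 2)\<close> writes it as a
        cosine.\<close>
      let ?f = "\<lambda>x::'i \<Rightarrow> real. sin (pi / (2 * R) * x i)"
      have "trig_poly I (\<lambda>x. 1 * cos ((\<Sum>j\<in>I. (if j = i then pi / (2 * R) else 0) * x j) + (- (pi / 2))))"
        by (rule trig_poly.cos)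
      also have "(\<lambda>x. 1 * cos ((\<Sum>j\<in>I. (if j = i then pi / (2 * R) else 0) * x j) + (- (pi / 2)))) = ?f"
        using iI I by (simp add: if_distrib[of "\<lambda>z. z * _"] cos_diff fun_eq_iff cong: if_cong)
      finally have "?P ?f" by (intro conjI allI sin_fold_coords[OF R])
      moreover have "?f x \<noteq> ?f y"
      proof
        assume "?f x = ?f y"
        then have "fold_coords R x i = fold_coords R y i" by (simp add: fold_coords_def)
        then show False using i fold_coords_id[OF R, of x i] fold_coords_id[OF R, of y i] that iI by simp
      qed
      ultimately show ?thesis by (intro exI[of _ ?f]) (rule conjI)
    qed
  qed (rule e)
  then obtain g where "?P g \<and> (\<forall>x\<in>?K. \<bar>F x - g x\<bar> < e)" by (rule exE)
  then have g: "?P g" "\<And>x. x \<in> ?K \<Longrightarrow> \<bar>F x - g x\<bar> < e" by simp_all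
  show ?thesis
  proof (rule that[of g])
    show "trig_poly I g" using g(1) by (rule conjunct1)
    fix x :: "'i \<Rightarrow> real" assume x: "\<And>i. i \<notin> I \<Longrightarrow> x i = 0"
    have "fold_coords R x \<in> ?K" using fold_coords_bound[OF R] x by (auto simp: fold_coords_def)
    then have "\<bar>F (fold_coords R x) - g (fold_coords R x)\<bar> < e" by (rule g(2))
    then show "\<bar>F (fold_coords R x) - g x\<bar> < e" using g(1) by simp
  qed
qed

section \<open>Expectations compared through trigonometric polynomials\<close>

text \<open>Where no coordinate exceeds \<open>R\<close>, folding does nothing. Elsewhere
  \<open>F\<close> changes by at most \<open>2 * B\<close> under folding. Thus the error involves
  the bound of \<open>F\<close> alone and not that of \<open>g\<close>, over which the approximation
  theorem gives no control.\<close>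

lemma (in prob_space) expectation_fold_approximation:
  fixes X :: "'a \<Rightarrow> ('i::countable \<Rightarrow> real)" and F :: "('i \<Rightarrow> real) \<Rightarrow> real" and B R p e :: real
  assumes X: "X \<in> borel_measurable M" and I: "finite I" "\<And>\<omega> i. \<omega> \<in> space M \<Longrightarrow> i \<notin> I \<Longrightarrow> X \<omega> i = 0"
    and F: "continuous_on UNIV F" "\<And>x. \<bar>F x\<bar> \<le> B" and R: "R > 0"
    and p: "\<And>i. i \<in> I \<Longrightarrow> prob {\<omega>\<in>space M. \<bar>X \<omega> i\<bar> > R} \<le> p"
    and g: "trig_poly I g" "\<And>x. (\<And>i. i \<notin> I \<Longrightarrow> x i = 0) \<Longrightarrow> \<bar>F (fold_coords R x) - g x\<bar> < e"
  shows "\<bar>expectation (\<lambda>\<omega>. F (X \<omega>)) - expectation (\<lambda>\<omega>. g (X \<omega>))\<bar> \<le> e + 2 * B * (card I * p)"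
proof -
  have Fm: "(\<lambda>\<omega>. F (X \<omega>)) \<in> borel_measurable M"
    using borel_measurable_continuous_on[OF F(1) X] .
  have gm: "(\<lambda>\<omega>. g (X \<omega>)) \<in> borel_measurable M"
    using borel_measurable_continuous_on[OF continuous_trig_poly[OF g(1)] X] .
  have Xi[measurable]: "(\<lambda>\<omega>. X \<omega> i) \<in> borel_measurable M" for i
    using borel_measurable_continuous_on[OF continuous_on_product_coordinates X] .
  obtain C where C: "\<And>x. \<bar>g x\<bar> \<le> C" using bounded_trig_poly[OF g(1)] by blast
  have Fi: "integrable M (\<lambda>\<omega>. F (X \<omega>))" by (rule integrable_const_bound[of _ B]) (use F Fm in auto)
  have gi: "integrable M (\<lambda>\<omega>. g (X \<omega>))" by (rule integrable_const_bound[of _ C]) (use C gm in auto)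
  let ?E = "\<lambda>i. {\<omega>\<in>space M. \<bar>X \<omega> i\<bar> > R}"
  have Em: "?E i \<in> events" for i by measurable
  have B: "0 \<le> B" using F(2)[of undefined] by linarith
  have bound: "\<bar>F (X \<omega>) - g (X \<omega>)\<bar> \<le> e + 2 * B * indicator (\<Union>i\<in>I. ?E i) \<omega>" if w: "\<omega> \<in> space M" for \<omega>
  proof (cases "\<omega> \<in> (\<Union>i\<in>I. ?E i)")
    case True
    have "\<bar>F (fold_coords R (X \<omega>)) - g (X \<omega>)\<bar> < e" by (intro g(2) I(2)[OF w])
    then show ?thesis using True F(2)[of "X \<omega>"] F(2)[of "fold_coords R (X \<omega>)"] by simp
  next
    case False
    then have "\<bar>X \<omega> i\<bar> \<le> R" for i using w I(2)[OF w, of i] R by (cases "i \<in> I") (auto simp: not_less)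
    then have "fold_coords R (X \<omega>) = X \<omega>" by (intro ext fold_coords_id[OF R])
    moreover have "\<bar>F (fold_coords R (X \<omega>)) - g (X \<omega>)\<bar> < e" by (intro g(2) I(2)[OF w])
    ultimately show ?thesis using False by simp
  qed
  have "\<bar>expectation (\<lambda>\<omega>. F (X \<omega>)) - expectation (\<lambda>\<omega>. g (X \<omega>))\<bar> = \<bar>expectation (\<lambda>\<omega>. F (X \<omega>) - g (X \<omega>))\<bar>"
    using Fi gi by simp
  also have "\<dots> \<le> expectation (\<lambda>\<omega>. \<bar>F (X \<omega>) - g (X \<omega>)\<bar>)" by (rule integral_abs_bound)
  also have "\<dots> \<le> expectation (\<lambda>\<omega>. e + 2 * B * indicator (\<Union>i\<in>I. ?E i) \<omega>)"
  proof (rule integral_mono)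
    show "integrable M (\<lambda>\<omega>. e + 2 * B * indicator (\<Union>i\<in>I. ?E i) \<omega>)"
      using I(1) Em by (intro Bochner_Integration.integrable_add integrable_mult_right integrable_const integrable_real_indicator)
        (auto simp: less_top[symmetric])
  qed (use Fi gi bound in auto)
  also have "\<dots> = e + 2 * B * prob (\<Union>i\<in>I. ?E i)"
    using I(1) Em by (subst Bochner_Integration.integral_add) (auto simp: prob_space less_top[symmetric] intro!: integrable_mult_right integrable_real_indicator)
  also have "prob (\<Union>i\<in>I. ?E i) \<le> (\<Sum>i\<in>I. prob (?E i))"
    using I(1) Em by (intro finite_measure_subadditive_finite) auto
  also have "\<dots> \<le> card I * p" using p sum_bounded_above[of I "\<lambda>i. prob (?E i)" p] by simp
  finally show ?thesis using B by (simp add: mult_left_mono)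
qed

lemma (in prob_space) tail_prob_small:
  assumes [measurable]: "Z \<in> borel_measurable M" and e: "e > 0"
  shows "\<exists>R::real. prob {\<omega>\<in>space M. \<bar>Z \<omega>\<bar> > R} \<le> e"
proof -
  let ?E = "\<lambda>n::nat. {\<omega>\<in>space M. \<bar>Z \<omega>\<bar> > real n}"
  have "(\<lambda>n. prob (?E n)) \<longlonglongrightarrow> prob (\<Inter>n. ?E n)"
    by (rule finite_Lim_measure_decseq) (auto simp: decseq_def)
  moreover have "(\<Inter>n. ?E n) = {}"
  proof -
    have "\<omega> \<notin> (\<Inter>n. ?E n)" for \<omega>
      using reals_Archimedean2[of "\<bar>Z \<omega>\<bar>"] by (auto simp: not_less intro: less_imp_le)
    then show ?thesis by blast
  qed
  ultimately have "(\<lambda>n. prob (?E n)) \<longlonglongrightarrow> 0" by simp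
  then have "\<forall>\<^sub>F n in sequentially. prob (?E n) < e" using e by (rule order_tendstoD)
  then obtain n where "prob (?E n) < e" by (auto simp: eventually_sequentially)
  then show ?thesis using less_imp_le by blast
qed

text \<open>First \<open>R\<close> is fixed from the tails of all \<open>X n\<close> and of
  \<open>Y\<close>, then \<open>g\<close> depending on \<open>R\<close>. Convergence is needed only
  for this one \<open>g\<close>, a finite sum of cosines of linear forms, and \<open>g\<close>
  replaces \<open>F\<close> with an error uniform in \<open>n\<close>.\<close>

lemma Cramer_Wold_expectation:
  fixes X :: "nat \<Rightarrow> 'w \<Rightarrow> ('i::countable \<Rightarrow> real)" and Y :: "'v \<Rightarrow> ('i \<Rightarrow> real)"
  assumes M: "prob_space M" and N: "prob_space N"
    and X: "\<And>n. X n \<in> borel_measurable M" and Y: "Y \<in> borel_measurable N"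
    and I: "finite I" "\<And>n \<omega> i. \<omega> \<in> space M \<Longrightarrow> i \<notin> I \<Longrightarrow> X n \<omega> i = 0" "\<And>\<omega> i. \<omega> \<in> space N \<Longrightarrow> i \<notin> I \<Longrightarrow> Y \<omega> i = 0"
    and tight: "\<And>e. e > 0 \<Longrightarrow> \<exists>R. \<forall>n. \<forall>i\<in>I. measure M {\<omega>\<in>space M. \<bar>X n \<omega> i\<bar> > R} \<le> e"
    and conv: "\<And>t s. (\<lambda>n. \<integral>\<omega>. cos ((\<Sum>i\<in>I. t i * X n \<omega> i) + s) \<partial>M) \<longlonglongrightarrow> (\<integral>\<omega>. cos ((\<Sum>i\<in>I. t i * Y \<omega> i) + s) \<partial>N)"
    and F: "continuous_on UNIV F" "\<And>x. \<bar>F x\<bar> \<le> (B::real)"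
  shows "(\<lambda>n. \<integral>\<omega>. F (X n \<omega>) \<partial>M) \<longlonglongrightarrow> (\<integral>\<omega>. F (Y \<omega>) \<partial>N)"
proof (rule LIMSEQ_I)
  fix \<epsilon> :: real assume \<epsilon>: "\<epsilon> > 0"
  interpret M: prob_space M by fact
  interpret N: prob_space N by fact
  have B: "0 \<le> B" using F(2)[of undefined] by linarith
  \<comment> \<open>The tails contribute at most \<open>\<epsilon> / 6\<close>, as does the
    approximation by \<open>g\<close>, leaving \<open>\<epsilon> / 3\<close> for each of the three
    terms compared at the end.\<close>
  define p where "p = \<epsilon> / (12 * (B + 1) * (card I + 1))"
  have p: "p > 0" using B \<epsilon> by (simp add: p_def)
  have pB: "2 * B * (card I * p) \<le> \<epsilon> / 6"
  proof -
    have "2 * B * (card I * p) \<le> 2 * (B + 1) * ((card I + 1) * p)"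
      using B p by (intro mult_mono) auto
    also have "\<dots> = \<epsilon> / 6" using B by (simp add: p_def divide_simps) (simp add: algebra_simps)?
    finally show ?thesis .
  qed
  have Xi[measurable]: "(\<lambda>\<omega>. X n \<omega> i) \<in> borel_measurable M" for n i
    using borel_measurable_continuous_on[OF continuous_on_product_coordinates X] .
  have Yi[measurable]: "(\<lambda>\<omega>. Y \<omega> i) \<in> borel_measurable N" for i
    using borel_measurable_continuous_on[OF continuous_on_product_coordinates Y] .
  obtain R1 where R1: "\<And>n i. i \<in> I \<Longrightarrow> M.prob {\<omega>\<in>space M. \<bar>X n \<omega> i\<bar> > R1} \<le> p"
    using tight[OF p] by blast
  obtain r where r: "\<And>i. N.prob {\<omega>\<in>space N. \<bar>Y \<omega> i\<bar> > r i} \<le> p"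
    using N.tail_prob_small[OF Yi p] by metis
  define R where "R = \<bar>R1\<bar> + (\<Sum>i\<in>I. \<bar>r i\<bar>) + 1"
  have s: "0 \<le> (\<Sum>i\<in>I. \<bar>r i\<bar>)" by (simp add: sum_nonneg)
  have R: "R > 0" "R \<ge> R1" using s unfolding R_def by linarith+
  have Rr: "r i \<le> R" if "i \<in> I" for i
    using member_le_sum[of i I "\<lambda>i. \<bar>r i\<bar>"] that I(1) unfolding R_def by auto
  have pX: "M.prob {\<omega>\<in>space M. \<bar>X n \<omega> i\<bar> > R} \<le> p" if "i \<in> I" for n i
  proof -
    have "M.prob {\<omega>\<in>space M. \<bar>X n \<omega> i\<bar> > R} \<le> M.prob {\<omega>\<in>space M. \<bar>X n \<omega> i\<bar> > R1}"
      using R by (intro M.finite_measure_mono) auto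
    then show ?thesis using R1[OF that, of n] by linarith
  qed
  have pY: "N.prob {\<omega>\<in>space N. \<bar>Y \<omega> i\<bar> > R} \<le> p" if "i \<in> I" for i
  proof -
    have "N.prob {\<omega>\<in>space N. \<bar>Y \<omega> i\<bar> > R} \<le> N.prob {\<omega>\<in>space N. \<bar>Y \<omega> i\<bar> > r i}"
      using Rr[OF that] by (intro N.finite_measure_mono) auto
    then show ?thesis using r[of i] by linarith
  qed
  have e6: "\<epsilon> / 6 > 0" using \<epsilon> by simp
  obtain g where g: "trig_poly I g" "\<And>x. (\<And>i. i \<notin> I \<Longrightarrow> x i = 0) \<Longrightarrow> \<bar>F (fold_coords R x) - g x\<bar> < \<epsilon> / 6"
    using trig_poly_approximation[OF F(1) I(1) R(1) e6] by blast
  have aX: "\<bar>(\<integral>\<omega>. F (X n \<omega>) \<partial>M) - (\<integral>\<omega>. g (X n \<omega>) \<partial>M)\<bar> \<le> \<epsilon> / 3" for n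
    using M.expectation_fold_approximation[OF X[of n] I(1) I(2) F R(1) pX g] pB by force
  have aY: "\<bar>(\<integral>\<omega>. F (Y \<omega>) \<partial>N) - (\<integral>\<omega>. g (Y \<omega>) \<partial>N)\<bar> \<le> \<epsilon> / 3"
    using N.expectation_fold_approximation[OF Y I(1) I(3) F R(1) pY g] pB by force
  have "(\<lambda>n. \<integral>\<omega>. g (X n \<omega>) \<partial>M) \<longlonglongrightarrow> (\<integral>\<omega>. g (Y \<omega>) \<partial>N)"
    using g(1)
  proof (induction rule: trig_poly.induct)
    case (cos c t s)
    then show ?case using tendsto_mult_left[OF conv[of t s], of c] by simp
  next
    case (add f g)
    have "integrable M (\<lambda>\<omega>. h (X n \<omega>))" if h: "trig_poly I h" for h n
    proof -
      obtain C where "\<And>x. \<bar>h x\<bar> \<le> C" using bounded_trig_poly[OF h] by blast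
      then show ?thesis using borel_measurable_continuous_on[OF continuous_trig_poly[OF h] X]
        by (intro M.integrable_const_bound[of _ C]) auto
    qed
    moreover have "integrable N (\<lambda>\<omega>. h (Y \<omega>))" if h: "trig_poly I h" for h
    proof -
      obtain C where "\<And>x. \<bar>h x\<bar> \<le> C" using bounded_trig_poly[OF h] by blast
      then show ?thesis using borel_measurable_continuous_on[OF continuous_trig_poly[OF h] Y]
        by (intro N.integrable_const_bound[of _ C]) auto
    qed
    ultimately show ?case using tendsto_add[OF add.IH] add.hyps by simp
  qed
  then obtain n0 where n0: "\<And>n. n \<ge> n0 \<Longrightarrow> \<bar>(\<integral>\<omega>. g (X n \<omega>) \<partial>M) - (\<integral>\<omega>. g (Y \<omega>) \<partial>N)\<bar> < \<epsilon> / 3"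
    using LIMSEQ_D[of _ _ "\<epsilon> / 3"] \<epsilon> by (metis divide_pos_pos real_norm_def zero_less_numeral)
  show "\<exists>no. \<forall>n\<ge>no. norm ((\<integral>\<omega>. F (X n \<omega>) \<partial>M) - (\<integral>\<omega>. F (Y \<omega>) \<partial>N)) < \<epsilon>"
  proof (intro exI[of _ n0] allI impI)
    fix n assume "n \<ge> n0"
    then show "norm ((\<integral>\<omega>. F (X n \<omega>) \<partial>M) - (\<integral>\<omega>. F (Y \<omega>) \<partial>N)) < \<epsilon>"
      using n0[of n] aX[of n] aY unfolding real_norm_def by linarith
  qed
qed

section \<open>Centred square integrable walks on the line\<close>

locale iid_centred = prob_space M for M :: "'w measure" +
  fixes Y :: "nat \<Rightarrow> 'w \<Rightarrow> real"
  assumes indep: "indep_vars (\<lambda>_. borel) Y UNIV"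
    and ident: "\<And>i. distr M borel (Y i) = distr M borel (Y 0)"
    and square_integrable: "integrable M (\<lambda>\<omega>. (Y 0 \<omega>)\<^sup>2)"
    and mean_zero: "expectation (Y 0) = 0"
begin

definition second_moment :: real where
  "second_moment = expectation (\<lambda>\<omega>. (Y 0 \<omega>)\<^sup>2)"

lemma measurable_Y[measurable]: "Y i \<in> borel_measurable M"
  using indep unfolding indep_vars_def2 by simp

lemma second_moment_nonneg: "0 \<le> second_moment"
  by (simp add: second_moment_def)

lemma
  shows integrable_Y_square: "integrable M (\<lambda>\<omega>. (Y i \<omega>)\<^sup>2)"
    and expectation_Y_square: "expectation (\<lambda>\<omega>. (Y i \<omega>)\<^sup>2) = second_moment"
    and expectation_Y: "expectation (Y i) = 0"
proof -
  have "integrable (distr M borel (Y i)) (\<lambda>x. x\<^sup>2)"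
    unfolding ident[of i] using square_integrable by (subst integrable_distr_eq) auto
  then show "integrable M (\<lambda>\<omega>. (Y i \<omega>)\<^sup>2)" by (subst (asm) integrable_distr_eq) auto
  have "(\<integral>x. x\<^sup>2 \<partial>distr M borel (Y i)) = (\<integral>x. x\<^sup>2 \<partial>distr M borel (Y 0))" by (simp only: ident[of i])
  then show "expectation (\<lambda>\<omega>. (Y i \<omega>)\<^sup>2) = second_moment"
    by (simp add: integral_distr second_moment_def)
  have "(\<integral>x. x \<partial>distr M borel (Y i)) = (\<integral>x. x \<partial>distr M borel (Y 0))" by (simp only: ident[of i])
  then show "expectation (Y i) = 0" using mean_zero by (simp add: integral_distr)
qed

lemma integrable_Y: "integrable M (Y i)"
  by (rule square_integrable_imp_integrable[OF _ integrable_Y_square]) simp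

lemma sum_moments:
  assumes "finite I"
  shows "integrable M (\<lambda>\<omega>. (\<Sum>i\<in>I. Y i \<omega>)\<^sup>2) \<and> expectation (\<lambda>\<omega>. (\<Sum>i\<in>I. Y i \<omega>)\<^sup>2) = card I * second_moment"
  using assms
proof (induction I rule: finite_induct)
  case (insert j I)
  let ?S = "\<lambda>\<omega>. \<Sum>i\<in>I. Y i \<omega>"
  have iv: "indep_var borel (Y j) borel ?S"
    using insert by (intro indep_vars_sum indep_vars_subset[OF indep]) auto
  have S: "integrable M ?S" using integrable_Y by simp
  have YS: "integrable M (\<lambda>\<omega>. Y j \<omega> * ?S \<omega>)"
    by (rule indep_var_integrable[OF iv integrable_Y S])
  have EYS: "expectation (\<lambda>\<omega>. Y j \<omega> * ?S \<omega>) = 0"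
    using indep_var_lebesgue_integral[OF iv integrable_Y S] by (simp add: expectation_Y)
  have eq: "(\<lambda>\<omega>. (\<Sum>i\<in>insert j I. Y i \<omega>)\<^sup>2) = (\<lambda>\<omega>. (Y j \<omega>)\<^sup>2 + 2 * (Y j \<omega> * ?S \<omega>) + (?S \<omega>)\<^sup>2)"
    using insert by (simp add: fun_eq_iff power2_sum)
  show ?case unfolding eq using insert YS EYS integrable_Y_square expectation_Y_square[of j]
    by (simp add: algebra_simps)
qed simp

abbreviation sum_tail :: "nat set \<Rightarrow> real \<Rightarrow> real" where
  "sum_tail I r \<equiv> prob {\<omega>\<in>space M. \<bar>\<Sum>i\<in>I. Y i \<omega>\<bar> \<ge> r}"

lemma prob_sum_ge_le:
  assumes "finite I" "c > 0"
  shows "sum_tail I c \<le> card I * second_moment / c\<^sup>2"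
  using second_moment_method[of "\<lambda>\<omega>. \<Sum>i\<in>I. Y i \<omega>" c] sum_moments[OF assms(1)] assms(2) by simp

text \<open>The characteristic function is a power whose exponent is the number of terms. This lets
  the central limit theorem, which speaks of initial segments, be used for an arbitrary finite set
  of indices.\<close>

lemma distr_sum_eq:
  assumes "finite I" "finite J" "card I = card J"
  shows "distr M borel (\<lambda>\<omega>. \<Sum>i\<in>I. Y i \<omega>) = distr M borel (\<lambda>\<omega>. \<Sum>i\<in>J. Y i \<omega>)"
proof (rule Levy_uniqueness)
  have char: "char (distr M borel (\<lambda>\<omega>. \<Sum>i\<in>I. Y i \<omega>)) t = char (distr M borel (Y 0)) t ^ card I" for t I
  proof -
    have "char (distr M borel (\<lambda>\<omega>. \<Sum>i\<in>I. Y i \<omega>)) t = (\<Prod>i\<in>I. char (distr M borel (Y i)) t)"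
      by (intro char_distr_sum indep_vars_subset[OF indep]) simp
    also have "\<dots> = (\<Prod>i\<in>I. char (distr M borel (Y 0)) t)"
    proof (rule prod.cong[OF refl])
      show "char (distr M borel (Y i)) t = char (distr M borel (Y 0)) t" for i by (simp only: ident[of i])
    qed
    finally show ?thesis by simp
  qed
  show "char (distr M borel (\<lambda>\<omega>. \<Sum>i\<in>I. Y i \<omega>)) = char (distr M borel (\<lambda>\<omega>. \<Sum>i\<in>J. Y i \<omega>))"
    using assms by (simp add: fun_eq_iff char)
qed simp_all

text \<open>Etemadi's inequality, in the form where the bound \<open>p\<close> is common to all increments: decompose
  according to the first time at which the walk leaves \<open>(-3c, 3c)\<close>.\<close>
lemma maximal_inequality:
  fixes a m :: nat and p c :: real
  assumes c: "c > 0" and p: "\<And>i j. i \<le> j \<Longrightarrow> j \<le> m \<Longrightarrow> prob {\<omega>\<in>space M. \<bar>\<Sum>l=a+i..<a+j. Y l \<omega>\<bar> \<ge> c} \<le> p"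
  shows "prob {\<omega>\<in>space M. \<exists>j\<le>m. \<bar>\<Sum>l=a..<a+j. Y l \<omega>\<bar> \<ge> 3 * c} \<le> 2 * p"
proof -
  let ?T = "\<lambda>j \<omega>. \<Sum>l=a..<a+j. Y l \<omega>"
  let ?D = "\<lambda>j \<omega>. \<Sum>l=a+j..<a+m. Y l \<omega>"
  define A where "A j = {\<omega>\<in>space M. \<bar>?T j \<omega>\<bar> \<ge> 3 * c \<and> (\<forall>i<j. \<bar>?T i \<omega>\<bar> < 3 * c)}" for j
  let ?B = "\<lambda>j. {\<omega>\<in>space M. \<bar>?D j \<omega>\<bar> \<ge> c}"
  have split: "?T m \<omega> = ?T j \<omega> + ?D j \<omega>" if "j \<le> m" for j \<omega>
    using that by (simp add: sum.atLeastLessThan_concat)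
  have A[measurable]: "A j \<in> events" for j unfolding A_def by measurable
  have B[measurable]: "?B j \<in> events" for j by measurable
  have disj: "disjoint_family_on A {..m}"
    unfolding disjoint_family_on_def
  proof (intro ballI impI)
    fix i j :: nat assume "i \<noteq> j"
    then have "i < j \<or> j < i" by linarith
    then show "A i \<inter> A j = {}" by (auto simp: A_def)
  qed
  have p0: "0 \<le> p" using p[of 0 0] measure_nonneg order_trans by blast
  have AB: "prob (A j \<inter> ?B j) = prob (A j) * prob (?B j)" if "j \<le> m" for j
  proof -
    \<comment> \<open>The event \<open>A j\<close> depends on the increments before
      \<open>a + j\<close> and \<open>?B j\<close> on the later ones. Writing the former as
      \<open>?f = 1\<close> turns this into independence of functions of two disjoint
      restrictions.\<close>
    let ?f = "\<lambda>z::nat \<Rightarrow> real. if \<bar>\<Sum>l=a..<a+j. z l\<bar> \<ge> 3 * c \<and> (\<forall>i\<in>{..<j}. \<bar>\<Sum>l=a..<a+i. z l\<bar> < 3 * c) then 1 else 0 :: real"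
    let ?g = "\<lambda>z::nat \<Rightarrow> real. \<Sum>l=a+j..<a+m. z l"
    have sm: "(\<lambda>z. \<Sum>l\<in>L. z l) \<in> borel_measurable (PiM K (\<lambda>_. borel :: real measure))" if "L \<subseteq> K" for L K :: "nat set"
      using that by (intro borel_measurable_sum measurable_component_singleton) auto
    have f: "?f \<in> borel_measurable (PiM {a..<a+j} (\<lambda>_. borel))"
      by (intro measurable_If measurable_const pred_intros_logic pred_intros_finite
           borel_measurable_le borel_measurable_less borel_measurable_abs sm) auto
    have g: "?g \<in> borel_measurable (PiM {a+j..<a+m} (\<lambda>_. borel))"
      by (intro sm) auto
    have s1: "{1 :: real} \<in> sets borel" by simp
    have sc: "{y :: real. \<bar>y\<bar> \<ge> c} \<in> sets borel" by measurable
    have "indep_var borel (?f \<circ> (\<lambda>\<omega>. restrict (\<lambda>i. Y i \<omega>) {a..<a+j})) borel (?g \<circ> (\<lambda>\<omega>. restrict (\<lambda>i. Y i \<omega>) {a+j..<a+m}))"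
      by (intro indep_var_compose[OF indep_var_restrict[OF indep]] f g) auto
    from indep_varD[OF this s1 sc]
    have "prob ((\<lambda>x. (?f (restrict (\<lambda>i. Y i x) {a..<a+j}), ?g (restrict (\<lambda>i. Y i x) {a+j..<a+m}))) -` ({1} \<times> {y. \<bar>y\<bar> \<ge> c}) \<inter> space M)
       = prob ((\<lambda>x. ?f (restrict (\<lambda>i. Y i x) {a..<a+j})) -` {1} \<inter> space M) * prob ((\<lambda>x. ?g (restrict (\<lambda>i. Y i x) {a+j..<a+m})) -` {y. \<bar>y\<bar> \<ge> c} \<inter> space M)"
      by (simp only: comp_def)
    moreover have r: "(\<Sum>l=a..<a+i. restrict (\<lambda>i. Y i x) {a..<a+j} l) = ?T i x" if "i \<le> j" for i x
      using that by (intro sum.cong) auto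
    have rf: "?f (restrict (\<lambda>i. Y i x) {a..<a+j}) = (if \<bar>?T j x\<bar> \<ge> 3 * c \<and> (\<forall>i<j. \<bar>?T i x\<bar> < 3 * c) then 1 else 0)" for x
      using r[of j x] by (auto simp: r less_imp_le cong: if_cong simp del: restrict_apply)
    have rg: "?g (restrict (\<lambda>i. Y i x) {a+j..<a+m}) = ?D j x" for x
      by (intro sum.cong) auto
    have "(\<lambda>x. (?f (restrict (\<lambda>i. Y i x) {a..<a+j}), ?g (restrict (\<lambda>i. Y i x) {a+j..<a+m}))) -` ({1} \<times> {y. \<bar>y\<bar> \<ge> c}) \<inter> space M = A j \<inter> ?B j"
      unfolding rf rg A_def by (auto split: if_splits)
    moreover have "(\<lambda>x. ?f (restrict (\<lambda>i. Y i x) {a..<a+j})) -` {1} \<inter> space M = A j"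
      unfolding rf A_def by (auto split: if_splits)
    moreover have "(\<lambda>x. ?g (restrict (\<lambda>i. Y i x) {a+j..<a+m})) -` {y. \<bar>y\<bar> \<ge> c} \<inter> space M = ?B j"
      unfolding rg by auto
    ultimately show ?thesis by simp
  qed
  \<comment> \<open>After a first exit at time \<open>j\<close>, the full sum \<open>?D 0\<close>
    and the remainder \<open>?D j\<close> cannot both be smaller than \<open>c\<close>. The first
    alternative costs one \<open>p\<close>; the second costs another, weighted by the probabilities
    of the disjoint \<open>A j\<close>.\<close>
  have sub: "{\<omega>\<in>space M. \<exists>j\<le>m. \<bar>?T j \<omega>\<bar> \<ge> 3 * c} \<subseteq> ?B 0 \<union> (\<Union>j\<in>{..m}. A j \<inter> ?B j)"
  proof
    fix \<omega> assume w: "\<omega> \<in> {\<omega>\<in>space M. \<exists>j\<le>m. \<bar>?T j \<omega>\<bar> \<ge> 3 * c}"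
    then obtain j0 where j0: "j0 \<le> m" "\<bar>?T j0 \<omega>\<bar> \<ge> 3 * c" by blast
    define j where "j = (LEAST j. \<bar>?T j \<omega>\<bar> \<ge> 3 * c)"
    have j: "\<bar>?T j \<omega>\<bar> \<ge> 3 * c" unfolding j_def by (rule LeastI[of _ j0]) (rule j0)
    have jm: "j \<le> m" using Least_le[of "\<lambda>j. \<bar>?T j \<omega>\<bar> \<ge> 3 * c" j0] j0 unfolding j_def by simp
    have jl: "\<bar>?T i \<omega>\<bar> < 3 * c" if "i < j" for i
      using not_less_Least[of i "\<lambda>j. \<bar>?T j \<omega>\<bar> \<ge> 3 * c"] that unfolding j_def by (simp add: not_le)
    have "\<omega> \<in> A j" using w j jl by (auto simp: A_def)
    moreover have "\<bar>?D 0 \<omega>\<bar> \<ge> c \<or> \<bar>?D j \<omega>\<bar> \<ge> c"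
    proof -
      have "?D 0 \<omega> = ?T j \<omega> + ?D j \<omega>" using split[OF jm, of \<omega>] by simp
      then show ?thesis using j c by linarith
    qed
    ultimately show "\<omega> \<in> ?B 0 \<union> (\<Union>j\<in>{..m}. A j \<inter> ?B j)" using w jm by blast
  qed
  have "prob {\<omega>\<in>space M. \<exists>j\<le>m. \<bar>?T j \<omega>\<bar> \<ge> 3 * c} \<le> prob (?B 0 \<union> (\<Union>j\<in>{..m}. A j \<inter> ?B j))"
    by (rule finite_measure_mono[OF sub]) auto
  also have "\<dots> \<le> prob (?B 0) + prob (\<Union>j\<in>{..m}. A j \<inter> ?B j)"
    by (intro measure_Un_le) auto
  also have "prob (\<Union>j\<in>{..m}. A j \<inter> ?B j) \<le> (\<Sum>j\<in>{..m}. prob (A j \<inter> ?B j))"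
    by (intro finite_measure_subadditive_finite) auto
  also have "\<dots> \<le> (\<Sum>j\<in>{..m}. prob (A j) * p)"
  proof (intro sum_mono)
    fix j assume "j \<in> {..m}"
    then show "prob (A j \<inter> ?B j) \<le> prob (A j) * p"
      using p[of j m] by (simp add: AB mult_left_mono)
  qed
  also have "\<dots> = prob (\<Union>j\<in>{..m}. A j) * p"
    using finite_measure_finite_Union[of "{..m}" A] disj A by (simp add: sum_distrib_right image_subset_iff)
  also have "\<dots> \<le> 1 * p" using p0 by (intro mult_right_mono) auto
  also have "prob (?B 0) \<le> p" using p[of 0 m] by simp
  finally show ?thesis by simp
qed

text \<open>The function \<open>?g\<close> is bounded and continuous and dominates the indicator of
  \<open>\<bar>x\<bar> \<ge> c\<close>, so its expectation converges although \<open>Y\<close> may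
  have no fourth moment. The 3 is the fourth moment of the standard normal law.\<close>

lemma normalized_sum_tail:
  assumes s: "second_moment > 0" and c: "c > 0" and \<delta>: "\<delta> > 0"
  shows "\<forall>\<^sub>F n in sequentially. sum_tail {..<n} (c * sqrt (n * second_moment)) \<le> 3 / c ^ 4 + \<delta>"
proof -
  define \<sigma> where "\<sigma> = sqrt second_moment"
  have \<sigma>: "\<sigma> > 0" "\<sigma>\<^sup>2 = second_moment" using s by (auto simp: \<sigma>_def)
  let ?T = "\<lambda>n \<omega>. (\<Sum>i<n. Y i \<omega>) / sqrt (n * second_moment)"
  let ?g = "\<lambda>x::real. min 1 ((x / c) ^ 4)"
  have W: "weak_conv_m (\<lambda>n. distr M borel (?T n)) std_normal_distribution"
    using central_limit_theorem_zero_mean[OF indep expectation_Y \<sigma>(1) integrable_Y_square, of "distr M borel (Y 0)"]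
      ident expectation_Y_square expectation_Y \<sigma>(2) by simp
  have dist: "real_distribution (distr M borel (?T n))" for n
    by (rule real_distribution_distr) simp
  have "(\<lambda>n. \<integral>x. ?g x \<partial>distr M borel (?T n)) \<longlonglongrightarrow> (\<integral>x. ?g x \<partial>std_normal_distribution)"
    by (rule weak_conv_imp_integral_bdd_continuous_conv[OF dist real_dist_normal_dist W, where B = 1])
       (use c in \<open>auto intro!: continuous_intros\<close>)
  moreover have "(\<integral>x. ?g x \<partial>std_normal_distribution) \<le> 3 / c ^ 4"
  proof -
    have i4: "integrable std_normal_distribution (\<lambda>x. (x / c) ^ 4)"
      using integrable_std_normal_distribution_moment[of 4] by (simp add: power_divide)
    have "(\<integral>x. ?g x \<partial>std_normal_distribution) \<le> (\<integral>x. (x / c) ^ 4 \<partial>std_normal_distribution)"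
      by (rule integral_mono[OF _ i4])
         (auto intro!: Bochner_Integration.integrable_bound[OF i4])
    also have "\<dots> = 3 / c ^ 4"
      using std_normal_distribution_even_moments(1)[of 2] by (simp add: power_divide fact_numeral)
    finally show ?thesis .
  qed
  ultimately have ev: "\<forall>\<^sub>F n in sequentially. (\<integral>x. ?g x \<partial>distr M borel (?T n)) < 3 / c ^ 4 + \<delta>"
    using \<delta> by (intro order_tendstoD) auto
  show ?thesis
    using ev eventually_gt_at_top[of 0]
  proof eventually_elim
    case (elim n)
    let ?E = "{\<omega>\<in>space M. \<bar>\<Sum>i<n. Y i \<omega>\<bar> \<ge> c * sqrt (n * second_moment)}"
    have pos: "sqrt (n * second_moment) > 0" using elim s by simp
    have E: "?E \<in> events" by measurable
    have gi: "integrable M (\<lambda>\<omega>. ?g (?T n \<omega>))"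
      by (rule integrable_const_bound[of _ 1]) auto
    have "prob ?E = expectation (indicator ?E)" using E by simp
    also have "\<dots> \<le> expectation (\<lambda>\<omega>. ?g (?T n \<omega>))"
    proof (rule integral_mono)
      show "integrable M (indicator ?E :: _ \<Rightarrow> real)" using E by (intro integrable_real_indicator) (auto simp: less_top[symmetric])
      show "indicator ?E \<omega> \<le> ?g (?T n \<omega>)" for \<omega>
      proof (cases "\<omega> \<in> ?E")
        case True
        then have "c \<le> \<bar>\<Sum>i<n. Y i \<omega>\<bar> / sqrt (n * second_moment)" using pos by (simp only: pos_le_divide_eq mem_Collect_eq)
        also have "\<dots> = \<bar>?T n \<omega>\<bar>" using pos by (simp only: abs_div_pos)
        finally have "c \<le> \<bar>?T n \<omega>\<bar>" .
        then have "1 \<le> \<bar>?T n \<omega>\<bar> / c" using c by (simp only: le_divide_eq_1_pos)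
        then have "1 \<le> \<bar>?T n \<omega> / c\<bar>" using c by (simp only: abs_div_pos)
        then have "1 \<le> \<bar>?T n \<omega> / c\<bar> ^ 4" by (rule one_le_power)
        then have "1 \<le> (?T n \<omega> / c) ^ 4" by (simp only: power_even_abs_numeral even_numeral)
        then show ?thesis using True by (simp add: min_def)
      qed auto
    qed (rule gi)
    also have "\<dots> = (\<integral>x. ?g x \<partial>distr M borel (?T n))" by (simp add: integral_distr)
    finally show ?case using elim(1) by linarith
  qed
qed

text \<open>The fourth moment of the Gaussian limit is what makes the probability small compared with \<open>1 / k\<close>;
  sums of few terms, for which the central limit theorem says nothing, are handled by Chebyshev's
  inequality.\<close>
lemma short_sum_tail:
  assumes \<epsilon>: "\<epsilon> > 0" and \<eta>: "\<eta> > 0"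
  shows "\<exists>k0. \<forall>k\<ge>k0. \<exists>n0. \<forall>n\<ge>n0. \<forall>I. finite I \<longrightarrow> card I \<le> n div k + 1 \<longrightarrow>
     real k * sum_tail I (\<epsilon> * sqrt n) \<le> \<eta>"
proof (cases "second_moment = 0")
  \<comment> \<open>A degenerate walk cannot be normalized by its standard deviation; Chebyshev's
    bound is zero here.\<close>
  case True
  show ?thesis
  proof (rule exI[of _ 0], intro allI impI, rule exI[of _ 1], intro allI impI)
    fix k n :: nat and I :: "nat set" assume "1 \<le> n" "finite I"
    then have "sum_tail I (\<epsilon> * sqrt n) \<le> 0"
      using prob_sum_ge_le[of I "\<epsilon> * sqrt n"] True \<epsilon> by simp
    then have "sum_tail I (\<epsilon> * sqrt n) = 0"
      using measure_nonneg[of M "{\<omega>\<in>space M. \<bar>\<Sum>i\<in>I. Y i \<omega>\<bar> \<ge> \<epsilon> * sqrt n}"] by linarith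
    then show "real k * sum_tail I (\<epsilon> * sqrt n) \<le> \<eta>" using \<eta> by simp
  qed
next
  case False
  let ?s = second_moment
  have s: "?s > 0" using False second_moment_nonneg by simp
  \<comment> \<open>With the \<open>c\<close> chosen below, \<open>k\<close> times the bound
    \<open>3 / c ^ 4 + 1 / k^2\<close> is exactly \<open>C / k\<close>.\<close>
  define C where "C = 12 * ?s\<^sup>2 / \<epsilon> ^ 4 + 1"
  have C: "C > 0" by (simp add: C_def add_nonneg_pos)
  define k0 where "k0 = nat \<lceil>C / \<eta>\<rceil> + 1"
  show ?thesis
  proof (rule exI[of _ k0], intro allI impI)
    fix k assume k: "k0 \<le> k"
    have k1: "real k > 0" using k by (simp add: k0_def)
    have "C / \<eta> \<le> real k" using k unfolding k0_def by linarith
    then have Ck: "C / real k \<le> \<eta>" using k1 \<eta> by (simp add: field_simps)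
    \<comment> \<open>A set of \<open>i\<close> terms with \<open>i * k \<le> 2 * n\<close> has
      standard deviation at most \<open>sqrt (2 * n * second_moment / k)\<close>; \<open>c\<close>
      is \<open>\<epsilon> * sqrt n\<close> divided by this value.\<close>
    define c where "c = sqrt (\<epsilon>\<^sup>2 * k / (2 * ?s))"
    have c: "c > 0" using \<epsilon> k1 s by (simp add: c_def)
    have "(c\<^sup>2)\<^sup>2 = (\<epsilon>\<^sup>2 * k / (2 * ?s))\<^sup>2" using \<epsilon> k1 s by (simp add: c_def)
    then have c4: "c ^ 4 = (\<epsilon>\<^sup>2 * k / (2 * ?s))\<^sup>2" by (simp flip: power_mult)
    have Cc: "real k * (3 / c ^ 4 + 1 / (real k)\<^sup>2) = C / k"
      unfolding c4 C_def using k1 s \<epsilon> by (simp add: field_simps power2_eq_square power4_eq_xxxx)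
    have "\<forall>\<^sub>F i in sequentially. sum_tail {..<i} (c * sqrt (i * ?s)) \<le> 3 / c ^ 4 + 1 / (real k)\<^sup>2"
      using k1 by (intro normalized_sum_tail s c) simp
    then obtain i0 where i0: "\<And>i. i \<ge> i0 \<Longrightarrow> sum_tail {..<i} (c * sqrt (i * ?s)) \<le> 3 / c ^ 4 + 1 / (real k)\<^sup>2"
      by (auto simp: eventually_sequentially)
    \<comment> \<open>From \<open>k \<le> n\<close> it follows that \<open>n div k + 1\<close> is at
      most \<open>2 * n / k\<close>. The second entry makes Chebyshev's bound small enough for sums
      of fewer than \<open>i0\<close> terms.\<close>
    define n0 where "n0 = max k (nat \<lceil>k * (i0 * ?s) / (\<epsilon>\<^sup>2 * \<eta>)\<rceil> + 1)"
    show "\<exists>n0. \<forall>n\<ge>n0. \<forall>I. finite I \<longrightarrow> card I \<le> n div k + 1 \<longrightarrow>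
     real k * sum_tail I (\<epsilon> * sqrt n) \<le> \<eta>"
    proof (intro exI[of _ n0] allI impI)
      fix n and I :: "nat set" assume n: "n0 \<le> n" and I: "finite I" "card I \<le> n div k + 1"
      have nk: "k \<le> n" using n by (simp add: n0_def)
      have n1: "real n > 0" using nk k1 by linarith
      have n2: "k * (i0 * ?s) / (\<epsilon>\<^sup>2 * \<eta>) \<le> n" using n unfolding n0_def by linarith
      let ?P = "sum_tail I (\<epsilon> * sqrt n)"
      show "real k * ?P \<le> \<eta>"
      proof (cases "card I \<ge> i0")
        case True
        let ?i = "card I"
        have "real (n div k) * real k \<le> real n"
          by (metis of_nat_le_iff of_nat_mult div_times_less_eq_dividend)
        moreover have "real ?i * real k \<le> (real (n div k) + 1) * real k"
          using I(2) k1 by (intro mult_right_mono) auto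
        ultimately have "real ?i * real k \<le> real n + real k" by (simp add: algebra_simps)
        then have ik: "real ?i * real k \<le> 2 * real n" using nk by linarith
        have "c * sqrt (?i * ?s) = \<epsilon> * sqrt (?i * k / 2)"
        proof -
          have "c * sqrt (?i * ?s) = sqrt (\<epsilon>\<^sup>2 * (?i * k / 2))"
            unfolding c_def using s by (simp add: real_sqrt_mult[symmetric])
          also have "\<dots> = sqrt (\<epsilon>\<^sup>2) * sqrt (?i * k / 2)" by (rule real_sqrt_mult)
          also have "sqrt (\<epsilon>\<^sup>2) = \<epsilon>" using \<epsilon> by simp
          finally show ?thesis .
        qed
        also have "\<dots> \<le> \<epsilon> * sqrt n" using ik \<epsilon> by (intro mult_left_mono real_sqrt_le_mono) auto
        finally have le: "c * sqrt (?i * ?s) \<le> \<epsilon> * sqrt n" .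
        have "?P = measure (distr M borel (\<lambda>\<omega>. \<Sum>i\<in>I. Y i \<omega>)) {x. \<bar>x\<bar> \<ge> \<epsilon> * sqrt n}"
          by (subst measure_distr) (auto intro!: arg_cong[where f=prob])
        also have "distr M borel (\<lambda>\<omega>. \<Sum>i\<in>I. Y i \<omega>) = distr M borel (\<lambda>\<omega>. \<Sum>i<?i. Y i \<omega>)"
          using I by (intro distr_sum_eq) auto
        also have "measure \<dots> {x. \<bar>x\<bar> \<ge> \<epsilon> * sqrt n} = sum_tail {..<?i} (\<epsilon> * sqrt n)"
          by (subst measure_distr) (auto intro!: arg_cong[where f=prob])
        also have "\<dots> \<le> sum_tail {..<?i} (c * sqrt (?i * ?s))"
          using le by (intro finite_measure_mono) auto
        also have "\<dots> \<le> 3 / c ^ 4 + 1 / (real k)\<^sup>2" by (rule i0[OF True])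
        finally have "real k * ?P \<le> real k * (3 / c ^ 4 + 1 / (real k)\<^sup>2)" using k1 by (intro mult_left_mono) auto
        then show ?thesis using Cc Ck by simp
      next
        case False
        have "?P \<le> card I * ?s / (\<epsilon> * sqrt n)\<^sup>2" using I \<epsilon> n1 by (intro prob_sum_ge_le) auto
        also have "(\<epsilon> * sqrt n)\<^sup>2 = \<epsilon>\<^sup>2 * n" by (simp add: power_mult_distrib)
        also have "card I * ?s / (\<epsilon>\<^sup>2 * n) \<le> i0 * ?s / (\<epsilon>\<^sup>2 * n)"
          using False s n1 \<epsilon> by (intro divide_right_mono mult_right_mono) auto
        finally have "real k * ?P \<le> real k * (i0 * ?s / (\<epsilon>\<^sup>2 * n))" using k1 by (intro mult_left_mono) auto
        also have "\<dots> \<le> \<eta>" using n2 n1 \<epsilon> \<eta> by (simp add: field_simps)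
        finally show ?thesis .
      qed
    qed
  qed
qed

text \<open>A block has about \<open>n / k\<close> terms but is divided by \<open>sqrt n\<close>, so
  the number of factors and the normalization are decoupled; the application has
  \<open>r = 1 / k\<close>.\<close>

lemma char_power_tendsto:
  fixes m :: "nat \<Rightarrow> nat"
  assumes m: "\<And>n. m n \<le> n" "(\<lambda>n. m n / n) \<longlonglongrightarrow> r"
  shows "(\<lambda>n. char (distr M borel (Y 0)) (\<theta> / sqrt n) ^ m n) \<longlonglongrightarrow> exp (- (\<theta>\<^sup>2 * second_moment * r / 2))"
proof -
  define a where "a = \<theta>\<^sup>2 * second_moment / 2"
  let ?\<phi> = "char (distr M borel (Y 0))"
  \<comment> \<open>For \<open>n > a\<close> this comparison base lies in \<open>(0, 1]\<close>: the
    upper bound is needed to compare powers factor by factor, positivity to take real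
    powers.\<close>
  let ?w = "\<lambda>n::nat. 1 - a / n"
  let ?e = "\<lambda>n::nat. \<theta>\<^sup>2 / 6 * expectation (\<lambda>\<omega>. min (6 * (Y 0 \<omega>)\<^sup>2) (\<bar>\<theta> / sqrt n\<bar> * \<bar>Y 0 \<omega>\<bar> ^ 3))"
  have a0: "0 \<le> a" using second_moment_nonneg by (simp add: a_def)
  interpret D: real_distribution "distr M borel (Y 0)" by (rule real_distribution_distr) simp
  have var: "variance (Y 0) = second_moment"
    by (simp add: expectation_Y second_moment_def)
  have "\<forall>\<^sub>F n in sequentially. real n > a"
    using filterlim_real_sequentially unfolding filterlim_at_top_dense by blast
  then have big: "\<forall>\<^sub>F n in sequentially. real n > a \<and> n > 0" using eventually_gt_at_top[of 0] by eventually_elim simp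
  have main: "\<forall>\<^sub>F n in sequentially. norm (?\<phi> (\<theta> / sqrt n) ^ m n - complex_of_real (?w n ^ m n)) \<le> ?e n"
    using big
  proof eventually_elim
    case (elim n)
    have w: "\<bar>?w n\<bar> \<le> 1" using elim a0 by (auto simp: abs_le_iff field_simps)
    have "norm (?\<phi> (\<theta> / sqrt n) ^ m n - complex_of_real (?w n) ^ m n) \<le> m n * norm (?\<phi> (\<theta> / sqrt n) - complex_of_real (?w n))"
      using w by (intro norm_power_diff D.cmod_char_le_1) (simp only: norm_of_real)
    also have "\<dots> \<le> n * norm (?\<phi> (\<theta> / sqrt n) - complex_of_real (?w n))"
      using m(1) by (intro mult_right_mono) auto
    also have weq: "complex_of_real (?w n) = 1 - (\<theta> / sqrt n)\<^sup>2 * second_moment / 2"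
      using elim by (simp add: a_def power_divide)
    also have "n * norm (?\<phi> (\<theta> / sqrt n) - \<dots>) \<le> n * ((\<theta> / sqrt n)\<^sup>2 / 6 * expectation (\<lambda>\<omega>. min (6 * (Y 0 \<omega>)\<^sup>2) (\<bar>\<theta> / sqrt n\<bar> * \<bar>Y 0 \<omega>\<bar> ^ 3)))"
      using char_approx3'[OF measurable_Y integrable_Y integrable_Y_square expectation_Y var refl, of "\<theta> / sqrt n"]
      by (intro mult_left_mono) auto
    also have "\<dots> = ?e n" using elim by (simp add: power_divide)
    finally show ?case by (simp only: of_real_power weq)
  qed
  \<comment> \<open>Multiplying the remainder by \<open>n\<close> cancels the factor
    \<open>1 / n\<close> of the squared argument. What remains is dominated by
    \<open>6 * (Y 0 \<omega>)\<^sup>2\<close>, so second moments are enough.\<close>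
  have "(\<lambda>n. expectation (\<lambda>\<omega>. min (6 * (Y 0 \<omega>)\<^sup>2) (\<bar>\<theta> / sqrt n\<bar> * \<bar>Y 0 \<omega>\<bar> ^ 3))) \<longlonglongrightarrow> expectation (\<lambda>\<omega>. 0)"
  proof (rule integral_dominated_convergence[where w = "\<lambda>\<omega>. 6 * (Y 0 \<omega>)\<^sup>2"])
    have "(\<lambda>n::nat. \<bar>\<theta> / sqrt n\<bar> * z ^ 3) \<longlonglongrightarrow> 0" for z :: real
    proof -
      have "(\<lambda>n::nat. \<theta> / sqrt n) \<longlonglongrightarrow> 0"
        by (intro tendsto_divide_0[OF tendsto_const] filterlim_at_top_imp_at_infinity
            filterlim_compose[OF sqrt_at_top filterlim_real_sequentially])
      then show ?thesis using tendsto_mult_left_zero tendsto_rabs_zero by blast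
    qed
    from tendsto_min[OF tendsto_const this, of "6 * (Y 0 \<omega>)\<^sup>2" "\<bar>Y 0 \<omega>\<bar>" for \<omega>]
    show "AE \<omega> in M. (\<lambda>n. min (6 * (Y 0 \<omega>)\<^sup>2) (\<bar>\<theta> / sqrt n\<bar> * \<bar>Y 0 \<omega>\<bar> ^ 3)) \<longlonglongrightarrow> 0" by simp
  qed (use square_integrable in auto)
  then have "?e \<longlonglongrightarrow> 0" using tendsto_mult_right_zero[of _ sequentially "\<theta>\<^sup>2 / 6"] by simp
  then have diff: "(\<lambda>n. ?\<phi> (\<theta> / sqrt n) ^ m n - complex_of_real (?w n ^ m n)) \<longlonglongrightarrow> 0"
    by (rule Lim_null_comparison[OF main])
  \<comment> \<open>Only the ratio \<open>m n / n\<close> converges. The power \<open>m n\<close> is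
    therefore split into an \<open>n\<close>-th power with a known limit and the real exponent
    \<open>m n / n\<close>.\<close>
  have "(\<lambda>n. ?w n ^ n) \<longlonglongrightarrow> exp (- a)"
    using tendsto_exp_limit_sequentially[of "- a"] by simp
  then have "(\<lambda>n. (?w n ^ n) powr (m n / n)) \<longlonglongrightarrow> exp (- a) powr r"
    by (rule tendsto_powr[OF _ m(2)]) simp
  moreover have "\<forall>\<^sub>F n in sequentially. (?w n ^ n) powr (m n / n) = ?w n ^ m n"
    using big
  proof eventually_elim
    case (elim n)
    then have w: "?w n > 0" by (simp add: field_simps)
    have "(?w n ^ n) powr (m n / n) = (?w n powr n) powr (m n / n)" using w by (simp only: powr_realpow)
    also have "\<dots> = ?w n powr (m n)" using elim by (simp add: powr_powr)
    finally show ?case using w by (simp only: powr_realpow)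
  qed
  ultimately have "(\<lambda>n. ?w n ^ m n) \<longlonglongrightarrow> exp (- a) powr r" using tendsto_cong by fast
  then have "(\<lambda>n. complex_of_real (?w n ^ m n)) \<longlonglongrightarrow> complex_of_real (exp (- a) powr r)" by (rule tendsto_of_real)
  from tendsto_add[OF diff this] show ?thesis by (simp add: powr_def a_def exp_of_real[symmetric] mult_ac)
qed

end

section \<open>Characteristic function of a Gaussian vector\<close>

lemma integral_normal_density_iexp:
  assumes s: "s > 0"
  shows "(CLINT y|lborel. normal_density 0 s y *\<^sub>R iexp (a * y)) = complex_of_real (exp (- ((s * a)\<^sup>2 / 2)))"
proof -
  have "(CLINT y|lborel. normal_density 0 s y *\<^sub>R iexp (a * y))
      = \<bar>s\<bar> *\<^sub>R (CLINT y|lborel. normal_density 0 s (0 + s * y) *\<^sub>R iexp (a * (0 + s * y)))"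
    using s by (intro lborel_integral_real_affine) simp
  also have "\<dots> = (CLINT y|lborel. std_normal_density y *\<^sub>R iexp (s * a * y))"
  proof -
    have "\<bar>s\<bar> * normal_density 0 s (0 + s * y) = std_normal_density y" for y
      using s by (simp add: normal_density_def real_sqrt_mult power_mult_distrib)
    then show ?thesis by (simp flip: integral_scaleR_right add: mult_ac)
  qed
  also have "\<dots> = char std_normal_distribution (s * a)"
    unfolding char_def by (subst integral_density) (auto simp: normal_density_nonneg)
  finally show ?thesis by (simp add: char_std_normal_distribution)
qed

lemma integral_lborel_prod_Basis:
  fixes h :: "'a::euclidean_space \<Rightarrow> real \<Rightarrow> complex"
  assumes h: "\<And>b. b \<in> Basis \<Longrightarrow> integrable lborel (h b)"
  shows "(\<integral>x. (\<Prod>b\<in>Basis. h b (x \<bullet> b)) \<partial>lborel) = (\<Prod>b\<in>Basis. \<integral>y. h b y \<partial>lborel)"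
proof -
  interpret product_sigma_finite "\<lambda>_::'a. lborel :: real measure" ..
  have hm[measurable]: "b \<in> Basis \<Longrightarrow> h b \<in> borel_measurable borel" for b
    using borel_measurable_integrable[OF h] by simp
  have "(\<integral>x. (\<Prod>b\<in>Basis. h b (x \<bullet> b)) \<partial>lborel)
     = (\<integral>f. (\<Prod>b\<in>Basis. h b ((\<Sum>c\<in>Basis. f c *\<^sub>R c) \<bullet> b)) \<partial>(\<Pi>\<^sub>M b\<in>Basis. lborel))"
    unfolding lborel_eq[where 'a='a] by (subst integral_distr) simp_all
  also have "\<dots> = (\<integral>f. (\<Prod>b\<in>Basis. h b (f b)) \<partial>(\<Pi>\<^sub>M b\<in>Basis. lborel))"
    by (intro Bochner_Integration.integral_cong refl prod.cong) simp
  also have "\<dots> = (\<Prod>b\<in>Basis. \<integral>y. h b y \<partial>lborel)"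
    by (rule product_integral_prod) (use h in auto)
  finally show ?thesis .
qed

lemma prod_Basis_vec:
  fixes f :: "real^'m \<Rightarrow> 'b::comm_monoid_mult"
  shows "(\<Prod>b\<in>Basis. f b) = (\<Prod>i\<in>UNIV. f (axis i 1))"
proof -
  have B: "(Basis :: (real^'m) set) = (\<lambda>i. axis i 1) ` UNIV" by (auto simp: Basis_vec_def)
  have inj: "inj (\<lambda>i. axis i (1::real) :: real^'m)" by (auto simp: inj_on_def axis_eq_axis)
  show ?thesis unfolding B prod.reindex[OF inj] comp_def ..
qed

lemma (in prob_space) char_gaussian_vector:
  fixes D :: "'a \<Rightarrow> real^'m"
  assumes D: "distributed M lborel D (\<lambda>x. ennreal (\<Prod>i\<in>UNIV. normal_density 0 s (x $ i)))" and s: "s > 0"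
  shows "char (distr M borel (\<lambda>\<omega>. v \<bullet> D \<omega>)) t = complex_of_real (exp (- ((s * t)\<^sup>2 * (v \<bullet> v) / 2)))"
proof -
  have Dm[measurable]: "D \<in> borel_measurable M" using distributed_measurable[OF D] by simp
  let ?f = "\<lambda>x::real^'m. \<Prod>i\<in>UNIV. normal_density 0 s (x $ i)"
  have f0: "0 \<le> ?f x" for x by (intro prod_nonneg) (simp add: normal_density_nonneg)
  let ?h = "\<lambda>b y. normal_density 0 s y *\<^sub>R iexp (t * (v \<bullet> b) * y)"
  have hi: "integrable lborel (?h b)" for b
    by (rule Bochner_Integration.integrable_bound[OF integrable_normal_density[OF s, of 0]])
       (auto simp: normal_density_nonneg)
  \<comment> \<open>Both the density and the exponential of a linear form are products over the
    coordinates, which reduces the integral to one-dimensional ones.\<close>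
  have split: "?f x *\<^sub>R iexp (t * (v \<bullet> x)) = (\<Prod>b\<in>Basis. ?h b (x \<bullet> b))" for x :: "real^'m"
  proof -
    have "iexp (t * (v \<bullet> x)) = exp (\<Sum>b\<in>Basis. \<i> * (t * (v \<bullet> b) * (x \<bullet> b)))"
      by (subst (1) euclidean_inner) (simp add: sum_distrib_left mult_ac)
    also have "\<dots> = (\<Prod>b\<in>Basis. iexp (t * (v \<bullet> b) * (x \<bullet> b)))"
      by (simp add: exp_sum)
    finally show ?thesis
      by (simp add: prod_Basis_vec inner_axis scaleR_conv_of_real prod.distrib)
  qed
  have "char (distr M borel (\<lambda>\<omega>. v \<bullet> D \<omega>)) t = (CLINT \<omega>|M. iexp (t * (v \<bullet> D \<omega>)))"
    unfolding char_def by (subst integral_distr) auto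
  also have "\<dots> = (CLINT x|distr M lborel D. iexp (t * (v \<bullet> x)))"
    by (subst integral_distr) auto
  also have "\<dots> = (CLINT x|lborel. ?f x *\<^sub>R iexp (t * (v \<bullet> x)))"
    unfolding distributed_distr_eq_density[OF D]
    by (subst integral_density) (auto simp: f0)
  also have "\<dots> = (\<Prod>b\<in>Basis. \<integral>y. ?h b y \<partial>lborel)"
    unfolding split by (rule integral_lborel_prod_Basis[OF hi])
  also have "\<dots> = (\<Prod>b\<in>Basis. complex_of_real (exp (- ((s * (t * (v \<bullet> b)))\<^sup>2 / 2))))"
    by (intro prod.cong refl integral_normal_density_iexp s)
  also have "\<dots> = complex_of_real (exp (\<Sum>b\<in>Basis. - ((s * (t * (v \<bullet> b)))\<^sup>2 / 2)))"
    by (simp add: exp_sum)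
  also have "(\<Sum>b\<in>Basis. - ((s * (t * (v \<bullet> b)))\<^sup>2 / 2)) = - ((s * t)\<^sup>2 * (v \<bullet> v) / 2)"
    by (subst (1) euclidean_inner)
       (simp add: sum_distrib_left sum_negf sum_divide_distrib power2_eq_square mult_ac)
  finally show ?thesis .
qed

section \<open>Convergence of block increments\<close>

lemma nat_div_bounds:
  assumes "k > 0"
  shows "real a / real k - 1 < real (a div k)" "real (a div k) \<le> real a / real k"
proof -
  have "real a = real (a div k) * real k + real (a mod k)"
    by (metis div_mult_mod_eq of_nat_add of_nat_mult)
  moreover have "real (a mod k) < real k" using assms by simp
  ultimately have "real a < (real (a div k) + 1) * real k" "real (a div k) * real k \<le> real a"
    by (auto simp: algebra_simps)
  then show "real a / real k - 1 < real (a div k)" "real (a div k) \<le> real a / real k"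
    using assms by (auto simp: field_simps)
qed

text \<open>Rounding the end points, instead of fixing a common length, gives \<open>k\<close>
  blocks that cover exactly the first \<open>n\<close> steps even if \<open>k\<close> does not
  divide \<open>n\<close>; their lengths differ from \<open>n / k\<close> by at most 1.\<close>

definition block :: "nat \<Rightarrow> nat \<Rightarrow> nat \<Rightarrow> nat set" where
  "block n k l = {l * n div k ..< Suc l * n div k}"

lemma finite_block: "finite (block n k l)" by (simp add: block_def)

lemma UN_block: "(\<Union>l<j. block n k l) = {0..<j * n div k}"
proof (induction j)
  case (Suc j)
  have "j * n div k \<le> Suc j * n div k" by (intro div_le_mono) simp
  then show ?case unfolding lessThan_Suc UN_insert Suc by (auto simp: block_def)
qed simp

lemma disjoint_block:
  assumes "l \<noteq> l'"
  shows "block n k l \<inter> block n k l' = {}"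
proof -
  have "block n k l \<inter> block n k l' = {}" if "l < l'" for l l'
  proof -
    have "Suc l * n div k \<le> l' * n div k" using that by (intro div_le_mono mult_le_mono1) simp
    then show ?thesis by (auto simp: block_def)
  qed
  then show ?thesis using assms by (metis Int_commute linorder_neqE_nat)
qed

lemma card_block_le: "l < k \<Longrightarrow> card (block n k l) \<le> n"
proof -
  assume l: "l < k"
  have "Suc l * n div k \<le> k * n div k" using l by (intro div_le_mono mult_le_mono1) simp
  also have "\<dots> = n" using l by simp
  finally show ?thesis by (simp add: block_def)
qed

lemma card_block_tendsto:
  assumes k: "k > 0"
  shows "(\<lambda>n. real (card (block n k l)) / real n) \<longlonglongrightarrow> 1 / real k"
proof -
  have "\<bar>real (card (block n k l)) - real n / real k\<bar> \<le> 1" for n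
  proof -
    have "l * n div k \<le> Suc l * n div k" by (intro div_le_mono mult_le_mono1) simp
    then have "real (card (block n k l)) = real (Suc l * n div k) - real (l * n div k)"
      by (simp add: block_def of_nat_diff)
    moreover have "real (Suc l * n) / k = real (l * n) / k + real n / k" using k by (simp add: field_simps)
    ultimately show ?thesis
      using nat_div_bounds[OF k, of "Suc l * n"] nat_div_bounds[OF k, of "l * n"] by linarith
  qed
  then have bound: "norm (real (card (block n k l)) / n - 1 / k) \<le> 1 / n" if "n > 0" for n
  proof -
    have "real (card (block n k l)) / n - 1 / k = (real (card (block n k l)) - n / k) / n"
      using that k by (simp add: field_simps)
    then show ?thesis using that \<open>\<bar>real (card (block n k l)) - real n / real k\<bar> \<le> 1\<close>
      by (simp add: abs_divide divide_right_mono)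
  qed
  have "(\<lambda>n. real (card (block n k l)) / n - 1 / k) \<longlonglongrightarrow> 0"
    by (rule Lim_null_comparison[OF _ lim_1_over_n])
       (use bound in \<open>auto intro: eventually_mono[OF eventually_gt_at_top[of 0]]\<close>)
  then show ?thesis by (simp only: LIM_zero_iff)
qed

lemma char_divide:
  assumes [measurable]: "X \<in> borel_measurable M"
  shows "char (distr M borel (\<lambda>\<omega>. X \<omega> / c)) t = char (distr M borel X) (t / c)"
  unfolding char_def by (subst (1 2) integral_distr) auto

text \<open>The phase becomes a rotation of the characteristic function, so convergence of the
  latter yields the cosine expectations required by \<open>Cramer_Wold_expectation\<close>.\<close>

lemma (in prob_space) expectation_cos_eq_char:
  assumes [measurable]: "L \<in> borel_measurable M"
  shows "expectation (\<lambda>\<omega>. cos (L \<omega> + s)) = Re (iexp s * char (distr M borel L) 1)"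
proof -
  have i: "integrable M (\<lambda>\<omega>. iexp (L \<omega>))" by (intro integrable_iexp) auto
  have "iexp s * char (distr M borel L) 1 = (CLINT \<omega>|M. iexp s * iexp (L \<omega>))"
    unfolding char_def by (subst integral_distr) auto
  also have "Re \<dots> = expectation (\<lambda>\<omega>. Re (iexp s * iexp (L \<omega>)))"
    using i by (subst integral_Re) auto
  also have "(\<lambda>\<omega>. Re (iexp s * iexp (L \<omega>))) = (\<lambda>\<omega>. cos (L \<omega> + s))"
  proof
    fix \<omega>
    have "iexp s * iexp (L \<omega>) = iexp (L \<omega> + s)" by (simp add: exp_add[symmetric] algebra_simps)
    then show "Re (iexp s * iexp (L \<omega>)) = cos (L \<omega> + s)" by (simp only:) (simp add: Re_exp)
  qed
  finally show ?thesis by simp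
qed

lemma inner_second_moment_matrix:
  fixes Z :: "'w \<Rightarrow> real^'m"
  assumes "\<And>i j. integrable M (\<lambda>\<omega>. Z \<omega> $ i * Z \<omega> $ j)"
  shows "x \<bullet> (second_moment_matrix M Z *v y) = (\<integral>\<omega>. (x \<bullet> Z \<omega>) * (y \<bullet> Z \<omega>) \<partial>M)"
proof -
  have "(\<integral>\<omega>. (x \<bullet> Z \<omega>) * (y \<bullet> Z \<omega>) \<partial>M) = (\<integral>\<omega>. (\<Sum>i\<in>UNIV. \<Sum>j\<in>UNIV. (x $ i * y $ j) * (Z \<omega> $ i * Z \<omega> $ j)) \<partial>M)"
    by (simp add: inner_vec_def sum_product mult_ac)
  also have "\<dots> = (\<Sum>i\<in>UNIV. \<Sum>j\<in>UNIV. (x $ i * y $ j) * (\<integral>\<omega>. Z \<omega> $ i * Z \<omega> $ j \<partial>M))"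
    using assms by (subst Bochner_Integration.integral_sum; simp)
  finally show ?thesis
    by (simp add: inner_vec_def second_moment_matrix_def matrix_vector_mult_def sum_distrib_left mult_ac)
qed

abbreviation linear_form :: "nat \<Rightarrow> (nat \<times> 'm::finite \<Rightarrow> real) \<Rightarrow> (nat \<times> 'm \<Rightarrow> real) \<Rightarrow> real" where
  "linear_form k t x \<equiv> \<Sum>p\<in>{..<k} \<times> UNIV. t p * x p"

lemma linear_form_cartesian:
  fixes t :: "nat \<times> 'm::finite \<Rightarrow> real" and x :: "nat \<Rightarrow> real^'m"
  shows "(\<Sum>p\<in>{..<k} \<times> UNIV. t p * (case p of (l, c) \<Rightarrow> if l < k then x l $ c else 0))
    = (\<Sum>l<k. (\<chi> c. t (l, c)) \<bullet> x l)"
proof -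
  have "(\<Sum>p\<in>{..<k} \<times> UNIV. t p * (case p of (l, c) \<Rightarrow> if l < k then x l $ c else 0))
    = (\<Sum>p\<in>{..<k} \<times> UNIV. case p of (l, c) \<Rightarrow> t (l, c) * x l $ c)"
    by (intro sum.cong refl) auto
  then show ?thesis by (simp add: sum.cartesian_product inner_vec_def)
qed

locale centred_vector_walk = prob_space M for M :: "'w measure" +
  fixes Z :: "nat \<Rightarrow> 'w \<Rightarrow> real^'m"
  assumes indep: "indep_vars (\<lambda>_. borel) Z UNIV"
    and ident: "\<And>i. distr M borel (Z i) = distr M borel (Z 0)"
    and square_integrable: "integrable M (\<lambda>\<omega>. (norm (Z 0 \<omega>))\<^sup>2)"
    and mean_zero: "expectation (Z 0) = 0"
begin

abbreviation covariance :: "real^'m^'m" where "covariance \<equiv> second_moment_matrix M (Z 0)"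

lemma measurable_Z[measurable]: "Z i \<in> borel_measurable M"
  using indep unfolding indep_vars_def2 by simp

lemma measurable_Z_component[measurable]: "(\<lambda>\<omega>. Z i \<omega> $ c) \<in> borel_measurable M"
  by (rule measurable_compose[OF measurable_Z])
     (intro borel_measurable_continuous_onI continuous_intros)

lemma integrable_Z0: "integrable M (Z 0)"
proof -
  have "integrable M (\<lambda>\<omega>. norm (Z 0 \<omega>))"
    by (rule square_integrable_imp_integrable[OF _ square_integrable]) simp
  then show ?thesis by (simp add: integrable_norm_iff)
qed

lemma integrable_coordinate_product: "integrable M (\<lambda>\<omega>. Z 0 \<omega> $ i * Z 0 \<omega> $ j)"
proof (rule Bochner_Integration.integrable_bound[OF square_integrable])
  have "\<bar>Z 0 \<omega> $ i\<bar> * \<bar>Z 0 \<omega> $ j\<bar> \<le> norm (Z 0 \<omega>) * norm (Z 0 \<omega>)" for \<omega>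
    by (intro mult_mono component_le_norm_cart) auto
  then show "AE \<omega> in M. norm (Z 0 \<omega> $ i * Z 0 \<omega> $ j) \<le> norm ((norm (Z 0 \<omega>))\<^sup>2)"
    by (simp add: abs_mult power2_eq_square)
qed measurable

lemma projection_iid: "iid_centred M (\<lambda>i \<omega>. v \<bullet> Z i \<omega>)"
proof
  show "indep_vars (\<lambda>_. borel) (\<lambda>i \<omega>. v \<bullet> Z i \<omega>) UNIV"
    by (rule indep_vars_compose2[OF indep]) simp
  have "distr M borel (\<lambda>\<omega>. v \<bullet> Z i \<omega>) = distr (distr M borel (Z i)) borel (\<lambda>z. v \<bullet> z)" for i
    by (subst distr_distr) (auto simp: comp_def)
  then show "distr M borel (\<lambda>\<omega>. v \<bullet> Z i \<omega>) = distr M borel (\<lambda>\<omega>. v \<bullet> Z 0 \<omega>)" for i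
    by (simp only: ident[of i])
  show "integrable M (\<lambda>\<omega>. (v \<bullet> Z 0 \<omega>)\<^sup>2)"
  proof (rule Bochner_Integration.integrable_bound)
    show "integrable M (\<lambda>\<omega>. (norm v)\<^sup>2 * (norm (Z 0 \<omega>))\<^sup>2)" using square_integrable by simp
    have "(v \<bullet> z)\<^sup>2 \<le> (norm v * norm z)\<^sup>2" for z
      using Cauchy_Schwarz_ineq2[of v z] by (metis abs_ge_zero power2_abs power_mono)
    then show "AE \<omega> in M. norm ((v \<bullet> Z 0 \<omega>)\<^sup>2) \<le> norm ((norm v)\<^sup>2 * (norm (Z 0 \<omega>))\<^sup>2)"
      by (simp add: power_mult_distrib)
  qed measurable
  show "expectation (\<lambda>\<omega>. v \<bullet> Z 0 \<omega>) = 0" using integrable_Z0 mean_zero by simp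
qed

lemma second_moment_projection:
  "iid_centred.second_moment M (\<lambda>i \<omega>. v \<bullet> Z i \<omega>) = v \<bullet> (covariance *v v)"
  unfolding iid_centred.second_moment_def[OF projection_iid]
  by (simp add: inner_second_moment_matrix[OF integrable_coordinate_product] power2_eq_square)

lemma covariance_factorization:
  obtains A :: "real^'m^'m" where "A ** transpose A = covariance"
proof (rule psd_factorization[of covariance])
  show "x \<bullet> (covariance *v y) = y \<bullet> (covariance *v x)" for x y
    by (simp add: inner_second_moment_matrix[OF integrable_coordinate_product] mult.commute)
  show "0 \<le> x \<bullet> (covariance *v x)" for x
    by (simp add: inner_second_moment_matrix[OF integrable_coordinate_product] integral_nonneg_AE)
qed

text \<open>The number of blocks is a variable and cannot be a type, so the increments are flattened
  into a function on pairs, zero outside \<open>l < k\<close> as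
  \<open>Cramer_Wold_expectation\<close> demands.\<close>

definition block_coords :: "nat \<Rightarrow> nat \<Rightarrow> 'w \<Rightarrow> nat \<times> 'm \<Rightarrow> real" where
  "block_coords k n \<omega> = (\<lambda>(l, c). if l < k then (\<Sum>i\<in>block n k l. Z i \<omega> $ c) / sqrt n else 0)"

lemma measurable_block_coords: "block_coords k n \<in> borel_measurable M"
proof (rule measurable_coordinatewise_then_product)
  fix p :: "nat \<times> 'm"
  show "(\<lambda>\<omega>. block_coords k n \<omega> p) \<in> borel_measurable M"
    by (cases p) (simp add: block_coords_def)
qed

lemma char_block_linear_form:
  fixes t :: "nat \<times> 'm \<Rightarrow> real"
  assumes k: "k > 0"
  defines "v \<equiv> \<lambda>l. (\<chi> c. t (l, c)) :: real^'m"
  shows "char (distr M borel (\<lambda>\<omega>. linear_form k t (block_coords k n \<omega>))) 1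
    = (\<Prod>l<k. char (distr M borel (\<lambda>\<omega>. v l \<bullet> Z 0 \<omega>)) (1 / sqrt n) ^ card (block n k l))"
proof -
  \<comment> \<open>The coefficient vector of step \<open>i\<close>, constant on each block. It
    turns the linear form into a sum over single independent steps.\<close>
  define T where "T i = (\<Sum>l<k. if i \<in> block n k l then v l else 0)" for i
  have T: "T i = v l" if "i \<in> block n k l" "l < k" for i l
  proof -
    have "T i = (\<Sum>l'<k. if l' = l then v l else 0)"
      unfolding T_def using that disjoint_block[of _ l n k] by (intro sum.cong refl) auto
    then show ?thesis using that by simp
  qed
  have un: "(\<Union>l<k. block n k l) = {0..<n}" using UN_block[of n k k] k by simp
  let ?W = "\<lambda>i \<omega>. T i \<bullet> Z i \<omega> / sqrt n"
  have eq: "linear_form k t (block_coords k n \<omega>) = (\<Sum>i\<in>{0..<n}. ?W i \<omega>)" for \<omega>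
  proof -
    have "block_coords k n \<omega> = (\<lambda>(l, c). if l < k then (\<Sum>i\<in>block n k l. Z i \<omega> /\<^sub>R sqrt n) $ c else 0)"
      by (auto simp: block_coords_def sum_distrib_left divide_inverse mult.commute fun_eq_iff)
    then have "linear_form k t (block_coords k n \<omega>) = (\<Sum>l<k. v l \<bullet> (\<Sum>i\<in>block n k l. Z i \<omega> /\<^sub>R sqrt n))"
      using linear_form_cartesian[of t k "\<lambda>l. \<Sum>i\<in>block n k l. Z i \<omega> /\<^sub>R sqrt n"] by (simp add: v_def)
    also have "\<dots> = (\<Sum>l<k. \<Sum>i\<in>block n k l. ?W i \<omega>)"
      by (intro sum.cong refl) (simp add: inner_sum_right T divide_inverse mult.commute)
    also have "\<dots> = (\<Sum>i\<in>(\<Union>l<k. block n k l). ?W i \<omega>)"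
      by (rule sum.UNION_disjoint[symmetric]) (auto simp: finite_block disjoint_block)
    finally show ?thesis unfolding un .
  qed
  have "char (distr M borel (\<lambda>\<omega>. \<Sum>i\<in>{0..<n}. ?W i \<omega>)) 1 = (\<Prod>i\<in>{0..<n}. char (distr M borel (?W i)) 1)"
    by (rule char_distr_sum, rule indep_vars_compose2[OF indep_vars_subset[OF indep]]) auto
  also have "\<dots> = (\<Prod>i\<in>(\<Union>l<k. block n k l). char (distr M borel (\<lambda>\<omega>. T i \<bullet> Z 0 \<omega>)) (1 / sqrt n))"
    unfolding un
  proof (rule prod.cong[OF refl])
    fix i
    have "distr M borel (\<lambda>\<omega>. T i \<bullet> Z i \<omega>) = distr M borel (\<lambda>\<omega>. T i \<bullet> Z 0 \<omega>)"
      using iid_centred.ident[OF projection_iid] .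
    then show "char (distr M borel (?W i)) 1 = char (distr M borel (\<lambda>\<omega>. T i \<bullet> Z 0 \<omega>)) (1 / sqrt n)"
      by (subst char_divide) auto
  qed
  also have "\<dots> = (\<Prod>l<k. \<Prod>i\<in>block n k l. char (distr M borel (\<lambda>\<omega>. T i \<bullet> Z 0 \<omega>)) (1 / sqrt n))"
    by (rule prod.UNION_disjoint) (auto simp: finite_block disjoint_block)
  also have "\<dots> = (\<Prod>l<k. char (distr M borel (\<lambda>\<omega>. v l \<bullet> Z 0 \<omega>)) (1 / sqrt n) ^ card (block n k l))"
    by (intro prod.cong refl) (simp add: T)
  finally show ?thesis unfolding eq .
qed

lemma char_block_tendsto:
  fixes t :: "nat \<times> 'm \<Rightarrow> real"
  assumes k: "k > 0"
  shows "(\<lambda>n. char (distr M borel (\<lambda>\<omega>. linear_form k t (block_coords k n \<omega>))) 1)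
    \<longlonglongrightarrow> (\<Prod>l<k. complex_of_real (exp (- ((\<chi> c. t (l, c)) \<bullet> (covariance *v (\<chi> c. t (l, c))) / k / 2))))"
  unfolding char_block_linear_form[OF k]
proof (rule tendsto_prod)
  fix l
  let ?v = "\<lambda>l. \<chi> c. t (l, c)"
  assume l: "l \<in> {..<k}"
  have "(\<lambda>n. char (distr M borel (\<lambda>\<omega>. ?v l \<bullet> Z 0 \<omega>)) (1 / sqrt n) ^ card (block n k l))
     \<longlonglongrightarrow> exp (- (1\<^sup>2 * (?v l \<bullet> (covariance *v ?v l)) * (1 / k) / 2))"
    unfolding second_moment_projection[symmetric]
    using l by (intro iid_centred.char_power_tendsto[OF projection_iid] card_block_le card_block_tendsto k) auto
  then show "(\<lambda>n. char (distr M borel (\<lambda>\<omega>. ?v l \<bullet> Z 0 \<omega>)) (1 / sqrt n) ^ card (block n k l))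
     \<longlonglongrightarrow> complex_of_real (exp (- (?v l \<bullet> (covariance *v ?v l) / k / 2)))"
    by (simp add: exp_of_real[symmetric])
qed

lemma block_coords_tight:
  assumes e: "e > 0"
  shows "\<exists>R. \<forall>n. \<forall>p\<in>{..<k} \<times> UNIV. prob {\<omega>\<in>space M. \<bar>block_coords k n \<omega> p\<bar> > R} \<le> e"
proof -
  let ?s = "\<lambda>c. axis c 1 \<bullet> (covariance *v axis c 1)"
  have s0: "0 \<le> ?s c" for c
    using iid_centred.second_moment_nonneg[OF projection_iid] by (simp add: second_moment_projection)
  define s where "s = (\<Sum>c\<in>UNIV. ?s c)"
  have ss: "?s c \<le> s" for c unfolding s_def by (rule member_le_sum) (use s0 in auto)
  have s: "0 \<le> s" unfolding s_def by (intro sum_nonneg s0)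
  define R where "R = sqrt (s / e) + 1"
  have R: "R > 0" using s e by (simp add: R_def add_nonneg_pos)
  have R2: "s / R\<^sup>2 \<le> e"
  proof -
    have "s / e = (sqrt (s / e))\<^sup>2" using s e by simp
    also have "\<dots> \<le> R\<^sup>2" unfolding R_def using s e by (intro power_mono) auto
    finally show ?thesis using e R by (simp add: field_simps)
  qed
  have "prob {\<omega>\<in>space M. \<bar>block_coords k n \<omega> (l, c)\<bar> > R} \<le> e" if l: "l < k" for n l c
  proof (cases "n = 0")
    \<comment> \<open>Here \<open>sqrt n\<close> is zero and the coordinates vanish, division by
      zero being zero; the estimate below needs a positive \<open>n\<close>.\<close>
    case True
    then show ?thesis using l e R by (simp add: block_coords_def)
  next
    case False
    then have n: "real n > 0" by simp
    have ax: "axis c 1 \<bullet> z = z $ c" for z :: "real^'m" by (simp add: inner_axis')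
    have "prob {\<omega>\<in>space M. \<bar>block_coords k n \<omega> (l, c)\<bar> > R} \<le> prob {\<omega>\<in>space M. \<bar>\<Sum>i\<in>block n k l. axis c 1 \<bullet> Z i \<omega>\<bar> \<ge> R * sqrt n}"
      using l n by (intro finite_measure_mono) (auto simp: block_coords_def ax field_simps)
    also have "\<dots> \<le> card (block n k l) * ?s c / (R * sqrt n)\<^sup>2"
      using iid_centred.prob_sum_ge_le[OF projection_iid finite_block, of "R * sqrt n" "axis c 1" n k l] R n
      by (simp add: second_moment_projection)
    also have "\<dots> \<le> n * s / (R * sqrt n)\<^sup>2"
      using card_block_le[OF l] ss s0 by (intro divide_right_mono mult_mono) auto
    also have "\<dots> = s / R\<^sup>2" using n by (simp add: power_mult_distrib)
    finally show ?thesis using R2 by linarith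
  qed
  then show ?thesis by (intro exI[of _ R]) auto
qed

end

definition brownian_coords :: "real^'m^'m \<Rightarrow> (real \<Rightarrow> 'v \<Rightarrow> real^'m) \<Rightarrow> nat \<Rightarrow> 'v \<Rightarrow> nat \<times> 'm \<Rightarrow> real" where
  "brownian_coords A b k \<omega> = (\<lambda>(l, c). if l < k then (A *v (b (Suc l / k) \<omega> - b (l / k) \<omega>)) $ c else 0)"

lemma measurable_matrix_vector_mult [measurable]:
  fixes A :: "real^'p^'q"
  shows "(\<lambda>x. A *v x) \<in> borel_measurable borel"
  by (intro borel_measurable_continuous_onI linear_continuous_on) (simp add: linear_conv_bounded_linear[symmetric])

lemma measurable_vec_component: "(\<lambda>x::real^'p. x $ c) \<in> borel_measurable borel"
  by (intro borel_measurable_continuous_onI continuous_intros)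

lemma measurable_brownian_coords:
  fixes A :: "real^'m^'m"
  assumes "standard_brownian_motion N b"
  shows "brownian_coords A b k \<in> borel_measurable N"
proof (rule measurable_coordinatewise_then_product)
  fix p :: "nat \<times> 'm"
  have b: "b t \<in> borel_measurable N" if "t \<ge> 0" for t
    using assms that by (auto simp: standard_brownian_motion_def)
  obtain l c where p: "p = (l, c)" by (cases p)
  have "(\<lambda>\<omega>. A *v (b (Suc l / k) \<omega> - b (l / k) \<omega>)) \<in> borel_measurable N"
    by (rule measurable_compose[OF _ measurable_matrix_vector_mult]) (intro borel_measurable_diff b; simp)
  then show "(\<lambda>\<omega>. brownian_coords A b k \<omega> p) \<in> borel_measurable N"
    using measurable_compose[OF _ measurable_vec_component, of _ N c]
    by (cases "l < k") (simp_all add: brownian_coords_def p)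
qed

text \<open>The increments over the grid of mesh \<open>1 / k\<close> are independent Gaussian
  vectors, and \<open>A\<close> acts on the form through its transpose. With
  \<open>A ** transpose A\<close> equal to the covariance this is the limit in
  \<open>char_block_tendsto\<close>.\<close>

lemma char_brownian_linear_form:
  fixes t :: "nat \<times> 'm::finite \<Rightarrow> real"
  assumes bm: "standard_brownian_motion N b" and k: "k > 0"
  defines "v \<equiv> \<lambda>l. (\<chi> c. t (l, c)) :: real^'m"
  shows "char (distr N borel (\<lambda>\<omega>. linear_form k t (brownian_coords A b k \<omega>))) 1
    = (\<Prod>l<k. complex_of_real (exp (- (v l \<bullet> ((A ** transpose A) *v v l) / k / 2))))"
proof -
  interpret prob_space N using bm by (simp add: standard_brownian_motion_def)
  let ?D = "\<lambda>l \<omega>. b (Suc l / k) \<omega> - b (l / k) \<omega>"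
  have ind: "indep_vars (\<lambda>_. borel) ?D {..<k}"
  proof -
    have "\<forall>(n::nat) t. 0 \<le> t 0 \<and> (\<forall>k<n. t k < t (Suc k)) \<longrightarrow>
        indep_vars (\<lambda>_. borel) (\<lambda>k \<omega>. b (t (Suc k)) \<omega> - b (t k) \<omega>) {..<n}"
      using bm unfolding standard_brownian_motion_def by (elim conjE) assumption
    from this[THEN spec, THEN spec, THEN mp, of "\<lambda>l. real l / real k" k]
    show ?thesis using k by (simp add: divide_strict_right_mono)
  qed
  have dist: "distributed N lborel (?D l) (\<lambda>x. ennreal (\<Prod>i\<in>UNIV. normal_density 0 (sqrt (1 / k)) (x $ i)))" for l
  proof -
    have d: "Suc l / real k - l / k = 1 / k" using k by (simp add: field_simps)
    have le: "0 \<le> l / real k \<and> l / real k < Suc l / k" using k by (simp add: divide_strict_right_mono)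
    have "\<forall>s t. 0 \<le> s \<and> s < t \<longrightarrow> distributed N lborel (\<lambda>\<omega>. b t \<omega> - b s \<omega>)
        (\<lambda>x. ennreal (\<Prod>i\<in>UNIV. normal_density 0 (sqrt (t - s)) (x $ i)))"
      using bm unfolding standard_brownian_motion_def by (elim conjE) assumption
    from this[THEN spec, THEN spec, THEN mp, OF le] show ?thesis unfolding d .
  qed
  have eq: "linear_form k t (brownian_coords A b k \<omega>) = (\<Sum>l<k. v l \<bullet> (A *v ?D l \<omega>))" for \<omega>
    using linear_form_cartesian[of t k "\<lambda>l. A *v ?D l \<omega>"] by (simp only: brownian_coords_def v_def)
  have "char (distr N borel (\<lambda>\<omega>. \<Sum>l<k. v l \<bullet> (A *v ?D l \<omega>))) 1 = (\<Prod>l<k. char (distr N borel (\<lambda>\<omega>. v l \<bullet> (A *v ?D l \<omega>))) 1)"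
    by (rule char_distr_sum, rule indep_vars_compose2[OF ind]) simp
  also have "\<dots> = (\<Prod>l<k. complex_of_real (exp (- (v l \<bullet> ((A ** transpose A) *v v l) / k / 2))))"
  proof (rule prod.cong[OF refl])
    fix l
    let ?w = "v l v* A"
    have "char (distr N borel (\<lambda>\<omega>. v l \<bullet> (A *v ?D l \<omega>))) 1 = char (distr N borel (\<lambda>\<omega>. ?w \<bullet> ?D l \<omega>)) 1"
      by (simp add: dot_lmul_matrix)
    also have "\<dots> = complex_of_real (exp (- ((sqrt (1 / k) * 1)\<^sup>2 * (?w \<bullet> ?w) / 2)))"
      using k by (intro char_gaussian_vector dist) simp
    also have "?w \<bullet> ?w = v l \<bullet> ((A ** transpose A) *v v l)"
      by (simp add: dot_lmul_matrix matrix_vector_mul_assoc[symmetric])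
    finally show "char (distr N borel (\<lambda>\<omega>. v l \<bullet> (A *v ?D l \<omega>))) 1 = complex_of_real (exp (- (v l \<bullet> ((A ** transpose A) *v v l) / k / 2)))"
      by simp
  qed
  finally show ?thesis unfolding eq .
qed

theorem (in centred_vector_walk) block_coords_convergence:
  fixes F :: "(nat \<times> 'm \<Rightarrow> real) \<Rightarrow> real"
  assumes bm: "standard_brownian_motion N b" and k: "k > 0" and A: "A ** transpose A = covariance"
    and F: "continuous_on UNIV F" "\<And>x. \<bar>F x\<bar> \<le> B"
  shows "(\<lambda>n. expectation (\<lambda>\<omega>. F (block_coords k n \<omega>))) \<longlonglongrightarrow> (\<integral>\<omega>. F (brownian_coords A b k \<omega>) \<partial>N)"
proof (rule Cramer_Wold_expectation[where I = "{..<k} \<times> UNIV" and F = F and B = B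
      and X = "block_coords k" and Y = "brownian_coords A b k"])
  interpret N: prob_space N using bm by (simp add: standard_brownian_motion_def)
  show "prob_space N" by (rule N.prob_space_axioms)
  show "prob_space M" by (rule prob_space_axioms)
  note mX = measurable_block_coords and mY = measurable_brownian_coords[OF bm]
  have lX: "(\<lambda>\<omega>. linear_form k t (block_coords k n \<omega>)) \<in> borel_measurable M" for t n
    by (intro borel_measurable_sum borel_measurable_times borel_measurable_const measurable_product_then_coordinatewise[OF mX])
  have lY: "(\<lambda>\<omega>. linear_form k t (brownian_coords A b k \<omega>)) \<in> borel_measurable N" for t
    by (intro borel_measurable_sum borel_measurable_times borel_measurable_const measurable_product_then_coordinatewise[OF mY])
  show "(\<lambda>n. expectation (\<lambda>\<omega>. cos (linear_form k t (block_coords k n \<omega>) + s)))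
      \<longlonglongrightarrow> (\<integral>\<omega>. cos (linear_form k t (brownian_coords A b k \<omega>) + s) \<partial>N)" for t s
    unfolding expectation_cos_eq_char[OF lX] N.expectation_cos_eq_char[OF lY] char_brownian_linear_form[OF bm k] A
    by (intro tendsto_Re tendsto_mult tendsto_const char_block_tendsto k)
  show "\<exists>R. \<forall>n. \<forall>p\<in>{..<k} \<times> UNIV. prob {\<omega>\<in>space M. \<bar>block_coords k n \<omega> p\<bar> > R} \<le> e" if "e > 0" for e
    using block_coords_tight[OF that] .
qed (use F measurable_block_coords measurable_brownian_coords[OF bm] in \<open>auto simp: block_coords_def brownian_coords_def split: if_splits\<close>)

section \<open>Discretization of the walk\<close>

text \<open>The times \<open>j / k\<close> are deterministic and only the increments are arguments.
  The discretized walk and the discretized Brownian path are thus values of the same continuous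
  function.\<close>

definition coords_hull :: "nat \<Rightarrow> (nat \<times> 'm::finite \<Rightarrow> real) \<Rightarrow> real" where
  "coords_hull k x = hull_volume ((\<lambda>j. (real j / real k, \<chi> c. \<Sum>l<j. x (l, c))) ` {0..k})"

lemma continuous_coords_hull: "continuous_on UNIV (coords_hull k :: (nat \<times> 'm::finite \<Rightarrow> real) \<Rightarrow> real)"
  unfolding coords_hull_def
  by (rule continuous_measure_hull_finite)
     (auto intro!: continuous_intros continuous_on_product_coordinates)

lemma increment_sum_blocks:
  fixes z :: "nat \<Rightarrow> real"
  shows "(\<Sum>l<j. \<Sum>i\<in>block n k l. z i) = (\<Sum>i<j * n div k. z i)"
  using sum.UNION_disjoint[of "{..<j}" "block n k" z] unfolding UN_block
  by (simp add: finite_block disjoint_block atLeast0LessThan)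

text \<open>\<open>Z\<close> holds the coordinates across the drift, \<open>Y\<close> the centred
  increments along it relative to their mean. Their joint law is left open, because the sums of
  \<open>Y\<close> disappear after division by \<open>n\<close>.\<close>

locale space_time_walk = centred_vector_walk M Z + drift: iid_centred M Y
  for M :: "'w measure" and Z :: "nat \<Rightarrow> 'w \<Rightarrow> real^'m" and Y :: "nat \<Rightarrow> 'w \<Rightarrow> real"
begin

definition scaled_path :: "nat \<Rightarrow> 'w \<Rightarrow> nat \<Rightarrow> real \<times> (real^'m)" where
  "scaled_path n \<omega> i = ((real i + (\<Sum>q<i. Y q \<omega>)) / real n, (\<Sum>q<i. Z q \<omega>) /\<^sub>R sqrt (real n))"

definition path_hull :: "nat \<Rightarrow> 'w \<Rightarrow> real" where
  "path_hull n \<omega> = hull_volume (scaled_path n \<omega> ` {0..n})"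

lemma measurable_scaled_path[measurable]: "(\<lambda>\<omega>. scaled_path n \<omega> i) \<in> borel_measurable M"
  unfolding scaled_path_def by measurable

lemma measurable_path_hull[measurable]: "path_hull n \<in> borel_measurable M"
proof -
  let ?V = "\<lambda>x::nat \<Rightarrow> real \<times> (real^'m). hull_volume ((\<lambda>i. x i) ` {0..n})"
  have "?V \<in> borel_measurable borel"
    by (intro borel_measurable_continuous_onI continuous_measure_hull_finite continuous_on_product_coordinates) auto
  moreover have "scaled_path n \<in> borel_measurable M"
    by (rule measurable_coordinatewise_then_product) measurable
  ultimately show ?thesis
    unfolding path_hull_def using measurable_compose by fastforce
qed

lemma block_point:
  assumes "k > 0" "j \<le> k"
  shows "(\<chi> c. \<Sum>l<j. block_coords k n \<omega> (l, c)) = (\<Sum>q<j * n div k. Z q \<omega>) /\<^sub>R sqrt n"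
proof -
  have "(\<Sum>l<j. block_coords k n \<omega> (l, c)) = (\<Sum>q<j * n div k. Z q \<omega> $ c) / sqrt n" for c
  proof -
    have "(\<Sum>l<j. block_coords k n \<omega> (l, c)) = (\<Sum>l<j. \<Sum>i\<in>block n k l. Z i \<omega> $ c) / sqrt n"
      using assms by (simp add: block_coords_def sum_divide_distrib)
    then show ?thesis unfolding increment_sum_blocks .
  qed
  then show ?thesis by (simp add: vec_eq_iff divide_inverse mult.commute)
qed

section \<open>Error of the discretization\<close>

text \<open>A statement about a single path; \<open>drift\<close>, \<open>osc\<close> and
  \<open>bound\<close> are shown later to hold with high probability. Of the displacement
  \<open>(2 + m) * \<epsilon>\<close>, one \<open>\<epsilon>\<close> is for the drift, one for
  rounding the time, and \<open>m * \<epsilon>\<close> for the oscillation in a block, its norm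
  being estimated by the sum over coordinates.\<close>

lemma path_hull_close:
  fixes k n :: nat and \<epsilon> R :: real
  defines "a \<equiv> \<lambda>l. l * n div k" and "m \<equiv> real CARD('m)"
  assumes k: "k > 0" "1 / k \<le> \<epsilon>" and n: "n > 0" "1 / n \<le> \<epsilon>" and \<epsilon>: "(2 + m) * \<epsilon> \<le> 1 / 2" and R: "R \<ge> 0"
    and drift: "\<And>i. i \<le> n \<Longrightarrow> \<bar>\<Sum>q<i. Y q \<omega>\<bar> \<le> \<epsilon> * n"
    and osc: "\<And>l i c. l < k \<Longrightarrow> a l \<le> i \<Longrightarrow> i \<le> a (Suc l) \<Longrightarrow> \<bar>\<Sum>q=a l..<i. Z q \<omega> $ c\<bar> \<le> \<epsilon> * sqrt n"
    and bound: "\<And>i c. i \<le> n \<Longrightarrow> \<bar>\<Sum>q<i. Z q \<omega> $ c\<bar> \<le> R * sqrt n"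
  shows "\<bar>path_hull n \<omega> - coords_hull k (block_coords k n \<omega>)\<bar>
      \<le> hull_lipschitz TYPE(real \<times> (real^'m)) (2 + m * R) * ((2 + m) * \<epsilon>)"
proof -
  have m: "m \<ge> 0" by (simp add: m_def)
  have sn: "sqrt n > 0" using n by simp
  have \<epsilon>0: "\<epsilon> > 0" using k by (meson divide_pos_pos less_le_trans of_nat_0_less_iff zero_less_one)
  have \<epsilon>1: "\<epsilon> \<le> 1"
  proof -
    have "2 * \<epsilon> \<le> (2 + m) * \<epsilon>" using \<epsilon>0 m by (intro mult_right_mono) auto
    then show ?thesis using \<epsilon> by linarith
  qed
  have norm_Z: "norm ((\<Sum>q\<in>J. Z q \<omega>) /\<^sub>R sqrt n) \<le> m * r" if "\<And>c. \<bar>\<Sum>q\<in>J. Z q \<omega> $ c\<bar> \<le> r * sqrt n" for J r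
  proof -
    have "norm ((\<Sum>q\<in>J. Z q \<omega>) /\<^sub>R sqrt n) \<le> (\<Sum>c\<in>UNIV. \<bar>((\<Sum>q\<in>J. Z q \<omega>) /\<^sub>R sqrt n) $ c\<bar>)" by (rule norm_le_l1_cart)
    also have "\<dots> \<le> (\<Sum>c\<in>(UNIV::'m set). r)"
    proof (intro sum_mono)
      fix c
      have "\<bar>((\<Sum>q\<in>J. Z q \<omega>) /\<^sub>R sqrt n) $ c\<bar> = \<bar>\<Sum>q\<in>J. Z q \<omega> $ c\<bar> / sqrt n"
        using sn by (simp add: abs_mult divide_inverse mult.commute)
      also have "\<dots> \<le> r" using that[of c] sn by (simp add: pos_divide_le_eq)
      finally show "\<bar>((\<Sum>q\<in>J. Z q \<omega>) /\<^sub>R sqrt n) $ c\<bar> \<le> r" .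
    qed
    finally show ?thesis by (simp add: m_def)
  qed
  let ?P = "scaled_path n \<omega>" and ?Q = "\<lambda>j. (real j / real k, \<chi> c. \<Sum>l<j. block_coords k n \<omega> (l, c))"
  have Q: "?Q j = (real j / real k, (\<Sum>q<a j. Z q \<omega>) /\<^sub>R sqrt n)" if "j \<le> k" for j
    using block_point[OF k(1) that] by (simp add: a_def)
  have an: "a j \<le> n" if "j \<le> k" for j
  proof -
    have "j * n div k \<le> k * n div k" using that by (intro div_le_mono mult_le_mono1)
    then show ?thesis using k by (simp add: a_def)
  qed
  have drift': "\<bar>(real i + (\<Sum>q<i. Y q \<omega>)) / n - i / n\<bar> \<le> \<epsilon>" if "i \<le> n" for i
    using drift[OF that] n by (simp add: add_divide_distrib pos_divide_le_eq)
  have dist_le: "dist p q \<le> \<bar>fst p - fst q\<bar> + norm (snd p - snd q)" for p q :: "real \<times> (real^'m)"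
    using norm_Pair_le[of "fst p - fst q" "snd p - snd q"] by (simp add: dist_norm minus_prod_def)
  have 1: "\<exists>p\<in>?P ` {0..n}. dist p q \<le> (2 + m) * \<epsilon>" if qQ: "q \<in> ?Q ` {0..k}" for q
  proof -
    obtain j where "q = ?Q j" "j \<in> {0..k}" using qQ by (rule imageE)
    then have j: "j \<le> k" "q = ?Q j" by simp_all
    have "dist (?P (a j)) q \<le> \<bar>(real (a j) + (\<Sum>q<a j. Y q \<omega>)) / n - j / k\<bar>"
      using dist_le[of "?P (a j)" q] unfolding j(2) Q[OF j(1)] scaled_path_def by simp
    also have "\<dots> \<le> \<epsilon> + \<bar>a j / n - j / k\<bar>" using drift'[OF an[OF j(1)]] by linarith
    also have "\<bar>a j / n - j / k\<bar> \<le> 1 / n"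
    proof -
      have "\<bar>real (a j) - j * n / k\<bar> \<le> 1" using nat_div_bounds[OF k(1), of "j * n"] by (simp add: a_def)
      moreover have "a j / n - j / k = (real (a j) - j * n / k) / n" using n k by (simp add: field_simps)
      ultimately show ?thesis using n by (simp add: abs_divide divide_right_mono)
    qed
    also have "\<epsilon> + 1 / n \<le> 2 * \<epsilon>" using n by simp
    also have "\<dots> \<le> (2 + m) * \<epsilon>" using m \<epsilon>0 by (intro mult_right_mono) auto
    finally show ?thesis using an[OF j(1)] by auto
  qed
  have 2: "\<exists>q\<in>?Q ` {0..k}. dist p q \<le> (2 + m) * \<epsilon>" if pP: "p \<in> ?P ` {0..n}" for p
  proof -
    obtain i where "p = ?P i" "i \<in> {0..n}" using pP by (rule imageE)
    then have i: "i \<le> n" "p = ?P i" by simp_all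
    \<comment> \<open>From \<open>l \<le> i * k / n < l + 1\<close> the step \<open>i\<close> lies
      between the end points \<open>a l\<close> and \<open>a (Suc l)\<close>, and
      \<open>l / k\<close> is within \<open>1 / k\<close> of \<open>i / n\<close>.\<close>
    define l where "l = i * k div n"
    have lk: "l \<le> k"
    proof -
      have "i * k div n \<le> n * k div n" using i by (intro div_le_mono mult_le_mono1)
      then show ?thesis using n by (simp add: l_def)
    qed
    have lt: "real l \<le> real i * k / n" "real i * k / n < real l + 1"
      using nat_div_bounds[OF n(1), of "i * k"] by (simp_all add: l_def)
    have tl: "\<bar>i / n - l / k\<bar> \<le> 1 / k"
    proof -
      have "\<bar>real i * k / n - l\<bar> \<le> 1" using lt by linarith
      moreover have "i / n - l / k = (real i * k / n - l) / k" using n k by (simp add: field_simps)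
      ultimately show ?thesis using k by (simp add: abs_divide divide_right_mono)
    qed
    have ali: "a l \<le> i"
    proof -
      have "l * n \<le> i * k" using lt(1) n by (simp add: field_simps flip: of_nat_mult)
      then have "l * n div k \<le> i * k div k" by (rule div_le_mono)
      then show ?thesis using k by (simp add: a_def)
    qed
    have osc': "\<bar>\<Sum>q=a l..<i. Z q \<omega> $ c\<bar> \<le> \<epsilon> * sqrt n" for c
    proof (cases "l < k")
      case True
      have "real (i * k) < real (Suc l * n)" using lt(2) n by (simp add: field_simps)
      then have "i * k \<le> Suc l * n" by linarith
      then have "i * k div k \<le> Suc l * n div k" by (rule div_le_mono)
      then have "i \<le> a (Suc l)" using k by (simp add: a_def)
      then show ?thesis using osc True ali by blast
    next
      \<comment> \<open>This is \<open>l = k\<close>, with no block to the right of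
        \<open>a l\<close>; then \<open>a l = n\<close> and the sum is empty.\<close>
      case False
      then have "a l = n" using lk k by (simp add: a_def)
      then show ?thesis using i \<epsilon>0 by simp
    qed
    have diff: "(\<Sum>q<i. Z q \<omega>) /\<^sub>R sqrt n - (\<Sum>q<a l. Z q \<omega>) /\<^sub>R sqrt n = (\<Sum>q=a l..<i. Z q \<omega>) /\<^sub>R sqrt n"
      using sum_diff_nat_ivl[of 0 "a l" i "\<lambda>q. Z q \<omega>"] ali
      by (simp add: atLeast0LessThan flip: scaleR_diff_right)
    have "dist p (?Q l) \<le> \<bar>(real i + (\<Sum>q<i. Y q \<omega>)) / n - l / k\<bar> + norm ((\<Sum>q=a l..<i. Z q \<omega>) /\<^sub>R sqrt n)"
      using dist_le[of p "?Q l"] unfolding i(2) Q[OF lk] scaled_path_def fst_conv snd_conv diff .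
    also have "\<dots> \<le> (\<epsilon> + 1 / k) + m * \<epsilon>"
      using drift'[OF i(1)] tl norm_Z[of "{a l..<i}" \<epsilon>] osc' by (intro add_mono) auto
    also have "\<dots> \<le> (2 + m) * \<epsilon>" using k by (simp add: algebra_simps)
    finally show ?thesis using lk by auto
  qed
  have norm_le: "norm p \<le> \<bar>fst p\<bar> + norm (snd p)" for p :: "real \<times> (real^'m)"
    using norm_Pair_le[of "fst p" "snd p"] by simp
  have PR: "?P ` {0..n} \<subseteq> cball 0 (2 + m * R)"
  proof (rule image_subsetI)
    fix i assume "i \<in> {0..n}"
    then have i: "i \<le> n" by simp
    have "\<bar>(real i + (\<Sum>q<i. Y q \<omega>)) / n\<bar> \<le> \<bar>i / n\<bar> + \<epsilon>" using drift'[OF i] by linarith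
    also have "\<bar>i / n\<bar> \<le> 1" using i n by simp
    also have "1 + \<epsilon> \<le> 2" using \<epsilon>1 by simp
    finally have "norm (?P i) \<le> 2 + m * R"
      using norm_le[of "?P i"] norm_Z[of "{..<i}" R] bound[OF i] unfolding scaled_path_def by fastforce
    then show "?P i \<in> cball 0 (2 + m * R)" by simp
  qed
  have QR: "?Q ` {0..k} \<subseteq> cball 0 (2 + m * R)"
  proof (rule image_subsetI)
    fix j assume "j \<in> {0..k}"
    then have j: "j \<le> k" by simp
    have "norm (?Q j) \<le> \<bar>j / k\<bar> + m * R"
      using norm_le[of "?Q j"] norm_Z[of "{..<a j}" R] bound[OF an[OF j]] unfolding Q[OF j] by fastforce
    also have "\<bar>j / k\<bar> \<le> 1" using j k by simp
    finally have "norm (?Q j) \<le> 2 + m * R" by linarith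
    then show "?Q j \<in> cball 0 (2 + m * R)" by simp
  qed
  have "0 \<le> (2 + m) * \<epsilon>" using \<epsilon>0 m by simp
  then show ?thesis
    unfolding path_hull_def coords_hull_def using 1 2 PR QR \<epsilon>
    by (intro measure_hull_close finite_imp_compact) auto
qed

lemma block_length_le: "k > 0 \<Longrightarrow> Suc l * n div k - l * n div k \<le> n div k + 1"
proof -
  assume k: "k > 0"
  have "Suc l * n div k = (l * n + n) div k" by (simp add: add.commute)
  also have "\<dots> = l * n div k + n div k + (l * n mod k + n mod k) div k" by (rule div_add1_eq)
  also have "(l * n mod k + n mod k) div k \<le> 1"
  proof -
    have "l * n mod k < k" "n mod k < k" using k by auto
    then have "l * n mod k + n mod k < 2 * k" by linarith
    then show ?thesis using k by (simp add: less_mult_imp_div_less less_Suc_eq_le[symmetric])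
  qed
  finally show ?thesis by linarith
qed

lemma projection_axis: "(\<lambda>i \<omega>. axis c 1 \<bullet> Z i \<omega>) = (\<lambda>i \<omega>. Z i \<omega> $ c)"
  by (simp add: inner_axis' fun_eq_iff)

lemma coordinate_iid: "iid_centred M (\<lambda>i \<omega>. Z i \<omega> $ c)"
  using projection_iid[of "axis c 1"] unfolding projection_axis .

lemma path_hull_discretization:
  assumes \<delta>: "\<delta> > 0"
  shows "\<exists>k0. \<forall>k\<ge>k0. \<exists>n0. \<forall>n\<ge>n0.
    prob {\<omega>\<in>space M. \<bar>path_hull n \<omega> - coords_hull k (block_coords k n \<omega>)\<bar> > \<delta>} \<le> \<delta>"
proof -
  define m where "m = real CARD('m)"
  have m: "m > 0" by (simp add: m_def)
  define s where "s c = iid_centred.second_moment M (\<lambda>i \<omega>. Z i \<omega> $ c)" for c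
  have s0: "s c \<ge> 0" for c unfolding s_def by (rule iid_centred.second_moment_nonneg[OF coordinate_iid])
  define S where "S = (\<Sum>c\<in>UNIV. s c)"
  have S0: "S \<ge> 0" unfolding S_def using s0 by (simp add: sum_nonneg)
  \<comment> \<open>The three levels in the maximal inequality are thirds, so Chebyshev's inequality
    brings a 9 and the maximal inequality doubles it to 18. The number 54 makes the total over the
    coordinates at most \<open>\<delta> / 3\<close>.\<close>
  define R where "R = sqrt (54 * S / \<delta>) + 1"
  have R: "R > 0" using S0 \<delta> by (simp add: R_def add_nonneg_pos)
  have RS: "18 * S / R\<^sup>2 \<le> \<delta> / 3"
  proof -
    have "54 * S / \<delta> = (sqrt (54 * S / \<delta>))\<^sup>2" using S0 \<delta> by simp
    also have "\<dots> \<le> R\<^sup>2" unfolding R_def using S0 \<delta> by (intro power_mono) auto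
    finally show ?thesis using \<delta> R by (simp add: field_simps)
  qed
  define C where "C = hull_lipschitz TYPE(real \<times> (real^'m)) (2 + m * R)"
  have C: "C \<ge> 0" unfolding C_def by (rule hull_lipschitz_nonneg)
  \<comment> \<open>Chosen so that the displacement \<open>(2 + m) * \<epsilon>\<close> is at most
    \<open>1 / 2\<close> and changes the volume by at most \<open>\<delta>\<close>.\<close>
  define \<epsilon> where "\<epsilon> = min (1 / 2) (\<delta> / (C + 1)) / (2 + m)"
  have \<epsilon>: "\<epsilon> > 0" unfolding \<epsilon>_def using C \<delta> m by (intro divide_pos_pos) auto
  have \<epsilon>m: "(2 + m) * \<epsilon> = min (1 / 2) (\<delta> / (C + 1))" using m by (simp add: \<epsilon>_def)
  have \<epsilon>1: "(2 + m) * \<epsilon> \<le> 1 / 2" unfolding \<epsilon>m by (rule min.cobounded1)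
  have C\<epsilon>: "C * ((2 + m) * \<epsilon>) \<le> \<delta>"
  proof -
    have "C * ((2 + m) * \<epsilon>) \<le> (C + 1) * (\<delta> / (C + 1))"
      unfolding \<epsilon>m using C \<delta> by (intro mult_mono) auto
    also have "\<dots> = \<delta>" using C by simp
    finally show ?thesis .
  qed
  \<comment> \<open>There are \<open>m * k\<close> oscillation events of probability at most
    \<open>2 * \<eta> / k\<close> each, which add up to \<open>\<delta> / 3\<close>.\<close>
  define \<eta> where "\<eta> = \<delta> / (6 * m)"
  have \<eta>: "\<eta> > 0" using \<delta> m by (simp add: \<eta>_def)
  have e3: "\<epsilon> / 3 > 0" using \<epsilon> by simp
  let ?S = "\<lambda>c k n I. finite I \<longrightarrow> card I \<le> n div k + 1 \<longrightarrow>
     real k * prob {\<omega>\<in>space M. \<bar>\<Sum>i\<in>I. Z i \<omega> $ c\<bar> \<ge> \<epsilon> / 3 * sqrt n} \<le> \<eta>"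
  have "\<forall>c. \<exists>k0. \<forall>k\<ge>k0. \<exists>n0. \<forall>n\<ge>n0. \<forall>I. ?S c k n I"
    by (rule allI) (rule iid_centred.short_sum_tail[OF coordinate_iid e3 \<eta>])
  from choice[OF this] obtain K where K0: "\<forall>c. \<forall>k\<ge>K c. \<exists>n0. \<forall>n\<ge>n0. \<forall>I. ?S c k n I"
    by (rule exE)
  note K = K0[THEN spec, THEN spec, THEN mp]
  \<comment> \<open>The sum over the finitely many coordinates stands in for their maximum; the
    middle term ensures \<open>1 / k \<le> \<epsilon>\<close>.\<close>
  define k0 where "k0 = (\<Sum>c\<in>UNIV. K c) + nat \<lceil>1 / \<epsilon>\<rceil> + 1"
  show ?thesis
  proof (rule exI[of _ k0], intro allI impI)
    fix k assume kk0: "k0 \<le> k"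
    have k: "k > 0" using kk0 by (simp add: k0_def)
    have "1 / \<epsilon> \<le> k" using kk0 unfolding k0_def by linarith
    then have k\<epsilon>: "1 / k \<le> \<epsilon>" using \<epsilon> k by (simp add: field_simps)
    have "K c \<le> k" for c using member_le_sum[of c UNIV K] kk0 by (simp add: k0_def)
    then have "\<forall>c. \<exists>n0. \<forall>n\<ge>n0. \<forall>I. ?S c k n I" by (intro allI K)
    from choice[OF this] obtain N0 where N1: "\<forall>c. \<forall>n\<ge>N0 c. \<forall>I. ?S c k n I"
      by (rule exE)
    note N0 = N1[THEN spec, THEN spec, THEN mp, THEN spec, THEN mp, THEN mp]
    \<comment> \<open>\<open>D / n\<close> is twice Chebyshev's bound for the sum of
      \<open>n\<close> terms of \<open>Y\<close> at level \<open>\<epsilon> * n / 3\<close>.\<close>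
    define D where "D = 18 * drift.second_moment / \<epsilon>\<^sup>2"
    have D: "D \<ge> 0" using drift.second_moment_nonneg by (simp add: D_def)
    define n0 where "n0 = (\<Sum>c\<in>UNIV. N0 c) + nat \<lceil>1 / \<epsilon>\<rceil> + nat \<lceil>3 * D / \<delta>\<rceil> + 1"
    show "\<exists>n0. \<forall>n\<ge>n0. prob {\<omega>\<in>space M. \<bar>path_hull n \<omega> - coords_hull k (block_coords k n \<omega>)\<bar> > \<delta>} \<le> \<delta>"
    proof (rule exI[of _ n0], intro allI impI)
      fix n assume nn0: "n0 \<le> n"
      have n: "n > 0" using nn0 by (simp add: n0_def)
      have "1 / \<epsilon> \<le> n" using nn0 unfolding n0_def by linarith
      then have n\<epsilon>: "1 / n \<le> \<epsilon>" using \<epsilon> n by (simp add: field_simps)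
      have "3 * D / \<delta> \<le> n" using nn0 unfolding n0_def by linarith
      then have Dn: "D / n \<le> \<delta> / 3" using \<delta> n by (simp add: field_simps)
      have N0n: "N0 c \<le> n" for c using member_le_sum[of c UNIV N0] nn0 by (simp add: n0_def)
      let ?a = "\<lambda>l. l * n div k" and ?len = "\<lambda>l. Suc l * n div k - l * n div k"
      \<comment> \<open>The exceptional events: \<open>B1\<close> for a large excursion along the
        drift, \<open>B2\<close> for a large oscillation inside a block, \<open>B3\<close> for a
        path that leaves the ball. The form \<open>3 * (...)\<close> and the lower limits
        \<open>0\<close> fit \<open>maximal_inequality\<close>.\<close>
      define B1 where "B1 = {\<omega>\<in>space M. \<exists>j\<le>n. \<bar>\<Sum>q=0..<0+j. Y q \<omega>\<bar> \<ge> 3 * (\<epsilon> * n / 3)}"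
      define B2 where "B2 c l = {\<omega>\<in>space M. \<exists>j\<le>?len l. \<bar>\<Sum>q=?a l..<?a l+j. Z q \<omega> $ c\<bar> \<ge> 3 * (\<epsilon> / 3 * sqrt n)}" for c l
      define B3 where "B3 c = {\<omega>\<in>space M. \<exists>j\<le>n. \<bar>\<Sum>q=0..<0+j. Z q \<omega> $ c\<bar> \<ge> 3 * (R * sqrt n / 3)}" for c
      have B1m: "B1 \<in> events" unfolding B1_def by measurable
      have B2m: "B2 c l \<in> events" for c l unfolding B2_def by measurable
      have B3m: "B3 c \<in> events" for c unfolding B3_def by measurable
      have P1: "prob B1 \<le> \<delta> / 3"
      proof -
        have "prob B1 \<le> 2 * (D / (2 * n))"
          unfolding B1_def
        proof (rule drift.maximal_inequality)
          show "\<epsilon> * n / 3 > 0" using \<epsilon> n by simp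
          fix i j assume ij: "i \<le> j" "j \<le> n"
          have "prob {\<omega>\<in>space M. \<bar>\<Sum>l=0+i..<0+j. Y l \<omega>\<bar> \<ge> \<epsilon> * n / 3} \<le> card {0+i..<0+j} * drift.second_moment / (\<epsilon> * n / 3)\<^sup>2"
            using \<epsilon> n by (intro drift.prob_sum_ge_le) auto
          also have "\<dots> \<le> n * drift.second_moment / (\<epsilon> * n / 3)\<^sup>2"
            using ij drift.second_moment_nonneg by (intro divide_right_mono mult_right_mono) auto
          also have "\<dots> = D / (2 * n)" using n \<epsilon> by (simp add: D_def field_simps power2_eq_square)
          finally show "prob {\<omega>\<in>space M. \<bar>\<Sum>l=0+i..<0+j. Y l \<omega>\<bar> \<ge> \<epsilon> * n / 3} \<le> D / (2 * n)" .
        qed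
        also have "2 * (D / (2 * n)) = D / n" by simp
        finally show ?thesis using Dn by linarith
      qed
      have P2: "real k * prob (B2 c l) \<le> 2 * \<eta>" for c l
      proof -
        have "prob (B2 c l) \<le> 2 * (\<eta> / k)"
          unfolding B2_def
        proof (rule iid_centred.maximal_inequality[OF coordinate_iid])
          show "\<epsilon> / 3 * sqrt n > 0" using \<epsilon> n by simp
          fix i j assume ij: "i \<le> j" "j \<le> ?len l"
          have "real k * prob {\<omega>\<in>space M. \<bar>\<Sum>q=?a l+i..<?a l+j. Z q \<omega> $ c\<bar> \<ge> \<epsilon> / 3 * sqrt n} \<le> \<eta>"
            using block_length_le[OF k, of l n] ij by (intro N0[OF N0n]) auto
          then show "prob {\<omega>\<in>space M. \<bar>\<Sum>q=?a l+i..<?a l+j. Z q \<omega> $ c\<bar> \<ge> \<epsilon> / 3 * sqrt n} \<le> \<eta> / k"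
            using k by (simp add: pos_le_divide_eq mult.commute)
        qed
        then show ?thesis using k by (simp add: field_simps)
      qed
      have P3: "prob (B3 c) \<le> 18 * s c / R\<^sup>2" for c
      proof -
        have "prob (B3 c) \<le> 2 * (9 * s c / R\<^sup>2)"
          unfolding B3_def
        proof (rule iid_centred.maximal_inequality[OF coordinate_iid])
          show "R * sqrt n / 3 > 0" using R n by simp
          fix i j assume ij: "i \<le> j" "j \<le> n"
          have "prob {\<omega>\<in>space M. \<bar>\<Sum>q=0+i..<0+j. Z q \<omega> $ c\<bar> \<ge> R * sqrt n / 3} \<le> card {0+i..<0+j} * s c / (R * sqrt n / 3)\<^sup>2"
            unfolding s_def using R n by (intro iid_centred.prob_sum_ge_le[OF coordinate_iid]) auto
          also have "\<dots> \<le> n * s c / (R * sqrt n / 3)\<^sup>2"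
            using ij s0 by (intro divide_right_mono mult_right_mono) auto
          also have "\<dots> = 9 * s c / R\<^sup>2" using n R by (simp add: power_divide power_mult_distrib)
          finally show "prob {\<omega>\<in>space M. \<bar>\<Sum>q=0+i..<0+j. Z q \<omega> $ c\<bar> \<ge> R * sqrt n / 3} \<le> 9 * s c / R\<^sup>2" .
        qed
        then show ?thesis by simp
      qed
      let ?B = "B1 \<union> ((\<Union>p\<in>UNIV \<times> {..<k}. B2 (fst p) (snd p)) \<union> (\<Union>c\<in>UNIV. B3 c))"
      let ?E = "{\<omega>\<in>space M. \<bar>path_hull n \<omega> - coords_hull k (block_coords k n \<omega>)\<bar> > \<delta>}"
      have sub: "?E \<subseteq> ?B"
      proof (rule subsetI, rule ccontr)
        fix \<omega> assume w: "\<omega> \<in> ?E" and nB: "\<omega> \<notin> ?B"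
        have sp: "\<omega> \<in> space M" using w by simp
        have "\<bar>path_hull n \<omega> - coords_hull k (block_coords k n \<omega>)\<bar> \<le> C * ((2 + m) * \<epsilon>)"
          unfolding C_def m_def
        proof (rule path_hull_close)
          show "k > 0" "1 / k \<le> \<epsilon>" "n > 0" "1 / n \<le> \<epsilon>" by fact+
          show "(2 + real CARD('m)) * \<epsilon> \<le> 1 / 2" using \<epsilon>1 by (simp add: m_def)
          show "R \<ge> 0" using R by simp
          show "\<bar>\<Sum>q<i. Y q \<omega>\<bar> \<le> \<epsilon> * n" if "i \<le> n" for i
          proof -
            have "\<omega> \<notin> B1" using nB by simp
            then have "\<not> \<bar>\<Sum>q=0..<0+i. Y q \<omega>\<bar> \<ge> 3 * (\<epsilon> * n / 3)"
              using sp that unfolding B1_def by blast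
            then show ?thesis by (simp add: atLeast0LessThan)
          qed
          show "\<bar>\<Sum>q<i. Z q \<omega> $ c\<bar> \<le> R * sqrt n" if "i \<le> n" for i c
          proof -
            have "\<omega> \<notin> B3 c" using nB by simp
            then have "\<not> \<bar>\<Sum>q=0..<0+i. Z q \<omega> $ c\<bar> \<ge> 3 * (R * sqrt n / 3)"
              using sp that unfolding B3_def by blast
            then show ?thesis by (simp add: atLeast0LessThan)
          qed
          show "\<bar>\<Sum>q=l * n div k..<i. Z q \<omega> $ c\<bar> \<le> \<epsilon> * sqrt n"
            if "l < k" "l * n div k \<le> i" "i \<le> Suc l * n div k" for l i c
          proof -
            have "\<omega> \<notin> B2 c l" using nB that(1) by auto
            moreover have "i - ?a l \<le> ?len l" using that(3) by (rule diff_le_mono)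
            ultimately have "\<not> \<bar>\<Sum>q=?a l..<?a l+(i - ?a l). Z q \<omega> $ c\<bar> \<ge> 3 * (\<epsilon> / 3 * sqrt n)"
              using sp unfolding B2_def by blast
            then show ?thesis using that by simp
          qed
        qed
        then show False using C\<epsilon> w by simp
      qed
      have "prob ?E \<le> prob ?B"
        by (rule finite_measure_mono[OF sub])
           (intro sets.Un sets.finite_UN B1m B2m B3m; simp)
      also have "\<dots> \<le> prob B1 + (prob (\<Union>p\<in>UNIV \<times> {..<k}. B2 (fst p) (snd p)) + prob (\<Union>c\<in>UNIV. B3 c))"
        by (rule order_trans[OF measure_Un_le], (intro sets.Un sets.finite_UN B1m B2m B3m; simp)+)
           (intro add_left_mono measure_Un_le sets.finite_UN B1m B2m B3m; simp)
      also have "prob (\<Union>p\<in>UNIV \<times> {..<k}. B2 (fst p) (snd p)) \<le> \<delta> / 3"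
      proof -
        have "prob (\<Union>p\<in>UNIV \<times> {..<k}. B2 (fst p) (snd p)) \<le> (\<Sum>p\<in>UNIV \<times> {..<k}. prob (B2 (fst p) (snd p)))"
          using B2m by (intro finite_measure_subadditive_finite) auto
        also have "\<dots> \<le> (\<Sum>p\<in>(UNIV :: 'm set) \<times> {..<k}. 2 * \<eta> / k)"
          using P2 k by (intro sum_mono) (simp add: pos_le_divide_eq mult.commute)
        also have "\<dots> = \<delta> / 3" using k m by (simp add: \<eta>_def m_def card_cartesian_product)
        finally show ?thesis .
      qed
      also have "prob (\<Union>c\<in>UNIV. B3 c) \<le> \<delta> / 3"
      proof -
        have "prob (\<Union>c\<in>UNIV. B3 c) \<le> (\<Sum>c\<in>UNIV. prob (B3 c))"
          using B3m by (intro finite_measure_subadditive_finite) auto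
        also have "\<dots> \<le> (\<Sum>c\<in>UNIV. 18 * s c / R\<^sup>2)" using P3 by (intro sum_mono)
        also have "\<dots> = 18 * S / R\<^sup>2" by (simp add: S_def sum_distrib_left sum_divide_distrib)
        finally show ?thesis using RS by linarith
      qed
      finally show "prob ?E \<le> \<delta>"
        using P1 by linarith
    qed
  qed
qed

end

section \<open>The limit theorem\<close>

lemma brownian_point:
  assumes "standard_brownian_motion N b" "\<omega> \<in> space N" "j \<le> k" "k > 0"
  shows "(\<chi> c. \<Sum>l<j. brownian_coords A b k \<omega> (l, c)) = A *v b (j / k) \<omega>"
proof -
  have b0: "b 0 \<omega> = 0" using assms by (simp add: standard_brownian_motion_def)
  have "(\<Sum>l<j. brownian_coords A b k \<omega> (l, c)) = (A *v b (j / k) \<omega>) $ c" for c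
  proof -
    have "(\<Sum>l<j. brownian_coords A b k \<omega> (l, c)) = (\<Sum>l<j. (A *v b (Suc l / k) \<omega>) $ c - (A *v b (l / k) \<omega>) $ c)"
      using assms by (intro sum.cong refl) (simp add: brownian_coords_def matrix_vector_mult_diff_distrib)
    also have "\<dots> = (A *v b (j / k) \<omega>) $ c"
      using sum_lessThan_telescope[of "\<lambda>l. (A *v b (real l / real k) \<omega>) $ c" j] by (simp add: b0)
    finally show ?thesis .
  qed
  then show ?thesis by (simp add: vec_eq_iff)
qed

lemma continuous_matrix_vector_mult: "continuous_on S ((*v) A)" for A :: "real^'p^'q"
  by (rule linear_continuous_on) (simp add: linear_conv_bounded_linear[symmetric])

text \<open>Pathwise: by uniform continuity on \<open>[0, 1]\<close> the grid points come uniformly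
  close to the whole curve, and the Lipschitz bound for hull volumes applies in a ball containing
  it.\<close>

lemma coords_hull_brownian_tendsto:
  fixes A :: "real^'m^'m"
  assumes bm: "standard_brownian_motion N b" and w: "\<omega> \<in> space N"
  shows "(\<lambda>k. coords_hull k (brownian_coords A b k \<omega>)) \<longlonglongrightarrow> hull_volume ((\<lambda>t. (t, A *v b t \<omega>)) ` {0..1})"
proof -
  let ?g = "\<lambda>t. (t, A *v b t \<omega>) :: real \<times> (real^'m)"
  have "continuous_on {0..} (\<lambda>t. b t \<omega>)" using assms by (simp add: standard_brownian_motion_def)
  then have "continuous_on {0..1} (\<lambda>t. b t \<omega>)" by (rule continuous_on_subset) (simp add: subset_eq)
  then have "continuous_on {0..1} (\<lambda>t. A *v b t \<omega>)"
    by (rule continuous_on_compose2[OF continuous_matrix_vector_mult[of UNIV]]) simp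
  then have cg: "continuous_on {0..1} ?g" by (intro continuous_on_Pair continuous_on_id)
  have compact: "compact (?g ` {0..1})" by (rule compact_continuous_image[OF cg compact_Icc])
  then have "bounded (?g ` {0..1})" by (rule compact_imp_bounded)
  then obtain R where "\<forall>p\<in>?g ` {0..1}. norm p \<le> R" unfolding bounded_iff by (rule exE)
  then have R: "?g ` {0..1} \<subseteq> cball 0 R" by (simp only: subset_eq mem_cball_0)
  define C where "C = hull_lipschitz TYPE(real \<times> (real^'m)) R"
  have C: "C \<ge> 0" by (simp add: C_def hull_lipschitz_nonneg)
  have uc: "uniformly_continuous_on {0..1} ?g" by (rule compact_uniformly_continuous[OF cg]) simp
  show ?thesis
  proof (rule LIMSEQ_I)
    fix e :: real assume e: "e > 0"
    define \<epsilon> where "\<epsilon> = min (1 / 2) (e / (2 * (C + 1)))"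
    have \<epsilon>: "\<epsilon> > 0" "\<epsilon> \<le> 1 / 2" using e C by (simp_all only: \<epsilon>_def min_less_iff_conj min.cobounded1) auto
    have "C * \<epsilon> \<le> (C + 1) * (e / (2 * (C + 1)))" unfolding \<epsilon>_def using C e by (intro mult_mono) auto
    also have "\<dots> = e / 2" using C by (simp add: field_simps)
    finally have Ce: "C * \<epsilon> < e" using e by simp
    obtain d where d: "d > 0" "\<And>s t. s \<in> {0..1} \<Longrightarrow> t \<in> {0..1} \<Longrightarrow> dist t s < d \<Longrightarrow> dist (?g t) (?g s) < \<epsilon>"
      using uc \<epsilon>(1) unfolding uniformly_continuous_on_def by blast
    define k0 where "k0 = nat \<lceil>1 / d\<rceil> + 1"
    show "\<exists>k0. \<forall>k\<ge>k0. norm (coords_hull k (brownian_coords A b k \<omega>) - hull_volume (?g ` {0..1})) < e"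
    proof (intro exI[of _ k0] allI impI)
      fix k assume kk0: "k0 \<le> k"
      have k: "k > 0" using kk0 by (simp add: k0_def)
      have "1 / d < k" using kk0 unfolding k0_def by linarith
      then have kd: "1 / k < d" using d k by (simp add: field_simps)
      have Q: "coords_hull k (brownian_coords A b k \<omega>) = hull_volume ((\<lambda>j. ?g (j / k)) ` {0..k})"
        unfolding coords_hull_def using brownian_point[OF bm w _ k]
        by (intro arg_cong[where f = "\<lambda>S. hull_volume S"] image_cong) auto
      have sub: "(\<lambda>j. ?g (real j / real k)) ` {0..k} \<subseteq> ?g ` {0..1}" using k by auto
      have "\<bar>hull_volume ((\<lambda>j. ?g (real j / real k)) ` {0..k}) - hull_volume (?g ` {0..1})\<bar> \<le> C * \<epsilon>"
        unfolding C_def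
      proof (rule measure_hull_close)
        show "compact ((\<lambda>j. ?g (real j / real k)) ` {0..k})" by (intro finite_imp_compact) simp
        show "(\<lambda>j. ?g (real j / real k)) ` {0..k} \<subseteq> cball 0 R" using sub R by blast
        show "\<exists>q\<in>?g ` {0..1}. dist p q \<le> \<epsilon>" if "p \<in> (\<lambda>j. ?g (real j / real k)) ` {0..k}" for p
          using that sub \<epsilon> by (intro bexI[of _ p]) auto
        show "\<exists>p\<in>(\<lambda>j. ?g (real j / real k)) ` {0..k}. dist p q \<le> \<epsilon>" if q: "q \<in> ?g ` {0..1}" for q
        proof -
          obtain t where t: "q = ?g t" "t \<in> {0..1}" using q by (rule imageE)
          define j where "j = nat \<lfloor>t * k\<rfloor>"
          have tk: "0 \<le> t * k" "t * k \<le> k" using t k by (auto intro: mult_left_le_one_le)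
          have j: "real j \<le> t * k" "t * k < real j + 1" using tk unfolding j_def by linarith+
          have jk: "j \<le> k" using j(1) tk by linarith
          have "j / k - t = (j - t * k) / k" using k by (simp add: field_simps)
          then have "\<bar>j / k - t\<bar> = \<bar>j - t * k\<bar> / k" by (simp add: abs_divide)
          also have "\<dots> \<le> 1 / k" using j k by (intro divide_right_mono) auto
          finally have "dist (j / k) t < d" using kd by (simp add: dist_real_def)
          then have "dist (?g (j / k)) (?g t) < \<epsilon>" using t(2) jk k by (intro d) auto
          then show ?thesis using jk unfolding t(1) by (intro bexI[of _ "?g (j / k)"] imageI less_imp_le) auto
        qed
      qed (use compact R \<epsilon> in auto)
      then show "norm (coords_hull k (brownian_coords A b k \<omega>) - hull_volume (?g ` {0..1})) < e"
        unfolding Q using Ce by simp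
    qed
  qed
qed

lemma spacetime_hull_matrix_image:
  fixes A :: "real^'m^'m"
  assumes bm: "standard_brownian_motion N b" and w: "\<omega> \<in> space N"
  shows "hull_volume ((\<lambda>t. (t, A *v b t \<omega>)) ` {0..1}) = \<bar>det A\<bar> * spacetime_hull_volume b \<omega>"
proof -
  have "continuous_on {0..} (\<lambda>t. b t \<omega>)" using assms by (simp add: standard_brownian_motion_def)
  then have "continuous_on {0..1} (\<lambda>t. b t \<omega>)" by (rule continuous_on_subset) auto
  then have "compact ((\<lambda>t. (t, b t \<omega>)) ` {0..1})"
    by (intro compact_continuous_image continuous_intros) auto
  then have cK: "compact (convex hull ((\<lambda>t. (t, b t \<omega>)) ` {0..1}))" by (rule compact_convex_hull)
  have lin: "linear (\<lambda>(t::real, x). (t, A *v x))"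
    by (auto intro!: linearI simp: matrix_vector_right_distrib matrix_vector_mult_scaleR)
  have "convex hull ((\<lambda>t. (t, A *v b t \<omega>)) ` {0..1}) = (\<lambda>(t, x). (t, A *v x)) ` (convex hull ((\<lambda>t. (t, b t \<omega>)) ` {0..1}))"
    unfolding convex_hull_linear_image[OF lin] by (simp add: image_image)
  then show ?thesis
    using measure_image_snd_linear[OF matrix_vector_mul_linear cK, of A]
    by (simp add: spacetime_hull_volume_def matrix_of_matrix_vector_mul)
qed

text \<open>The hull is spanned by uncountably many points, but its volume is a pointwise limit of
  volumes depending on finitely many of them; with \<open>mat 1\<close> the linear map drops
  out.\<close>

lemma measurable_spacetime_hull_volume:
  assumes bm: "standard_brownian_motion N b"
  shows "spacetime_hull_volume b \<in> borel_measurable N"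
proof (rule borel_measurable_LIMSEQ_real)
  show "(\<lambda>k. coords_hull k (brownian_coords (mat 1) b k \<omega>)) \<longlonglongrightarrow> spacetime_hull_volume b \<omega>" if "\<omega> \<in> space N" for \<omega>
    using coords_hull_brownian_tendsto[OF bm that, of "mat 1"] spacetime_hull_matrix_image[OF bm that, of "mat 1"]
    by simp
  show "(\<lambda>\<omega>. coords_hull k (brownian_coords (mat 1) b k \<omega>)) \<in> borel_measurable N" for k
    by (rule borel_measurable_continuous_on[OF continuous_coords_hull measurable_brownian_coords[OF bm]])
qed

section \<open>Convergence tested on piecewise linear functions\<close>

lemma cts_step_Lipschitz:
  assumes "x < y"
  shows "\<bar>cts_step x y a - cts_step x y b\<bar> \<le> \<bar>a - b\<bar> / (y - x)"
proof -
  \<comment> \<open>As a clamped affine function the step has a visible slope, and clamping does not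
    increase distances.\<close>
  have eq: "cts_step x y z = max 0 (min 1 ((y - z) / (y - x)))" for z
    using assms by (auto simp: cts_step_def max_def min_def divide_simps)
  have "\<bar>cts_step x y a - cts_step x y b\<bar> \<le> \<bar>(y - a) / (y - x) - (y - b) / (y - x)\<bar>"
    unfolding eq by linarith
  also have "\<dots> = \<bar>a - b\<bar> / (y - x)" using assms by (simp add: diff_divide_distrib[symmetric] abs_divide abs_minus_commute)
  finally show ?thesis .
qed

lemma cts_step_bounds: "x < y \<Longrightarrow> 0 \<le> cts_step x y z" "x < y \<Longrightarrow> cts_step x y z \<le> 1"
  by (auto simp: cts_step_def divide_simps)

lemma continuous_cts_step: "x < y \<Longrightarrow> continuous_on S (cts_step x y)"
  using cts_step_uniformly_continuous[of x y] uniformly_continuous_imp_continuous continuous_on_subset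
  by blast

context space_time_walk
begin

text \<open>The order of choices is \<open>\<delta>\<close>, then \<open>k\<close>, then
  \<open>n\<close>. The discretization error is small for all large \<open>n\<close> once
  \<open>k\<close> is fixed, so the limit in \<open>n\<close> can be taken at this \<open>k\<close>,
  whose Brownian counterpart is already close to the final value.\<close>

lemma cts_step_path_hull_tendsto:
  fixes N :: "'v measure" and b :: "real \<Rightarrow> 'v \<Rightarrow> real^'m"
  assumes bm: "standard_brownian_motion N b" and \<nu>: "\<nu> > 0" and xy: "x < y"
  shows "(\<lambda>n. expectation (\<lambda>\<omega>. cts_step x y (\<nu> * path_hull n \<omega>)))
    \<longlonglongrightarrow> (\<integral>\<omega>. cts_step x y (\<nu> * sqrt (det covariance) * spacetime_hull_volume b \<omega>) \<partial>N)"
proof -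
  interpret N: prob_space N using bm by (simp add: standard_brownian_motion_def)
  let ?I = "\<integral>\<omega>. cts_step x y (\<nu> * sqrt (det covariance) * spacetime_hull_volume b \<omega>) \<partial>N"
  obtain A :: "real^'m^'m" where A: "A ** transpose A = covariance" by (rule covariance_factorization)
  \<comment> \<open>Only the modulus of \<open>det A\<close> is visible in the limit, so the choice
    of the factor \<open>A\<close> is immaterial; a singular covariance gives the limit volume
    0.\<close>
  have "det covariance = (det A)\<^sup>2" by (simp add: A[symmetric] det_mul det_transpose power2_eq_square)
  then have detA: "sqrt (det covariance) = \<bar>det A\<bar>" by simp
  let ?f = "\<lambda>v. cts_step x y (\<nu> * v)"
  have cf: "continuous_on UNIV ?f"
    by (intro continuous_on_compose2[OF continuous_cts_step[OF xy, of UNIV]] continuous_intros) auto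
  have fb: "\<bar>?f v\<bar> \<le> 1" for v using cts_step_bounds[OF xy, of "\<nu> * v"] by simp
  have fm[measurable]: "?f \<in> borel_measurable borel" by (rule borel_measurable_continuous_onI[OF cf])
  let ?X = "\<lambda>k n \<omega>. coords_hull k (block_coords k n \<omega>)" and ?Y = "\<lambda>k \<omega>. coords_hull k (brownian_coords A b k \<omega>)"
  have Xm[measurable]: "?X k n \<in> borel_measurable M" for k n
    by (rule borel_measurable_continuous_on[OF continuous_coords_hull measurable_block_coords])
  have Ym[measurable]: "?Y k \<in> borel_measurable N" for k
    by (rule borel_measurable_continuous_on[OF continuous_coords_hull measurable_brownian_coords[OF bm]])
  have XY: "(\<lambda>n. expectation (\<lambda>\<omega>. ?f (?X k n \<omega>))) \<longlonglongrightarrow> (\<integral>\<omega>. ?f (?Y k \<omega>) \<partial>N)" if "k > 0" for k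
  proof (rule block_coords_convergence[OF bm that A, where F = "\<lambda>z. ?f (coords_hull k z)" and B = 1])
    show "continuous_on UNIV (\<lambda>z::nat \<times> 'm \<Rightarrow> real. ?f (coords_hull k z))"
      by (rule continuous_on_compose2[OF cf continuous_coords_hull]) simp
  qed (rule fb)
  have lim: "(\<lambda>k. \<integral>\<omega>. ?f (?Y k \<omega>) \<partial>N) \<longlonglongrightarrow> ?I"
  proof (rule integral_dominated_convergence[where w = "\<lambda>_. 1"])
    have [measurable]: "spacetime_hull_volume b \<in> borel_measurable N" by (rule measurable_spacetime_hull_volume[OF bm])
    have "(\<lambda>\<omega>. ?f (sqrt (det covariance) * spacetime_hull_volume b \<omega>)) \<in> borel_measurable N" by measurable
    then show "(\<lambda>\<omega>. cts_step x y (\<nu> * sqrt (det covariance) * spacetime_hull_volume b \<omega>)) \<in> borel_measurable N"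
      by (simp add: mult.assoc)
    show "AE \<omega> in N. (\<lambda>k. ?f (?Y k \<omega>)) \<longlonglongrightarrow> cts_step x y (\<nu> * sqrt (det covariance) * spacetime_hull_volume b \<omega>)"
    proof (rule AE_I2)
      fix \<omega> assume w: "\<omega> \<in> space N"
      have "(\<lambda>k. ?Y k \<omega>) \<longlonglongrightarrow> sqrt (det covariance) * spacetime_hull_volume b \<omega>"
        using coords_hull_brownian_tendsto[OF bm w, of A] unfolding spacetime_hull_matrix_image[OF bm w] detA .
      then have "(\<lambda>k. ?f (?Y k \<omega>)) \<longlonglongrightarrow> ?f (sqrt (det covariance) * spacetime_hull_volume b \<omega>)"
        by (rule continuous_on_tendsto_compose[OF cf]) auto
      then show "(\<lambda>k. ?f (?Y k \<omega>)) \<longlonglongrightarrow> cts_step x y (\<nu> * sqrt (det covariance) * spacetime_hull_volume b \<omega>)"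
        by (simp add: mult.assoc)
    qed
  qed (use fb in auto)
  show ?thesis
  proof (rule LIMSEQ_I)
    fix e :: real assume e: "e > 0"
    \<comment> \<open>Off the exceptional event the test function changes by at most
      \<open>\<nu> * \<delta> / (y - x)\<close>; on it by at most 1, which costs its probability, at
      most \<open>\<delta>\<close>. Together this is \<open>L * \<delta>\<close>.\<close>
    define L where "L = \<nu> / (y - x) + 1"
    have L: "L > 0" using \<nu> xy by (simp add: L_def add_pos_pos)
    define \<delta> where "\<delta> = e / (3 * L)"
    have \<delta>: "\<delta> > 0" using e L by (simp add: \<delta>_def)
    obtain k0 where k0: "\<And>k. k \<ge> k0 \<Longrightarrow> \<exists>n0. \<forall>n\<ge>n0. prob {\<omega>\<in>space M. \<bar>path_hull n \<omega> - ?X k n \<omega>\<bar> > \<delta>} \<le> \<delta>"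
      using path_hull_discretization[OF \<delta>] by blast
    have e3: "e / 3 > 0" using e by simp
    obtain k1 where k1: "\<And>k. k \<ge> k1 \<Longrightarrow> norm ((\<integral>\<omega>. ?f (?Y k \<omega>) \<partial>N) - ?I) < e / 3"
      using LIMSEQ_D[OF lim e3] by blast
    \<comment> \<open>Large enough for both approximations, and positive as the convergence of block
      increments requires.\<close>
    define k where "k = k0 + k1 + 1"
    obtain n0 where n0: "\<And>n. n \<ge> n0 \<Longrightarrow> prob {\<omega>\<in>space M. \<bar>path_hull n \<omega> - ?X k n \<omega>\<bar> > \<delta>} \<le> \<delta>"
      using k0[of k] by (auto simp: k_def)
    obtain n1 where n1: "\<And>n. n \<ge> n1 \<Longrightarrow> norm (expectation (\<lambda>\<omega>. ?f (?X k n \<omega>)) - (\<integral>\<omega>. ?f (?Y k \<omega>) \<partial>N)) < e / 3"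
      using LIMSEQ_D[OF XY e3, of k] by (auto simp: k_def)
    show "\<exists>no. \<forall>n\<ge>no. norm (expectation (\<lambda>\<omega>. ?f (path_hull n \<omega>)) - ?I) < e"
    proof (intro exI[of _ "n0 + n1"] allI impI)
      fix n assume n: "n0 + n1 \<le> n"
      let ?E = "{\<omega>\<in>space M. \<bar>path_hull n \<omega> - ?X k n \<omega>\<bar> > \<delta>}"
      have E: "?E \<in> events" by measurable
      have i1: "integrable M (\<lambda>\<omega>. ?f (path_hull n \<omega>))" by (rule integrable_const_bound[of _ 1]) (use fb in auto)
      have i2: "integrable M (\<lambda>\<omega>. ?f (?X k n \<omega>))" by (rule integrable_const_bound[of _ 1]) (use fb in auto)
      have "\<bar>expectation (\<lambda>\<omega>. ?f (path_hull n \<omega>)) - expectation (\<lambda>\<omega>. ?f (?X k n \<omega>))\<bar>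
         = \<bar>expectation (\<lambda>\<omega>. ?f (path_hull n \<omega>) - ?f (?X k n \<omega>))\<bar>" using i1 i2 by simp
      also have "\<dots> \<le> expectation (\<lambda>\<omega>. \<bar>?f (path_hull n \<omega>) - ?f (?X k n \<omega>)\<bar>)" by (rule integral_abs_bound)
      also have "\<dots> \<le> expectation (\<lambda>\<omega>. \<nu> * \<delta> / (y - x) + indicator ?E \<omega>)"
      proof (rule integral_mono)
        show "integrable M (\<lambda>\<omega>. \<nu> * \<delta> / (y - x) + indicator ?E \<omega>)"
          using E by (intro Bochner_Integration.integrable_add integrable_const integrable_real_indicator) (auto simp: less_top[symmetric])
        fix \<omega> assume w: "\<omega> \<in> space M"
        show "\<bar>?f (path_hull n \<omega>) - ?f (?X k n \<omega>)\<bar> \<le> \<nu> * \<delta> / (y - x) + indicator ?E \<omega>"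
        proof (cases "\<omega> \<in> ?E")
          case True
          have "\<nu> * \<delta> / (y - x) \<ge> 0" using \<nu> \<delta> xy by simp
          then show ?thesis using True cts_step_bounds[OF xy, of "\<nu> * path_hull n \<omega>"] cts_step_bounds[OF xy, of "\<nu> * ?X k n \<omega>"]
            by simp
        next
          case False
          then have "\<bar>path_hull n \<omega> - ?X k n \<omega>\<bar> \<le> \<delta>" using w by simp
          then have "\<bar>\<nu> * path_hull n \<omega> - \<nu> * ?X k n \<omega>\<bar> \<le> \<nu> * \<delta>"
            using \<nu> by (simp add: abs_mult flip: right_diff_distrib)
          then have "\<bar>\<nu> * path_hull n \<omega> - \<nu> * ?X k n \<omega>\<bar> / (y - x) \<le> \<nu> * \<delta> / (y - x)"
            using xy by (intro divide_right_mono) auto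
          then show ?thesis using cts_step_Lipschitz[OF xy, of "\<nu> * path_hull n \<omega>" "\<nu> * ?X k n \<omega>"] False by simp
        qed
      qed (use i1 i2 in auto)
      also have "\<dots> = \<nu> * \<delta> / (y - x) + prob ?E"
        using E by (subst Bochner_Integration.integral_add) (auto simp: prob_space less_top[symmetric])
      also have "\<dots> \<le> L * \<delta>" using n0[of n] n by (simp add: L_def algebra_simps)
      also have "L * \<delta> = e / 3" using L by (simp add: \<delta>_def)
      finally have "\<bar>expectation (\<lambda>\<omega>. ?f (path_hull n \<omega>)) - expectation (\<lambda>\<omega>. ?f (?X k n \<omega>))\<bar> \<le> e / 3" .
      moreover have "n \<ge> n1" "k \<ge> k1" using n by (simp_all add: k_def)
      note n1[OF this(1)] k1[OF this(2)]
      ultimately show "norm (expectation (\<lambda>\<omega>. ?f (path_hull n \<omega>)) - ?I) < e"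
        unfolding real_norm_def by linarith
    qed
  qed
qed

end

section \<open>Reduction of the given walk to coordinates along and across the drift\<close>

text \<open>Applied to \<open>Suc\<close>: the partial sums begin with the step of index 1, the
  families in the locales with index 0.\<close>

lemma (in prob_space) indep_vars_reindex:
  assumes "indep_vars (\<lambda>_. borel) X UNIV" "inj f"
  shows "indep_vars (\<lambda>_. borel) (\<lambda>i. X (f i)) UNIV"
proof -
  let ?F = "\<lambda>i. {X i -` A \<inter> space M | A. A \<in> sets borel}"
  have "indep_sets (\<lambda>i. ?F (f i)) UNIV"
  proof (rule indep_setsI)
    show "?F (f i) \<subseteq> events" for i
      using assms(1) unfolding indep_vars_def2 indep_sets_def by blast
    fix A J assume J: "J \<noteq> {}" "J \<subseteq> UNIV" "finite J" and A: "\<forall>j\<in>J. A j \<in> ?F (f j)"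
    let ?B = "\<lambda>i. A (the_inv f i)"
    have inv: "the_inv f (f j) = j" for j by (rule the_inv_f_f[OF assms(2)])
    have "prob (\<Inter>i\<in>f ` J. ?B i) = (\<Prod>i\<in>f ` J. prob (?B i))"
      using assms(1) J A unfolding indep_vars_def2 by (intro indep_setsD[of ?F UNIV]) (auto simp: inv)
    then show "prob (\<Inter>j\<in>J. A j) = (\<Prod>j\<in>J. prob (A j))"
      using inj_on_subset[OF assms(2)] by (simp add: inv prod.reindex)
  qed
  then show ?thesis using assms(1) unfolding indep_vars_def2 by auto
qed

text \<open>The remainder of the expansion of \<open>x\<close> is orthogonal to the span of the
  basis, which is the whole space, hence to itself.\<close>

lemma orthonormal_basis_inner:
  fixes u :: "'i::finite \<Rightarrow> 'a::euclidean_space"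
  assumes u: "orthonormal_basis u"
  shows "x \<bullet> y = (\<Sum>i\<in>UNIV. (x \<bullet> u i) * (y \<bullet> u i))"
proof -
  have uu: "u i \<bullet> u j = (if i = j then 1 else 0)" for i j using u by (simp add: orthonormal_basis_def)
  define z where "z = x - (\<Sum>i\<in>UNIV. (x \<bullet> u i) *\<^sub>R u i)"
  have "z \<bullet> u j = 0" for j
    by (simp add: z_def inner_diff_left inner_sum_left uu if_distrib cong: if_cong)
  then have "orthogonal z v" if "v \<in> span (range u)" for v
    using that by (intro orthogonal_to_span[of v "range u" z]) (auto simp: orthogonal_def)
  then have "orthogonal z z" using u by (simp add: orthonormal_basis_def)
  then have "x = (\<Sum>i\<in>UNIV. (x \<bullet> u i) *\<^sub>R u i)" by (simp add: orthogonal_def z_def)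
  then have "x \<bullet> y = (\<Sum>i\<in>UNIV. (x \<bullet> u i) *\<^sub>R u i) \<bullet> y" by (rule arg_cong)
  also have "\<dots> = (\<Sum>i\<in>UNIV. (x \<bullet> u i) * (u i \<bullet> y))" by (simp only: inner_sum_left inner_scaleR_left)
  finally show ?thesis by (simp only: inner_commute[of y])
qed

lemma linear_perp_coords: "linear (perp_coords u)"
  by (auto intro!: linearI simp: perp_coords_def vec_eq_iff inner_add_left)

lemma orthonormal_coords_isometry:
  fixes u :: "'m::finite option \<Rightarrow> real^'n"
  assumes u: "orthonormal_basis u"
  shows "(x \<bullet> u None, perp_coords u x) \<bullet> (y \<bullet> u None, perp_coords u y) = x \<bullet> y"
proof -
  have "x \<bullet> y = (x \<bullet> u None) * (y \<bullet> u None) + (\<Sum>i\<in>UNIV. (x \<bullet> u (Some i)) * (y \<bullet> u (Some i)))"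
    unfolding orthonormal_basis_inner[OF u, of x y] UNIV_option_conv
    by (simp add: sum.reindex)
  then show ?thesis by (simp add: perp_coords_def inner_vec_def)
qed

lemma measurable_walk_hull_volume:
  assumes "\<And>i. \<xi> i \<in> borel_measurable M"
  shows "walk_hull_volume \<xi> n \<in> borel_measurable M"
proof -
  let ?V = "\<lambda>x::nat \<Rightarrow> real^'n. hull_volume ((\<lambda>i. x i) ` {0..n})"
  have V: "?V \<in> borel_measurable borel"
    by (intro borel_measurable_continuous_onI continuous_measure_hull_finite continuous_on_product_coordinates) auto
  have "(\<lambda>\<omega> k. partial_sum \<xi> k \<omega>) \<in> borel_measurable M"
    unfolding partial_sum_def using assms by (intro measurable_coordinatewise_then_product borel_measurable_sum)
  from measurable_compose[OF this V] show ?thesis unfolding walk_hull_volume_def by simp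
qed

text \<open>The isometry \<open>?T\<close> passes to coordinates along and across the drift, where
  the walk is the image of the scaled path under the diagonal map \<open>?F\<close> with Jacobian
  \<open>\<nu> * n * sqrt n ^ CARD('m)\<close>. Dividing the increments along the drift by
  \<open>\<nu>\<close> gives the first coordinate unit speed and puts the factor
  \<open>\<nu>\<close> in front.\<close>

lemma walk_hull_volume_rescaled:
  fixes \<xi> :: "nat \<Rightarrow> 'w \<Rightarrow> real^'n" and u :: "'m::finite option \<Rightarrow> real^'n"
  assumes u: "orthonormal_basis u" and dim: "CARD('n) = CARD('m) + 1" and \<nu>: "\<nu> > 0" and n: "n > 0"
    and walk: "space_time_walk M (\<lambda>i \<omega>. perp_coords u (\<xi> (Suc i) \<omega>)) (\<lambda>i \<omega>. (\<xi> (Suc i) \<omega> \<bullet> u None - \<nu>) / \<nu>)"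
  shows "real n powr (- (real CARD('n) + 1) / 2) * walk_hull_volume \<xi> n \<omega>
    = \<nu> * space_time_walk.path_hull (\<lambda>i \<omega>. perp_coords u (\<xi> (Suc i) \<omega>)) (\<lambda>i \<omega>. (\<xi> (Suc i) \<omega> \<bullet> u None - \<nu>) / \<nu>) n \<omega>"
proof -
  let ?T = "\<lambda>x. (x \<bullet> u None, perp_coords u x)"
  let ?P = "space_time_walk.scaled_path (\<lambda>i \<omega>. perp_coords u (\<xi> (Suc i) \<omega>)) (\<lambda>i \<omega>. (\<xi> (Suc i) \<omega> \<bullet> u None - \<nu>) / \<nu>) n \<omega>"
  let ?F = "\<lambda>(t, x). (\<nu> * n * t, sqrt n *\<^sub>R x) :: real \<times> (real^'m)"
  have lT: "linear ?T"
    using linear_perp_coords[of u] by (auto intro!: linearI simp: inner_add_left linear_add linear_scale)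
  have lF: "linear ?F" by (auto intro!: linearI simp: algebra_simps)
  have point: "?T (partial_sum \<xi> i \<omega>) = ?F (?P i)" for i
  proof -
    have S: "partial_sum \<xi> i \<omega> = (\<Sum>q<i. \<xi> (Suc q) \<omega>)"
      unfolding partial_sum_def by (simp add: sum.atLeast1_atMost_eq)
    have "(\<Sum>q<i. (\<xi> (Suc q) \<omega> \<bullet> u None - \<nu>) / \<nu>) = (\<Sum>q<i. \<xi> (Suc q) \<omega>) \<bullet> u None / \<nu> - i"
      using \<nu> by (simp add: inner_sum_left diff_divide_distrib sum_subtractf sum_divide_distrib)
    then show ?thesis
      unfolding space_time_walk.scaled_path_def[OF walk] S
      using \<nu> n linear_sum[OF linear_perp_coords[of u]] by simp
  qed
  have "walk_hull_volume \<xi> n \<omega> = measure lborel (?T ` (convex hull ((\<lambda>k. partial_sum \<xi> k \<omega>) ` {0..n})))"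
    unfolding walk_hull_volume_def
  proof (rule measure_isometry_image[OF lT orthonormal_coords_isometry[OF u], symmetric])
    show "DIM(real \<times> (real^'m)) = CARD('n)" using dim by simp
    show "compact (convex hull ((\<lambda>k. partial_sum \<xi> k \<omega>) ` {0..n}))"
      by (rule compact_convex_hull) (simp add: finite_imp_compact)
  qed
  also have "?T ` (convex hull ((\<lambda>k. partial_sum \<xi> k \<omega>) ` {0..n})) = ?F ` (convex hull (?P ` {0..n}))"
    unfolding convex_hull_linear_image[OF lT] convex_hull_linear_image[OF lF] image_image point ..
  also have "measure lborel \<dots> = (\<nu> * n) * sqrt n ^ CARD('m) * hull_volume (?P ` {0..n})"
    using \<nu> n by (intro measure_image_scaling compact_convex_hull finite_imp_compact) auto
  finally have vol: "walk_hull_volume \<xi> n \<omega> = \<nu> * (n * sqrt n ^ CARD('m)) * hull_volume (?P ` {0..n})"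
    by simp
  \<comment> \<open>The exponents cancel because
    \<open>(d + 1) / 2 = 1 + (d - 1) / 2\<close>.\<close>
  have "real n powr (- (real CARD('n) + 1) / 2) * (n * sqrt n ^ CARD('m)) = 1"
  proof -
    have "sqrt n ^ CARD('m) = real n powr (real CARD('m) / 2)"
      using n by (simp add: powr_half_sqrt[symmetric] powr_realpow[symmetric] powr_powr)
    then have "n * sqrt n ^ CARD('m) = real n powr (1 + real CARD('m) / 2)"
      using n by (simp add: powr_add)
    then have "real n powr (- (real CARD('n) + 1) / 2) * (n * sqrt n ^ CARD('m)) = real n powr (- (real CARD('n) + 1) / 2 + (1 + real CARD('m) / 2))"
      by (simp only: powr_add)
    also have "- (real CARD('n) + 1) / 2 + (1 + real CARD('m) / 2) = 0" using dim by (simp add: field_simps)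
    finally show ?thesis using n by simp
  qed
  then have "real n powr (- (real CARD('n) + 1) / 2) * (\<nu> * (n * sqrt n ^ CARD('m)) * v) = \<nu> * v" for v
    by (metis (no_types, lifting) mult.commute mult.left_commute mult_1)
  then show ?thesis unfolding vol space_time_walk.path_hull_def[OF walk] by blast
qed

theorem theorem6p13:
  fixes d :: nat
    and M :: "'w measure" and \<xi> :: "nat \<Rightarrow> 'w \<Rightarrow> real ^ 'n"
    and \<mu> :: "real ^ 'n" and u :: "'m::finite option \<Rightarrow> real ^ 'n"
    and N :: "'v measure" and b :: "real \<Rightarrow> 'v \<Rightarrow> real ^ 'm"
  assumes "d \<ge> 2" and "CARD('n) = d" and "CARD('m) = d - 1"
    and "prob_space M"
    and "prob_space.indep_vars M (\<lambda>_. borel) \<xi> UNIV"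
    and "\<And>i. distr M borel (\<xi> i) = distr M borel (\<xi> 0)"
    and "integrable M (\<lambda>\<omega>. (norm (\<xi> 0 \<omega>))\<^sup>2)"
    and "integral\<^sup>L M (\<xi> 0) = \<mu>" and "norm \<mu> > 0"
    and "orthonormal_basis u" and "u None = \<mu> /\<^sub>R norm \<mu>"
    and "standard_brownian_motion N b"
  shows "converges_in_distribution
           M (\<lambda>n \<omega>. real n powr (- (real d + 1) / 2) * walk_hull_volume \<xi> n \<omega>)
           N (\<lambda>\<omega>. norm \<mu> * sqrt (det (second_moment_matrix M (\<lambda>\<omega>'. perp_coords u (\<xi> 0 \<omega>'))))
                    * spacetime_hull_volume b \<omega>)"
proof -
  note indep = assms(5) and ident = assms(6) and sq = assms(7) and mean = assms(8)
    and \<mu> = assms(9) and u = assms(10) and u0 = assms(11) and bm = assms(12)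
  interpret prob_space M by fact
  interpret N: prob_space N using bm by (simp add: standard_brownian_motion_def)
  define \<nu> where "\<nu> = norm \<mu>"
  have \<nu>: "\<nu> > 0" using \<mu> by (simp add: \<nu>_def)
  have \<xi>m[measurable]: "\<xi> i \<in> borel_measurable M" for i
    using indep unfolding indep_vars_def2 by simp
  have uu: "u i \<bullet> u j = (if i = j then 1 else 0)" for i j using u by (simp add: orthonormal_basis_def)
  \<comment> \<open>The coordinates across the drift are centred, so their second moment matrix is a
    covariance matrix; the coordinate along it has mean \<open>\<nu>\<close>.\<close>
  have \<mu>u: "\<mu> \<bullet> u i = (if i = None then \<nu> else 0)" for i
  proof -
    have "\<mu> = \<nu> *\<^sub>R u None" using u0 \<nu> by (simp add: \<nu>_def)
    then show ?thesis by (simp add: uu)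
  qed
  have int\<xi>: "integrable M (\<xi> 0)"
  proof -
    have "integrable M (\<lambda>\<omega>. norm (\<xi> 0 \<omega>))" by (rule square_integrable_imp_integrable[OF _ sq]) simp
    then show ?thesis by (simp add: integrable_norm_iff)
  qed
  have distr_f: "distr M borel (\<lambda>\<omega>. f (\<xi> i \<omega>)) = distr M borel (\<lambda>\<omega>. f (\<xi> 0 \<omega>))"
    if [measurable]: "f \<in> borel_measurable borel" for f :: "real^'n \<Rightarrow> 'c::topological_space" and i
  proof -
    have "distr M borel (\<lambda>\<omega>. f (\<xi> j \<omega>)) = distr (distr M borel (\<xi> j)) borel f" for j
      by (subst distr_distr) (auto simp: comp_def)
    then show ?thesis by (simp only: ident[of i])
  qed
  \<comment> \<open>The hypotheses concern \<open>\<xi> 0\<close>, whereas the walk starts with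
    \<open>\<xi> (Suc 0)\<close>; moments are carried over through the common law.\<close>
  have transfer: "integrable M (\<lambda>\<omega>. f (\<xi> i \<omega>)) \<longleftrightarrow> integrable M (\<lambda>\<omega>. f (\<xi> 0 \<omega>))"
      "expectation (\<lambda>\<omega>. f (\<xi> i \<omega>)) = expectation (\<lambda>\<omega>. f (\<xi> 0 \<omega>))"
    if [measurable]: "f \<in> borel_measurable borel" for f :: "real^'n \<Rightarrow> 'c::{banach, second_countable_topology}" and i
  proof -
    have "integrable M (\<lambda>\<omega>. f (\<xi> j \<omega>)) \<longleftrightarrow> integrable (distr M borel (\<xi> j)) f" for j
      by (subst integrable_distr_eq) auto
    then show "integrable M (\<lambda>\<omega>. f (\<xi> i \<omega>)) \<longleftrightarrow> integrable M (\<lambda>\<omega>. f (\<xi> 0 \<omega>))" by (simp only: ident[of i])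
    have "expectation (\<lambda>\<omega>. f (\<xi> j \<omega>)) = (\<integral>x. f x \<partial>distr M borel (\<xi> j))" for j
      by (subst integral_distr) auto
    then show "expectation (\<lambda>\<omega>. f (\<xi> i \<omega>)) = expectation (\<lambda>\<omega>. f (\<xi> 0 \<omega>))" by (simp only: ident[of i])
  qed
  have bl: "bounded_linear (perp_coords u)" using linear_perp_coords linear_conv_bounded_linear by blast
  have pm[measurable]: "perp_coords u \<in> borel_measurable borel"
    by (intro borel_measurable_continuous_onI linear_continuous_on bl)
  have pc: "perp_coords u x $ c = x \<bullet> u (Some c)" for x c by (simp add: perp_coords_def)
  have norm_perp: "norm (perp_coords u x) \<le> norm x" for x
  proof -
    have "(norm x)\<^sup>2 = (x \<bullet> u None)\<^sup>2 + (norm (perp_coords u x))\<^sup>2"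
      using orthonormal_coords_isometry[OF u, of x x] unfolding power2_norm_eq_inner by (simp add: power2_eq_square)
    then have "(norm (perp_coords u x))\<^sup>2 \<le> (norm x)\<^sup>2" by simp
    then show ?thesis by (rule power2_le_imp_le) simp
  qed
  let ?Z = "\<lambda>i \<omega>. perp_coords u (\<xi> (Suc i) \<omega>)" and ?Y = "\<lambda>i \<omega>. (\<xi> (Suc i) \<omega> \<bullet> u None - \<nu>) / \<nu>"
  have indep': "indep_vars (\<lambda>_. borel) (\<lambda>i. \<xi> (Suc i)) UNIV"
    by (rule indep_vars_reindex[OF indep]) simp
  have Z: "centred_vector_walk M ?Z"
  proof
    show "indep_vars (\<lambda>_. borel) ?Z UNIV" by (rule indep_vars_compose2[OF indep']) simp
    show "distr M borel (?Z i) = distr M borel (?Z 0)" for i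
      using distr_f[OF pm, of "Suc i"] distr_f[OF pm, of "Suc 0"] by simp
    have "integrable M (\<lambda>\<omega>. (norm (perp_coords u (\<xi> 0 \<omega>)))\<^sup>2)"
      by (rule Bochner_Integration.integrable_bound[OF sq]) (auto intro!: power_mono norm_perp)
    then show "integrable M (\<lambda>\<omega>. (norm (?Z 0 \<omega>))\<^sup>2)"
      by (subst transfer(1)[of "\<lambda>x. (norm (perp_coords u x))\<^sup>2" "Suc 0"]) auto
    have "expectation (?Z 0) = expectation (\<lambda>\<omega>. perp_coords u (\<xi> 0 \<omega>))"
      by (rule transfer(2)) simp
    also have "\<dots> = perp_coords u \<mu>" using integral_bounded_linear[OF bl int\<xi>] mean by simp
    also have "\<dots> = 0" by (simp add: vec_eq_iff pc \<mu>u)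
    finally show "expectation (?Z 0) = 0" .
  qed
  have Y: "iid_centred M ?Y"
  proof
    let ?f = "\<lambda>x. (x \<bullet> u None - \<nu>) / \<nu>"
    have fm[measurable]: "?f \<in> borel_measurable borel" by measurable
    show "indep_vars (\<lambda>_. borel) ?Y UNIV" by (rule indep_vars_compose2[OF indep']) simp
    show "distr M borel (?Y i) = distr M borel (?Y 0)" for i
      using distr_f[OF fm, of "Suc i"] distr_f[OF fm, of "Suc 0"] by simp
    have i1: "integrable M (\<lambda>\<omega>. \<xi> 0 \<omega> \<bullet> u None)" using int\<xi> by simp
    have i2: "integrable M (\<lambda>\<omega>. (\<xi> 0 \<omega> \<bullet> u None)\<^sup>2)"
    proof (rule Bochner_Integration.integrable_bound[OF sq])
      have "norm (u None) = 1" by (simp add: norm_eq_sqrt_inner uu)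
      then have "\<bar>x \<bullet> u None\<bar> \<le> norm x" for x using Cauchy_Schwarz_ineq2[of x "u None"] by simp
      then show "AE \<omega> in M. norm ((\<xi> 0 \<omega> \<bullet> u None)\<^sup>2) \<le> norm ((norm (\<xi> 0 \<omega>))\<^sup>2)"
        by (simp add: abs_le_square_iff[symmetric])
    qed measurable
    have eq: "(\<lambda>\<omega>. (?f (\<xi> 0 \<omega>))\<^sup>2) = (\<lambda>\<omega>. ((\<xi> 0 \<omega> \<bullet> u None)\<^sup>2 - 2 * \<nu> * (\<xi> 0 \<omega> \<bullet> u None) + \<nu>\<^sup>2) / \<nu>\<^sup>2)"
      by (simp add: power_divide power2_diff algebra_simps)
    have "integrable M (\<lambda>\<omega>. (?f (\<xi> 0 \<omega>))\<^sup>2)" unfolding eq using i1 i2 by simp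
    then show "integrable M (\<lambda>\<omega>. (?Y 0 \<omega>)\<^sup>2)"
      by (subst transfer(1)[of "\<lambda>x. (?f x)\<^sup>2" "Suc 0"]) auto
    have "expectation (?Y 0) = expectation (\<lambda>\<omega>. ?f (\<xi> 0 \<omega>))"
      by (rule transfer(2)) (rule fm)
    also have "\<dots> = (\<mu> \<bullet> u None - \<nu>) / \<nu>" using int\<xi> i1 mean by (simp add: prob_space)
    finally show "expectation (?Y 0) = 0" by (simp add: \<mu>u)
  qed
  interpret walk: space_time_walk M ?Z ?Y by (intro space_time_walk.intro Z Y)
  have cov: "second_moment_matrix M (?Z 0) = second_moment_matrix M (\<lambda>\<omega>. perp_coords u (\<xi> 0 \<omega>))"
  proof -
    have "expectation (\<lambda>\<omega>. (\<xi> (Suc 0) \<omega> \<bullet> u (Some i)) * (\<xi> (Suc 0) \<omega> \<bullet> u (Some j)))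
        = expectation (\<lambda>\<omega>. (\<xi> 0 \<omega> \<bullet> u (Some i)) * (\<xi> 0 \<omega> \<bullet> u (Some j)))" for i j
      by (rule transfer(2)[of "\<lambda>x. (x \<bullet> u (Some i)) * (x \<bullet> u (Some j))"]) measurable
    then show ?thesis unfolding second_moment_matrix_def by (simp only: pc)
  qed
  have dim: "CARD('n) = CARD('m) + 1" using assms(1-3) by simp
  let ?X = "\<lambda>n \<omega>. real n powr (- (real d + 1) / 2) * walk_hull_volume \<xi> n \<omega>"
  let ?L = "\<lambda>\<omega>. norm \<mu> * sqrt (det (second_moment_matrix M (\<lambda>\<omega>'. perp_coords u (\<xi> 0 \<omega>')))) * spacetime_hull_volume b \<omega>"
  have Xm[measurable]: "?X n \<in> borel_measurable M" for n
    using measurable_walk_hull_volume[of \<xi> M n, OF \<xi>m] by simp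
  have Lm[measurable]: "?L \<in> borel_measurable N"
    using measurable_spacetime_hull_volume[OF bm] by simp
  have X: "?X n \<omega> = \<nu> * walk.path_hull n \<omega>" if "n > 0" for n \<omega>
    using walk_hull_volume_rescaled[OF u dim \<nu> that walk.space_time_walk_axioms, of \<omega>] assms(2) by simp
  have "weak_conv_m (\<lambda>n. distr M borel (?X n)) (distr N borel ?L)"
  \<comment> \<open>Piecewise linear steps bracket the indicators of half-lines, so convergence of
    their integrals is enough for weak convergence.\<close>
  proof (rule integral_cts_step_conv_imp_weak_conv)
    show "real_distribution (distr M borel (?X n))" for n by (rule real_distribution_distr) (rule Xm)
    show "real_distribution (distr N borel ?L)" by (rule N.real_distribution_distr) (rule Lm)
    fix x y :: real assume xy: "x < y"
    have cm: "cts_step x y \<in> borel_measurable borel"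
      by (rule borel_measurable_continuous_onI[OF continuous_cts_step[OF xy]])
    have "(\<lambda>n. expectation (\<lambda>\<omega>. cts_step x y (\<nu> * walk.path_hull n \<omega>)))
      \<longlonglongrightarrow> (\<integral>\<omega>. cts_step x y (?L \<omega>) \<partial>N)"
      using walk.cts_step_path_hull_tendsto[OF bm \<nu> xy] unfolding cov \<nu>_def .
    moreover have "\<forall>\<^sub>F n in sequentially. expectation (\<lambda>\<omega>. cts_step x y (\<nu> * walk.path_hull n \<omega>)) = expectation (\<lambda>\<omega>. cts_step x y (?X n \<omega>))"
      using eventually_gt_at_top[of 0] by eventually_elim (simp only: X)
    ultimately have "(\<lambda>n. expectation (\<lambda>\<omega>. cts_step x y (?X n \<omega>))) \<longlonglongrightarrow> (\<integral>\<omega>. cts_step x y (?L \<omega>) \<partial>N)"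
      by (rule Lim_transform_eventually)
    moreover have "integral\<^sup>L (distr M borel (?X n)) (cts_step x y) = expectation (\<lambda>\<omega>. cts_step x y (?X n \<omega>))" for n
      by (rule integral_distr[OF Xm cm])
    moreover have "integral\<^sup>L (distr N borel ?L) (cts_step x y) = (\<integral>\<omega>. cts_step x y (?L \<omega>) \<partial>N)"
      by (rule integral_distr[OF Lm cm])
    ultimately show "(\<lambda>n. integral\<^sup>L (distr M borel (?X n)) (cts_step x y)) \<longlonglongrightarrow> integral\<^sup>L (distr N borel ?L) (cts_step x y)"
      by (simp only:)
  qed
  then show ?thesis
    unfolding converges_in_distribution_def using Xm Lm by blast
qed

end
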